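(* Let $n\ge1$, $\mathfrak g=\mathfrak{osp}(2n+1|2n)$ with $f=\sum_{i=1}^{2n}F_{i+1,i}$ and $E_{ij}=\frac12(-1)^{p(i)}F_{ij}$ as in the context. Let $\mathcal A$ be the $(4n+1)\times(4n+1)$ matrix with entries in $\mathcal V(\bar{\mathfrak p})[D]$ given by $\mathcal A_{ij}=\delta_{ij}D+\bar E_{ji}$ for $i\le j$ and $\mathcal A_{ij}=-f_{ij}$ for $i>j$, where $f=\sum_{i,j}f_{ij}e_{ij}$ is the matrix of $f$ in $\mathfrak{gl}(2n+1|2n)$ (explicitly $f_{j+1,j}=(-1)^{\delta_j}$, other $f_{ij}=0$). Write $\operatorname{rdet}(\mathcal A)=\sum_{t=0}^{4n+1}w_{4n+1-t}D^t$ with $w_t\in\mathcal V(\bar{\mathfrak p})$. Then $w_1,\dots,w_{4n+1}\in\mathcal W(\bar{\mathfrak g},f)$, and the set $\{w_t: 1\le t\le 4n+1,\ t\equiv0\text{ or }3\pmod4\}$ freely generates $\mathcal W(\bar{\mathfrak g},f)$ as a differential algebra; that is, $\mathcal W(\bar{\mathfrak g},f)=\mathbb C[w_t^{(m)}\mid m\ge0,\ t\equiv0,3\ (\mathrm{mod}\ 4)]$.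
   Context: $\mathfrak{gl}(2n+1|2n)$: index set $I=\{1,\dots,4n+1\}$, $p(i)=0$ for $i$ odd, $p(i)=1$ for $i$ even; matrix units $e_{ij}$ of parity $p(i)+p(j)$, $[e_{ij},e_{kl}]=\delta_{jk}e_{il}-(-1)^{(p(i)+p(j))(p(k)+p(l))}\delta_{il}e_{kj}$, $\operatorname{str}(\sum a_{ij}e_{ij})=\sum(-1)^{p(i)}a_{ii}$. Put $i'=4n+2-i$, $\delta_k=1$ if $k\in\{2n+2,2n+4,\dots,4n\}$, else $0$. $\theta(e_{ij})=(-1)^{p(i)p(j)+p(j)+1+\delta_i+\delta_j}e_{j'i'}$, $F_{ij}=e_{ij}+\theta(e_{ij})$, $\mathfrak g=\operatorname{span}\{F_{ij}\}\cong\mathfrak{osp}(2n+1|2n)$ with form $(X|Y)=\operatorname{str}(XY)$ and grading $F_{ij}\in\mathfrak g_{(j-i)/2}$; $\mathfrak n=\mathfrak g_{>0}$, $\mathfrak p=\mathfrak g_{\le0}$. For $\mathfrak a$ with even supersymmetric invariant form, $\bar{\mathfrak a}$ is a parity-reversed copy ($p(\bar a)=p(a)+1$); $\mathcal V(\bar{\mathfrak a})=S(\mathbb C[D]\otimes\bar{\mathfrak a})$ is the free supercommutative algebra on $D^m\bar a$ with odd derivation $D$ and SUSY PVA bracket $\{\bar a{}_\chi\bar b\}=(-1)^{p(a)(p(b)+1)}\overline{[a,b]}+\chi(a|b)$ extended by sesquilinearity $\{Dx{}_\chi y\}=-\chi\{x{}_\chi y\}$, $\{x{}_\chi Dy\}=(-1)^{p(x)+1}(D+\chi)\{x{}_\chi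 y\}$ and Leibniz $\{x{}_\chi yz\}=(-1)^{(p(x)+1)p(y)}y\{x{}_\chi z\}+\{x{}_\chi y\}z$; $\chi$ odd, supercommuting with $\mathcal V$, $D\chi+\chi D=-2\chi^2$; $x^{(m)}=D^mx$. $\mathcal V(\bar{\mathfrak p})=S(\mathbb C[D]\otimes\bar{\mathfrak p})\subset\mathcal V(\bar{\mathfrak g})$; $\mathfrak J$ = differential ideal of $\mathcal V(\bar{\mathfrak g})$ generated by $\bar n-(f|n)$, $n\in\mathfrak n$; $\mathcal W(\bar{\mathfrak g},f)=\{w\in\mathcal V(\bar{\mathfrak p}):\{\bar n{}_\chi w\}\in\mathbb C[\chi]\otimes\mathfrak J\ \forall n\in\mathfrak n\}$. "Freely generates" means the $w^{(m)}$ are free supercommutative generators. In $\mathcal V[D]$, $D\,a=D(a)+(-1)^{p(a)}aD$, coefficients on the left. $\operatorname{rdet}(A)=\sum_{\sigma\in S_N}\operatorname{sgn}(\sigma)A_{1\sigma(1)}\cdots A_{N\sigma(N)}$. *)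

theory Defs
  imports Complex_Main "HOL-Library.Product_Lexorder" "HOL-Combinatorics.Permutations"
begin

text \<open>A monomial is an exponent function; a polynomial is a coefficient function on
 monomials.  Monomials are read as ordered products of the generators in increasing order.
 par g is the parity (0 or 1) of the generator g; odd generators square to zero.\<close>

type_synonym 'g mono = "'g \<Rightarrow> nat"
type_synonym 'g spoly = "'g mono \<Rightarrow> complex"

definition supp :: "'g mono \<Rightarrow> 'g set" where
  "supp m = {g. m g \<noteq> 0}"

definition valid_mono :: "('g \<Rightarrow> nat) \<Rightarrow> 'g mono \<Rightarrow> bool" where
  "valid_mono par m \<longleftrightarrow> finite (supp m) \<and> (\<forall>g. odd (par g) \<longrightarrow> m g \<le> 1)"

definition is_poly :: "('g \<Rightarrow> nat) \<Rightarrow> 'g spoly \<Rightarrow> bool" where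
  "is_poly par p \<longleftrightarrow> finite {m. p m \<noteq> 0} \<and> (\<forall>m. p m \<noteq> 0 \<longrightarrow> valid_mono par m)"

definition mpar :: "('g \<Rightarrow> nat) \<Rightarrow> 'g mono \<Rightarrow> nat" where
  "mpar par m = (\<Sum>g\<in>supp m. m g * par g) mod 2"

text \<open>sign produced by reordering the product of two ordered monomials\<close>
definition msign :: "('g::linorder \<Rightarrow> nat) \<Rightarrow> 'g mono \<Rightarrow> 'g mono \<Rightarrow> complex" where
  "msign par m1 m2 = (-1) ^ card {(a, b). m1 a \<noteq> 0 \<and> m2 b \<noteq> 0 \<and> odd (par a) \<and> odd (par b) \<and> b < a}"

definition smul :: "('g::linorder \<Rightarrow> nat) \<Rightarrow> 'g spoly \<Rightarrow> 'g spoly \<Rightarrow> 'g spoly" where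
  "smul par p q = (\<lambda>m. if valid_mono par m then
      (\<Sum>m1\<in>{m1. \<forall>g. m1 g \<le> m g}. p m1 * q (\<lambda>g. m g - m1 g) * msign par m1 (\<lambda>g. m g - m1 g))
    else 0)"

definition szero :: "'g spoly" where "szero = (\<lambda>m. 0)"
definition sconst :: "complex \<Rightarrow> 'g spoly" where
  "sconst c = (\<lambda>m. if m = (\<lambda>_. 0) then c else 0)"
definition sone :: "'g spoly" where "sone = sconst 1"
definition sadd :: "'g spoly \<Rightarrow> 'g spoly \<Rightarrow> 'g spoly" where
  "sadd p q = (\<lambda>m. p m + q m)"
definition sscale :: "complex \<Rightarrow> 'g spoly \<Rightarrow> 'g spoly" where
  "sscale c p = (\<lambda>m. c * p m)"
definition svar :: "'g \<Rightarrow> 'g spoly" where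
  "svar g = (\<lambda>m. if m = (\<lambda>h. if h = g then 1 else 0) then 1 else 0)"

definition homog :: "('g \<Rightarrow> nat) \<Rightarrow> 'g spoly \<Rightarrow> nat \<Rightarrow> bool" where
  "homog par p e \<longleftrightarrow> (\<forall>m. p m \<noteq> 0 \<longrightarrow> mpar par m = e)"

definition sinv :: "('g \<Rightarrow> nat) \<Rightarrow> 'g spoly \<Rightarrow> 'g spoly" where
  "sinv par p = (\<lambda>m. (-1) ^ (mpar par m) * p m)"

type_synonym mat = "nat \<Rightarrow> nat \<Rightarrow> complex"

definition pp :: "nat \<Rightarrow> nat" where "pp i = (if even i then 1 else 0)"

definition Emat :: "nat \<Rightarrow> nat \<Rightarrow> mat" where
  "Emat k l = (\<lambda>a b. if a = k \<and> b = l then 1 else 0)"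

definition ebr :: "nat \<Rightarrow> nat \<Rightarrow> nat \<Rightarrow> nat \<Rightarrow> mat" where
  "ebr k l i j = (\<lambda>a b. (if l = i then Emat k j a b else 0)
      - (-1) ^ ((pp k + pp l) * (pp i + pp j)) * (if k = j then Emat i l a b else 0))"

text \<open>(X|Y) = str(XY) for finitely supported matrices\<close>
definition strform :: "mat \<Rightarrow> mat \<Rightarrow> complex" where
  "strform X Y = (\<Sum>(i, j)\<in>{(i, j). X i j \<noteq> 0}. (-1) ^ (pp i) * X i j * Y j i)"

section \<open>The SUSY PVA V(bar gl): generators bar e_kl^{(m)} = (k,l,m)\<close>

type_synonym gen = "nat \<times> nat \<times> nat"
type_synonym V = "gen spoly"

definition genpar :: "gen \<Rightarrow> nat" where
  "genpar g = (case g of (k, l, m) \<Rightarrow> (pp k + pp l + 1 + m) mod 2)"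

definition VV :: "V set" where "VV = {p. is_poly genpar p}"

abbreviation Vmul :: "V \<Rightarrow> V \<Rightarrow> V" where "Vmul \<equiv> smul genpar"

definition bar :: "mat \<Rightarrow> V" where
  "bar X = (\<lambda>m. \<Sum>(k, l)\<in>{(k, l). X k l \<noteq> 0}. X k l * svar (k, l, 0) m)"

definition Dder :: "V \<Rightarrow> V" where
  "Dder = (THE d. (\<forall>p. p \<notin> VV \<longrightarrow> d p = szero)
     \<and> (\<forall>p\<in>VV. d p \<in> VV)
     \<and> (\<forall>p\<in>VV. \<forall>q\<in>VV. d (sadd p q) = sadd (d p) (d q))
     \<and> (\<forall>c. \<forall>p\<in>VV. d (sscale c p) = sscale c (d p))
     \<and> (\<forall>k l m. d (svar (k, l, m)) = svar (k, l, Suc m))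
     \<and> (\<forall>y\<in>VV. \<forall>z\<in>VV. \<forall>e. homog genpar y e \<longrightarrow>
          d (Vmul y z) = sadd (Vmul (d y) z) (sscale ((-1) ^ e) (Vmul y (d z)))))"

definition Dpow :: "nat \<Rightarrow> V \<Rightarrow> V" where "Dpow m = Dder ^^ m"

subsection \<open>C[chi] \<otimes> V: coefficient k is the coefficient of chi^k (chi^k written on the left)\<close>

type_synonym cpoly = "nat \<Rightarrow> V"

definition cadd :: "cpoly \<Rightarrow> cpoly \<Rightarrow> cpoly" where
  "cadd q r = (\<lambda>k. sadd (q k) (r k))"
definition cscale :: "complex \<Rightarrow> cpoly \<Rightarrow> cpoly" where
  "cscale c q = (\<lambda>k. sscale c (q k))"
text \<open>y \<cdot> (sum chi^k c_k) for y homogeneous of parity e (chi odd, supercommuting with V)\<close>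
definition cmul_left :: "V \<Rightarrow> nat \<Rightarrow> cpoly \<Rightarrow> cpoly" where
  "cmul_left y e q = (\<lambda>k. sscale ((-1) ^ (k * e)) (Vmul y (q k)))"
definition cmul_right :: "cpoly \<Rightarrow> V \<Rightarrow> cpoly" where
  "cmul_right q z = (\<lambda>k. Vmul (q k) z)"
text \<open>(D + chi) acting on sum chi^k c_k, using D chi + chi D = -2 chi^2\<close>
definition cDchi :: "cpoly \<Rightarrow> cpoly" where
  "cDchi q = (\<lambda>k. sadd (sscale (if even k then 1 else -1) (Dder (q k)))
      (if k = 0 then szero else sscale (if even (k - 1) then 1 else -1) (q (k - 1))))"

definition brgen :: "nat \<Rightarrow> nat \<Rightarrow> nat \<Rightarrow> nat \<Rightarrow> cpoly" where
  "brgen k l i j = (\<lambda>t. if t = 0 then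
        sscale ((-1) ^ (((pp k + pp l) mod 2) * ((pp i + pp j) mod 2 + 1))) (bar (ebr k l i j))
      else if t = 1 then sconst (strform (Emat k l) (Emat i j)) else szero)"

definition Br :: "nat \<Rightarrow> nat \<Rightarrow> V \<Rightarrow> cpoly" where
  "Br k l = (let px = (pp k + pp l + 1) mod 2 in
     THE B. (\<forall>w. w \<notin> VV \<longrightarrow> B w = (\<lambda>_. szero))
     \<and> (\<forall>p\<in>VV. \<forall>q\<in>VV. B (sadd p q) = cadd (B p) (B q))
     \<and> (\<forall>c. \<forall>p\<in>VV. B (sscale c p) = cscale c (B p))
     \<and> (\<forall>i j. B (svar (i, j, 0)) = brgen k l i j)
     \<and> (\<forall>i j m. B (svar (i, j, Suc m)) = cscale ((-1) ^ (px + 1)) (cDchi (B (svar (i, j, m)))))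
     \<and> (\<forall>y\<in>VV. \<forall>z\<in>VV. \<forall>e. homog genpar y e \<longrightarrow>
          B (Vmul y z) = cadd (cscale ((-1) ^ ((px + 1) * e)) (cmul_left y e (B z)))
                              (cmul_right (B y) z)))"

definition brk :: "mat \<Rightarrow> V \<Rightarrow> cpoly" where
  "brk X w = (\<lambda>t m. \<Sum>(a, b)\<in>{(a, b). X a b \<noteq> 0}. X a b * Br a b w t m)"

definition Iset :: "nat \<Rightarrow> nat set" where "Iset n = {1..4*n+1}"
definition primeI :: "nat \<Rightarrow> nat \<Rightarrow> nat" where "primeI n i = 4*n + 2 - i"
definition dl :: "nat \<Rightarrow> nat \<Rightarrow> nat" where
  "dl n k = (if even k \<and> 2*n + 2 \<le> k \<and> k \<le> 4*n then 1 else 0)"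

definition thsign :: "nat \<Rightarrow> nat \<Rightarrow> nat \<Rightarrow> complex" where
  "thsign n i j = (-1) ^ (pp i * pp j + pp j + 1 + dl n i + dl n j)"

definition Fm :: "nat \<Rightarrow> nat \<Rightarrow> nat \<Rightarrow> mat" where
  "Fm n i j = (\<lambda>a b. Emat i j a b + thsign n i j * Emat (primeI n j) (primeI n i) a b)"

definition Em :: "nat \<Rightarrow> nat \<Rightarrow> nat \<Rightarrow> mat" where
  "Em n i j = (\<lambda>a b. (1/2) * (-1) ^ (pp i) * Fm n i j a b)"

definition fm :: "nat \<Rightarrow> mat" where
  "fm n = (\<lambda>a b. \<Sum>i\<in>{1..2*n}. Fm n (i + 1) i a b)"

text \<open>n = g_{>0} = span of F_ij, i < j\<close>
definition nset :: "nat \<Rightarrow> mat set" where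
  "nset n = {X. \<exists>c. X = (\<lambda>a b. \<Sum>(i, j)\<in>{(i, j). i \<in> Iset n \<and> j \<in> Iset n \<and> i < j}.
                                   c i j * Fm n i j a b)}"

inductive_set alg_gen :: "V set \<Rightarrow> V set" for S where
  ag_const: "sconst c \<in> alg_gen S"
| ag_gen: "s \<in> S \<Longrightarrow> s \<in> alg_gen S"
| ag_add: "p \<in> alg_gen S \<Longrightarrow> q \<in> alg_gen S \<Longrightarrow> sadd p q \<in> alg_gen S"
| ag_mul: "p \<in> alg_gen S \<Longrightarrow> q \<in> alg_gen S \<Longrightarrow> Vmul p q \<in> alg_gen S"

definition Vg :: "nat \<Rightarrow> V set" where
  "Vg n = alg_gen {Dpow m (bar (Fm n i j)) | i j m. i \<in> Iset n \<and> j \<in> Iset n}"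

text \<open>V(bar p), p = g_{\<le>0} = span of F_ij with j \<le> i\<close>
definition Vp :: "nat \<Rightarrow> V set" where
  "Vp n = alg_gen {Dpow m (bar (Fm n i j)) | i j m. i \<in> Iset n \<and> j \<in> Iset n \<and> j \<le> i}"

text \<open>differential ideal of V(bar g) generated by bar x - (f|x), x in n\<close>
inductive_set Jset :: "nat \<Rightarrow> V set" for n where
  J_zero: "szero \<in> Jset n"
| J_gen: "a \<in> Vg n \<Longrightarrow> X \<in> nset n \<Longrightarrow>
     Vmul a (Dpow m (sadd (bar X) (sconst (- strform (fm n) X)))) \<in> Jset n"
| J_add: "p \<in> Jset n \<Longrightarrow> q \<in> Jset n \<Longrightarrow> sadd p q \<in> Jset n"

definition Wset :: "nat \<Rightarrow> V set" where
  "Wset n = {w \<in> Vp n. \<forall>X\<in>nset n. \<forall>t. brk X w t \<in> Jset n}"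

type_synonym op = "nat \<Rightarrow> V"  \<comment> \<open>coefficient of D^t, coefficients on the left\<close>

text \<open>left multiplication by D:  D (b D^t) = D(b) D^t + (-1)^{p(b)} b D^{t+1}\<close>
definition Dop :: "op \<Rightarrow> op" where
  "Dop q = (\<lambda>t. sadd (Dder (q t)) (if t = 0 then szero else sinv genpar (q (t - 1))))"

definition opmul :: "op \<Rightarrow> op \<Rightarrow> op" where
  "opmul P Q = (\<lambda>t m. \<Sum>s\<in>{s. P s \<noteq> szero}. Vmul (P s) ((Dop ^^ s) Q t) m)"

definition opone :: op where "opone = (\<lambda>t. if t = 0 then sone else szero)"

definition Amat :: "nat \<Rightarrow> nat \<Rightarrow> nat \<Rightarrow> op" where
  "Amat n i j = (if i \<le> j then
      (\<lambda>t. sadd (if t = 1 \<and> i = j then sone else szero) (if t = 0 then bar (Em n j i) else szero))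
    else (\<lambda>t. if t = 0 then sconst (- fm n i j) else szero))"

definition rdet :: "nat \<Rightarrow> op" where
  "rdet n = (\<lambda>t m. \<Sum>\<sigma>\<in>{\<sigma>. \<sigma> permutes {1..4*n+1}}.
      of_int (sign \<sigma>) * foldr opmul (map (\<lambda>i. Amat n i (\<sigma> i)) [1..<4*n+2]) opone t m)"

definition wco :: "nat \<Rightarrow> nat \<Rightarrow> V" where
  "wco n t = rdet n (4*n + 1 - t)"

definition gparity :: "('h \<Rightarrow> V) \<Rightarrow> 'h \<Rightarrow> nat" where
  "gparity x g = (SOME e. e < 2 \<and> homog genpar (x g) e)"

definition mprodV :: "('h::linorder \<Rightarrow> V) \<Rightarrow> 'h mono \<Rightarrow> V" where
  "mprodV x m = foldr Vmul (map (\<lambda>g. ((Vmul (x g)) ^^ (m g)) sone) (sorted_list_of_set (supp m))) sone"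

definition evalV :: "('h::linorder \<Rightarrow> V) \<Rightarrow> 'h spoly \<Rightarrow> V" where
  "evalV x P = (\<lambda>mm. \<Sum>m\<in>{m. P m \<noteq> 0}. P m * mprodV x m mm)"

definition polys_on :: "('h \<Rightarrow> nat) \<Rightarrow> 'h set \<Rightarrow> 'h spoly set" where
  "polys_on par G = {P. is_poly par P \<and> (\<forall>m. P m \<noteq> 0 \<longrightarrow> supp m \<subseteq> G)}"

definition freely_generates :: "'h::linorder set \<Rightarrow> ('h \<Rightarrow> V) \<Rightarrow> V set \<Rightarrow> bool" where
  "freely_generates G x W \<longleftrightarrow> (\<forall>g\<in>G. \<exists>e<2. homog genpar (x g) e)
     \<and> W = evalV x ` polys_on (gparity x) G
     \<and> inj_on (evalV x) (polys_on (gparity x) G)"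

end

theory Submission
  imports Defs
begin

text \<open>Let \<open>rho\<close> be the differential homomorphism that is the identity on the generators from \<open>g\<close> in
 non-positive degree and sends \<open>n\<close> of positive degree to \<open>(f|n)\<close>. Its kernel on the affine algebra of \<open>g\<close> is
 the ideal \<open>J\<close>, so \<open>w\<close> lies in the W-algebra iff \<open>rho\<close> kills every coefficient of \<open>{n \<chi> w}\<close>, and
 these coefficients are superderivations in \<open>w\<close>.

 The matrix \<open>A\<close> is upper Hessenberg with scalar subdiagonal. Solving \<open>A s = (L, 0, \<dots>, 0)\<close> backwards from
 \<open>s\<^sub>N = y\<close>, where \<open>y\<close> is an auxiliary generator with trivial brackets, gives \<open>L = \<plusminus> rdet(A) y\<close>. By descending
 induction \<open>rho {n \<chi> s} = - n s\<close>, without \<open>\<chi>\<close>; since \<open>n\<close> is strictly upper triangular, \<open>L\<close> is invariant,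
 and so are its coefficients \<open>w\<^sub>t\<close>.

 In \<open>w\<^sub>s\<^sub>+\<^sub>1\<close>, for \<open>s \<equiv> 2, 3 (mod 4)\<close>, one generator \<open>v\<close> on the subdiagonal of level \<open>s\<close> occurs linearly, up to
 other generators \<open>u\<close> of that level and terms of lower level. Hence the \<open>w\<close> and the remaining \<open>u\<close>
 freely generate the algebra of the non-positive part. The brackets with \<open>n = F\<^sub>b\<^sub>,\<^sub>b\<^sub>+\<^sub>s\<^sub>+\<^sub>1\<close> kill the \<open>w\<close> and the
 \<open>u\<close> of level below \<open>s\<close>, and act on those of level \<open>s\<close> by a triangular system of partial derivatives; so, from the
 top level downwards, no \<open>u\<close> occurs in an invariant polynomial.\<close>

section \<open>The free supercommutative algebra as a ring\<close>

text \<open>Why 2 and 3 modulo 4: reflection in the antidiagonal pairs the \<open>F_ij\<close> of a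
  level, and a fixed \<open>F_ij\<close> is nonzero only at levels 2 mod 4. So level s has one
  independent generator more than level s + 1 exactly for s \<equiv> 2, 3 (mod 4). Each independent
  element of n of level s + 1 eliminates one u of level s; the surplus generator is the one that the
  coefficient with index s + 1 replaces. Why partial derivatives appear: the bracket of
  \<open>F_{b,b+s+1}\<close> with a generator of level r lies s + 1 - r steps above the diagonal,
  and (f|.) sees only the first step. Levels below s therefore give 0 and level s gives constants.
  Each D moves such a constant up by one power of \<chi>, so the coefficient of \<chi>^k
  differentiates only with respect to the k-th derivatives of the u. The obstacle is that derivation
  and bracket are definite descriptions on superpolynomials: their existence has to be extracted
  from freeness. Hence a ring type with a universal property comes before everything else, and
  \<open>rho\<close>, \<open>Theta\<close> and \<open>Psi\<close> are defined on the whole algebra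
  of gl, whose generators are free, although they matter only on the orthosymplectic part.\<close>

abbreviation divs :: "'g mono \<Rightarrow> 'g mono set" where
  "divs m \<equiv> {a. \<forall>g. a g \<le> m g}"

abbreviation madd :: "'g mono \<Rightarrow> 'g mono \<Rightarrow> 'g mono" where
  "madd a b \<equiv> (\<lambda>g. a g + b g)"

definition mgen :: "'g \<Rightarrow> 'g mono" where
  "mgen g = (\<lambda>h. if h = g then 1 else 0)"

lemma finite_divs:
  assumes "finite (supp m)"
  shows "finite (divs m)"
proof -
  let ?B = "\<Union>g\<in>supp m. {..m g}"
  have "divs m \<subseteq> {f. \<forall>x. (x \<in> supp m \<longrightarrow> f x \<in> ?B) \<and> (x \<notin> supp m \<longrightarrow> f x = 0)}"
    by (auto simp: supp_def) (metis le_zero_eq)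
  moreover have "finite \<dots>" using assms by (intro finite_set_of_finite_funs) auto
  ultimately show ?thesis by (rule finite_subset)
qed

lemma valid_mono_le:
  assumes "valid_mono par m" "\<And>g. a g \<le> m g"
  shows "valid_mono par a"
proof -
  have "supp a \<subseteq> supp m" using assms(2) unfolding supp_def
    by (metis (mono_tags, lifting) Collect_mono le_zero_eq)
  then show ?thesis using assms unfolding valid_mono_def by (meson finite_subset le_trans)
qed

text \<open>An odd generator occurring in both \<open>a\<close> and \<open>b\<close> would have
  exponent at least 2, which validity of their product excludes. So the inversion set splits into
  two disjoint pieces.\<close>

lemma msign_madd_left:
  assumes "valid_mono par (madd a b)" "finite (supp c)"
  shows "msign par (madd a b) c = msign par a c * msign par b c"
proof -
  let ?S = "\<lambda>x. {(u, v). x u \<noteq> 0 \<and> c v \<noteq> 0 \<and> odd (par u) \<and> odd (par v) \<and> v < u}"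
  have fin: "finite (supp (madd a b))" using assms(1) by (simp add: valid_mono_def)
  have "?S a \<subseteq> supp (madd a b) \<times> supp c" "?S b \<subseteq> supp (madd a b) \<times> supp c"
    by (auto simp: supp_def)
  then have f: "finite (?S a)" "finite (?S b)"
    using fin assms(2) by (meson finite_SigmaI finite_subset)+
  have "?S (madd a b) = ?S a \<union> ?S b" by auto
  moreover have "?S a \<inter> ?S b = {}"
  proof (rule ccontr)
    assume "?S a \<inter> ?S b \<noteq> {}"
    then obtain u where u: "a u \<noteq> 0" "b u \<noteq> 0" "odd (par u)" by auto
    moreover have "a u + b u \<le> 1" using assms(1) u(3) by (auto simp: valid_mono_def)
    ultimately show False by linarith
  qed
  ultimately have "card (?S (madd a b)) = card (?S a) + card (?S b)"
    using f by (simp add: card_Un_disjoint)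
  then show ?thesis unfolding msign_def by (simp add: power_add)
qed

lemma msign_madd_right:
  assumes "valid_mono par (madd a b)" "finite (supp c)"
  shows "msign par c (madd a b) = msign par c a * msign par c b"
proof -
  let ?S = "\<lambda>x. {(u, v). c u \<noteq> 0 \<and> x v \<noteq> 0 \<and> odd (par u) \<and> odd (par v) \<and> v < u}"
  have fin: "finite (supp (madd a b))" using assms(1) by (simp add: valid_mono_def)
  have "?S a \<subseteq> supp c \<times> supp (madd a b)" "?S b \<subseteq> supp c \<times> supp (madd a b)"
    by (auto simp: supp_def)
  then have f: "finite (?S a)" "finite (?S b)"
    using fin assms(2) by (meson finite_SigmaI finite_subset)+
  have "?S (madd a b) = ?S a \<union> ?S b" by auto
  moreover have "?S a \<inter> ?S b = {}"
  proof (rule ccontr)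
    assume "?S a \<inter> ?S b \<noteq> {}"
    then obtain u where u: "a u \<noteq> 0" "b u \<noteq> 0" "odd (par u)" by auto
    moreover have "a u + b u \<le> 1" using assms(1) u(3) by (auto simp: valid_mono_def)
    ultimately show False by linarith
  qed
  ultimately have "card (?S (madd a b)) = card (?S a) + card (?S b)"
    using f by (simp add: card_Un_disjoint)
  then show ?thesis unfolding msign_def by (simp add: power_add)
qed

lemma msign_zero [simp]: "msign par (\<lambda>_. 0) c = 1" "msign par c (\<lambda>_. 0) = 1"
  by (auto simp: msign_def)

text \<open>Both sides sum over the ordered factorizations of \<open>m\<close> into three monomials.
  The reindexing passes from (product of the first two, first) to (first, second); the signs agree
  because \<open>msign\<close> is multiplicative in each argument.\<close>

lemma smul_assoc: "smul par (smul par p q) r = smul par p (smul par q r)"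
proof
  fix m
  show "smul par (smul par p q) r m = smul par p (smul par q r) m"
  proof (cases "valid_mono par m")
    case False
    then show ?thesis by (simp add: smul_def)
  next
    case True
    have fm: "finite (divs m)" using True finite_divs valid_mono_def by blast
    have vsub: "valid_mono par (\<lambda>g. m g - a g)" for a
      by (rule valid_mono_le[OF True]) auto
    have vle: "valid_mono par a" if "a \<in> divs m" for a
      using that by (intro valid_mono_le[OF True]) auto
    have fd: "finite (divs a)" if "valid_mono par a" for a
      using that finite_divs valid_mono_def by blast
    let ?F = "\<lambda>a b. p b * q (\<lambda>g. a g - b g) * msign par b (\<lambda>g. a g - b g) *
        r (\<lambda>g. m g - a g) * msign par a (\<lambda>g. m g - a g)"
    let ?G = "\<lambda>b c. p b * (q c * r (\<lambda>g. m g - b g - c g) * msign par c (\<lambda>g. m g - b g - c g)) *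
        msign par b (\<lambda>g. m g - b g)"
    have "smul par (smul par p q) r m = (\<Sum>a\<in>divs m. \<Sum>b\<in>divs a. ?F a b)"
      using True vle by (auto simp: smul_def sum_distrib_right intro!: sum.cong)
    also have "\<dots> = (\<Sum>(a, b)\<in>Sigma (divs m) divs. ?F a b)"
      using fm fd vle by (intro sum.Sigma) auto
    also have "\<dots> = (\<Sum>(b, c)\<in>Sigma (divs m) (\<lambda>b. divs (\<lambda>g. m g - b g)). ?G b c)"
    proof (rule sum.reindex_bij_witness[where i = "\<lambda>(b, c). (madd b c, b)"
          and j = "\<lambda>(a, b). (b, \<lambda>g. a g - b g)"], goal_cases)
      case (5 ab)
      obtain a b where ab: "ab = (a, b)" by force
      have ab': "a \<in> divs m" "b \<in> divs a" using 5 ab by auto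
      define c where "c = (\<lambda>g. a g - b g)"
      define d where "d = (\<lambda>g. m g - a g)"
      have a_eq: "a = madd b c" using ab' by (auto simp: c_def fun_eq_iff)
      have m_eq: "(\<lambda>g. m g - b g) = madd c d"
        using ab' by (fastforce simp: c_def d_def fun_eq_iff)
      have d_eq: "(\<lambda>g. m g - b g - c g) = d"
        using ab' by (fastforce simp: c_def d_def fun_eq_iff)
      have v: "valid_mono par (madd b c)" "valid_mono par (madd c d)"
        using vle[OF ab'(1)] vsub[of b] a_eq m_eq by auto
      have "valid_mono par d" "valid_mono par b" using vsub[of a] vle ab'
        by (auto simp: d_def intro: order_trans)
      then have "finite (supp d)" "finite (supp b)" by (auto simp: valid_mono_def)
      then have "msign par a d = msign par b d * msign par c d"
        "msign par b (madd c d) = msign par b c * msign par b d"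
        using v a_eq msign_madd_left[of par b c d] msign_madd_right[of par c d b] by simp_all
      then show ?case unfolding ab prod.case m_eq d_eq d_def[symmetric] c_def[symmetric]
        by (simp add: algebra_simps)
    next
      case (1 a)
      then show ?case by (auto simp: fun_eq_iff)
    next
      case (2 a)
      obtain x y where a: "a = (x, y)" by force
      then have "y g \<le> x g" "x g \<le> m g" for g using 2 by auto
      then have "y g \<le> m g" "x g - y g \<le> m g - y g" for g
        by (meson order_trans, meson diff_le_mono)
      then show ?case using a by simp
    next
      case (3 a)
      then show ?case by (auto simp: fun_eq_iff)
    next
      case (4 a)
      obtain x y where a: "a = (x, y)" by force
      then have "x g \<le> m g" "y g \<le> m g - x g" for g using 4 by auto
      then have "x g + y g \<le> m g" for g
        by (metis add.commute le_diff_conv2)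
      then show ?case using a by simp
    qed
    also have "\<dots> = (\<Sum>b\<in>divs m. \<Sum>c\<in>divs (\<lambda>g. m g - b g). ?G b c)"
      using fm fd vsub by (intro sum.Sigma[symmetric]) auto
    also have "\<dots> = smul par p (smul par q r) m"
      using True vsub by (auto simp: smul_def sum_distrib_right sum_distrib_left intro!: sum.cong)
    finally show ?thesis .
  qed
qed

lemma smul_sone_right:
  "smul par p sone m = (if valid_mono par m then p m else 0)"
proof (cases "valid_mono par m")
  case True
  have fm: "finite (divs m)" using True finite_divs valid_mono_def by blast
  have "smul par p sone m = (\<Sum>a\<in>divs m. if a = m then p m else 0)"
  proof -
    have "(\<lambda>g. m g - a g) = (\<lambda>_. 0) \<longleftrightarrow> a = m" if "a \<in> divs m" for a
      using that by (auto simp: fun_eq_iff intro: le_antisym)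
    then show ?thesis unfolding smul_def using True
      by (auto simp: sone_def sconst_def intro!: sum.cong)
  qed
  then show ?thesis using True fm by (simp add: sum.delta)
qed (simp add: smul_def)

lemma smul_sone_left:
  "smul par sone p m = (if valid_mono par m then p m else 0)"
proof (cases "valid_mono par m")
  case True
  have fm: "finite (divs m)" using True finite_divs valid_mono_def by blast
  have "smul par sone p m = (\<Sum>a\<in>divs m. if a = (\<lambda>_. 0) then p m else 0)"
    unfolding smul_def using True
    by (auto simp: sone_def sconst_def intro!: sum.cong)
  then show ?thesis using True fm by (simp add: sum.delta)
qed (simp add: smul_def)

lemma is_poly_smul:
  assumes "is_poly par p" "is_poly par q"
  shows "is_poly par (smul par p q)"
proof -
  let ?P = "{m. p m \<noteq> 0}" and ?Q = "{m. q m \<noteq> 0}"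
  have "{m. smul par p q m \<noteq> 0} \<subseteq> (\<lambda>(a, b). madd a b) ` (?P \<times> ?Q)"
  proof
    fix m assume m: "m \<in> {m. smul par p q m \<noteq> 0}"
    then have "(\<Sum>a\<in>divs m. p a * q (\<lambda>g. m g - a g) * msign par a (\<lambda>g. m g - a g)) \<noteq> 0"
      by (auto simp: smul_def split: if_splits)
    then obtain a where a: "a \<in> divs m" "p a \<noteq> 0" "q (\<lambda>g. m g - a g) \<noteq> 0"
      by (rule sum.not_neutral_contains_not_neutral) auto
    moreover have "m = madd a (\<lambda>g. m g - a g)" using a(1) by auto
    ultimately show "m \<in> (\<lambda>(a, b). madd a b) ` (?P \<times> ?Q)"
      by (intro image_eqI[of _ _ "(a, \<lambda>g. m g - a g)"]) simp_all
  qed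
  moreover have "finite (?P \<times> ?Q)" using assms by (auto simp: is_poly_def)
  ultimately have "finite {m. smul par p q m \<noteq> 0}" by (meson finite_imageI finite_subset)
  then show ?thesis by (auto simp: is_poly_def smul_def split: if_splits)
qed

lemma is_poly_sconst: "is_poly par (sconst c)"
proof -
  have "{m. sconst c m \<noteq> 0} \<subseteq> {\<lambda>_. 0}" by (auto simp: sconst_def)
  then show ?thesis
    by (auto simp: is_poly_def sconst_def valid_mono_def supp_def intro: finite_subset)
qed

lemma is_poly_sadd:
  assumes "is_poly par p" "is_poly par q"
  shows "is_poly par (sadd p q)"
proof -
  have "{m. sadd p q m \<noteq> 0} \<subseteq> {m. p m \<noteq> 0} \<union> {m. q m \<noteq> 0}" by (auto simp: sadd_def)
  then have "finite {m. sadd p q m \<noteq> 0}"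
    using assms unfolding is_poly_def by (meson finite_Un finite_subset)
  moreover have "p m \<noteq> 0 \<or> q m \<noteq> 0" if "sadd p q m \<noteq> 0" for m
    using that by (auto simp: sadd_def)
  ultimately show ?thesis using assms by (auto simp: is_poly_def)
qed

lemma is_poly_sscale:
  assumes "is_poly par p"
  shows "is_poly par (sscale c p)"
proof -
  have "{m. sscale c p m \<noteq> 0} \<subseteq> {m. p m \<noteq> 0}" by (auto simp: sscale_def)
  then show ?thesis using assms by (auto simp: is_poly_def sscale_def intro: finite_subset)
qed

lemma valid_mgen [simp]: "valid_mono par (mgen g)"
  by (auto simp: valid_mono_def mgen_def supp_def)

lemma is_poly_svar: "is_poly par (svar g)"
proof -
  have "{m. svar g m \<noteq> 0} \<subseteq> {mgen g}" by (auto simp: svar_def mgen_def)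
  moreover have "valid_mono par m" if "svar g m \<noteq> 0" for m
    using that valid_mgen[of par g] by (auto simp: svar_def mgen_def split: if_splits)
  ultimately show ?thesis unfolding is_poly_def by (auto intro: finite_subset)
qed

section \<open>The superpolynomials as a ring type\<close>

typedef sv = "VV" morphisms cf Sv
  unfolding VV_def using is_poly_sconst by blast

setup_lifting type_definition_sv

lemma is_poly_cf [simp]: "is_poly genpar (cf a)"
  using cf[of a] by (simp add: VV_def)

instantiation sv :: ring_1
begin
lift_definition zero_sv :: sv is "sconst 0" by (simp add: VV_def is_poly_sconst)
lift_definition one_sv :: sv is sone by (simp add: VV_def is_poly_sconst sone_def)
lift_definition plus_sv :: "sv \<Rightarrow> sv \<Rightarrow> sv" is sadd by (simp add: VV_def is_poly_sadd)
lift_definition uminus_sv :: "sv \<Rightarrow> sv" is "sscale (-1)" by (simp add: VV_def is_poly_sscale)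
lift_definition minus_sv :: "sv \<Rightarrow> sv \<Rightarrow> sv" is "\<lambda>a b. sadd a (sscale (-1) b)"
  by (simp add: VV_def is_poly_sscale is_poly_sadd)
lift_definition times_sv :: "sv \<Rightarrow> sv \<Rightarrow> sv" is "smul genpar"
  by (simp add: VV_def is_poly_smul)
instance
proof
  fix a b c :: sv
  show "a + b + c = a + (b + c)" by transfer (simp add: sadd_def add.assoc)
  show "a + b = b + a" by transfer (simp add: sadd_def add.commute)
  show "0 + a = a" by transfer (simp add: sadd_def sconst_def)
  show "- a + a = 0" by transfer (simp add: sadd_def sconst_def sscale_def)
  show "a - b = a + - b" by transfer simp
  show "a * b * c = a * (b * c)" by transfer (rule smul_assoc)
  show "1 * a = a"
    by transfer (auto simp: smul_sone_left VV_def is_poly_def fun_eq_iff)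
  show "a * 1 = a"
    by transfer (auto simp: smul_sone_right VV_def is_poly_def fun_eq_iff)
  show "(a + b) * c = a * c + b * c"
    by transfer (auto simp: smul_def sadd_def algebra_simps sum.distrib)
  show "a * (b + c) = a * b + a * c"
    by transfer (auto simp: smul_def sadd_def algebra_simps sum.distrib)
  show "(0::sv) \<noteq> 1"
    by transfer (auto simp: sone_def sconst_def fun_eq_iff)
qed
end

lift_definition cn :: "complex \<Rightarrow> sv" is sconst by (simp add: VV_def is_poly_sconst)
lift_definition gn :: "gen \<Rightarrow> sv" is svar by (simp add: VV_def is_poly_svar)
text \<open>Invalid exponents give 0, so that \<open>mon_mult\<close> holds without side conditions:
  a repeated odd generator kills the product by itself.\<close>

lift_definition mon :: "gen mono \<Rightarrow> sv" is
  "\<lambda>m m'. if m' = m \<and> valid_mono genpar m then 1 else 0"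
  by (auto simp: VV_def is_poly_def)

lemma cf_simps [simp]:
  "cf 0 = (\<lambda>_. 0)" "cf (a + b) m = cf a m + cf b m" "cf (a - b) m = cf a m - cf b m"
  "cf (- a) m = - cf a m"
  by (transfer; simp add: sconst_def sadd_def sscale_def fun_eq_iff)+

lemma cf_sum [simp]: "cf (sum f A) m = (\<Sum>x\<in>A. cf (f x) m)"
  by (induction A rule: infinite_finite_induct) auto

lemma finite_cf: "finite {m. cf a m \<noteq> 0}"
  using is_poly_cf[of a] by (simp add: is_poly_def del: is_poly_cf)

lemma cf_valid: "cf a m \<noteq> 0 \<Longrightarrow> valid_mono genpar m"
  using is_poly_cf[of a] by (simp add: is_poly_def del: is_poly_cf)

lemma sv_eqI: "(\<And>m. cf a m = cf b m) \<Longrightarrow> a = b"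
  by (metis cf_inject ext)

lemma cf_mult: "cf (a * b) = smul genpar (cf a) (cf b)"
  by transfer simp

lemma cf_cn: "cf (cn c) = sconst c"
  by transfer simp

lemma sconst_eq_sscale: "sconst c = sscale c sone"
  by (auto simp: sconst_def sscale_def sone_def fun_eq_iff)

lemma smul_sconst_left:
  "smul par (sconst c) p m = (if valid_mono par m then c * p m else 0)"
proof -
  have "smul par (sscale c sone) p m = c * smul par sone p m"
    unfolding smul_def by (simp add: sscale_def sum_distrib_left mult.assoc)
  then show ?thesis by (simp add: smul_sone_left sconst_eq_sscale)
qed

lemma smul_sconst_right:
  "smul par p (sconst c) m = (if valid_mono par m then c * p m else 0)"
proof -
  have "smul par p (sscale c sone) m = c * smul par p sone m"
    unfolding smul_def
    by (simp add: sscale_def sum_distrib_left mult.assoc mult.left_commute)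
  then show ?thesis by (simp add: smul_sone_right sconst_eq_sscale)
qed

lemma cf_cn_mult [simp]: "cf (cn c * a) m = c * cf a m"
  using cf_valid[of a m] by (auto simp: cf_mult cf_cn smul_sconst_left)

lemma cn_central: "a * cn c = cn c * a"
  by (rule sv_eqI) (auto simp: cf_mult cf_cn smul_sconst_left smul_sconst_right)

lemma cn_left_commute: "a * (cn c * b) = cn c * (a * b)"
  by (metis cn_central mult.assoc)

lemma cn_simps [simp]:
  "cn 0 = 0" "cn 1 = 1" "cn (a + b) = cn a + cn b" "cn (- a) = - cn a" "cn (a - b) = cn a - cn b"
  by (transfer; auto simp: sconst_def sone_def sadd_def sscale_def fun_eq_iff)+

lemma cn_mult: "cn (a * b) = cn a * cn b"
  by (rule sv_eqI) (simp add: cf_cn sconst_def)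

lemma cn_sum: "cn (sum f A) = (\<Sum>x\<in>A. cn (f x))"
  by (induction A rule: infinite_finite_induct) auto

lemma cf_mon: "cf (mon m) m' = (if m' = m \<and> valid_mono genpar m then 1 else 0)"
  by transfer simp

lemma mon_invalid: "\<not> valid_mono genpar m \<Longrightarrow> mon m = 0"
  by (rule sv_eqI) (simp add: cf_mon)

lemma mon_zero: "mon (\<lambda>_. 0) = 1"
  by transfer (auto simp: sone_def sconst_def valid_mono_def supp_def fun_eq_iff)

lemma mon_mgen: "mon (mgen g) = gn g"
proof -
  have "valid_mono genpar (mgen g)" by simp
  then show ?thesis by transfer (auto simp: svar_def mgen_def fun_eq_iff)
qed

lemma mon_mult: "mon a * mon b = cn (msign genpar a b) * mon (madd a b)"
proof (cases "valid_mono genpar (madd a b)")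
  case False
  have "\<not> valid_mono genpar a \<or> \<not> valid_mono genpar b \<or> cf (mon a * mon b) m = 0" for m
  proof -
    have "cf (mon a) x * cf (mon b) (\<lambda>g. m g - x g) = 0" if "valid_mono genpar m" "x \<in> divs m" for x
    proof (rule ccontr)
      assume "\<not> ?thesis"
      then have "x = a" "(\<lambda>g. m g - x g) = b" by (auto simp: cf_mon split: if_splits)
      then have "x = a" "m g - x g = b g" for g by metis+
      then have "m g = madd a b g" for g
        using that(2) by (metis (mono_tags, lifting) le_add_diff_inverse mem_Collect_eq)
      then have "m = madd a b" by (rule ext)
      then show False using False that by simp
    qed
    then show ?thesis by (auto simp: cf_mult smul_def intro!: sum.neutral)
  qed
  then have "mon a * mon b = 0"
    by (cases "valid_mono genpar a \<and> valid_mono genpar b") (auto simp: mon_invalid intro: sv_eqI)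
  then show ?thesis using False by (simp add: mon_invalid)
next
  case True
  have va: "valid_mono genpar a" "valid_mono genpar b"
    by (rule valid_mono_le[OF True]; simp)+
  show ?thesis
  proof (rule sv_eqI)
    fix m
    show "cf (mon a * mon b) m = cf (cn (msign genpar a b) * mon (madd a b)) m"
    proof (cases "valid_mono genpar m")
      case vm: True
      have fm: "finite (divs m)" using vm finite_divs valid_mono_def by blast
      have "cf (mon a) x * cf (mon b) (\<lambda>g. m g - x g) * msign genpar x (\<lambda>g. m g - x g) =
          (if x = a then if m = madd a b then msign genpar a b else 0 else 0)" if "x \<in> divs m" for x
      proof (cases "x = a \<and> (\<lambda>g. m g - x g) = b")
        case True
        then have "x = a" "\<And>g. m g - x g = b g" by metis+
        then have "m g = madd a b g" for g
          using that by (metis (mono_tags, lifting) le_add_diff_inverse mem_Collect_eq)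
        then have "m = madd a b" by (rule ext)
        then show ?thesis using True va by (auto simp: cf_mon)
      next
        case False
        then have "x = a \<Longrightarrow> m \<noteq> madd a b" by auto
        then show ?thesis using False by (auto simp: cf_mon)
      qed
      then have "cf (mon a * mon b) m =
          (\<Sum>x\<in>divs m. if x = a then if m = madd a b then msign genpar a b else 0 else 0)"
        using vm by (auto simp: cf_mult smul_def intro!: sum.cong)
      also have "\<dots> = (if m = madd a b then msign genpar a b else 0)"
        using fm by (auto simp: sum.delta)
      finally show ?thesis using vm by (auto simp: cf_mon)
    next
      case False
      then show ?thesis using cf_valid by metis
    qed
  qed
qed

lemma sv_expand: "a = (\<Sum>m | cf a m \<noteq> 0. cn (cf a m) * mon m)"
proof (rule sv_eqI)
  fix m
  have "(\<Sum>x | cf a x \<noteq> 0. cf a x * cf (mon x) m) =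
      (\<Sum>x | cf a x \<noteq> 0. if x = m then cf a m else 0)"
    using cf_valid by (intro sum.cong) (auto simp: cf_mon)
  then show "cf a m = cf (\<Sum>m | cf a m \<noteq> 0. cn (cf a m) * mon m) m"
    using finite_cf[of a] by (simp add: sum.delta)
qed

section \<open>The universal property\<close>

declare split_paired_All [simp del] split_paired_Ex [simp del]

lemma msign_min:
  assumes "\<And>h. h \<in> supp m \<Longrightarrow> g \<le> h"
  shows "msign par (mgen g) m = 1"
proof -
  have "\<not> (mgen g u \<noteq> 0 \<and> m v \<noteq> 0 \<and> v < u)" for u v
    using assms[of v] by (auto simp: mgen_def supp_def dest: leD)
  then have "{(u, v). mgen g u \<noteq> 0 \<and> m v \<noteq> 0 \<and> odd (par u) \<and> odd (par v) \<and> v < u} = {}"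
    by blast
  then show ?thesis by (simp only: msign_def) simp
qed

lemma supp_mgen [simp]: "supp (mgen g) = {g}"
  by (auto simp: supp_def mgen_def)

lemma mgen_same [simp]: "mgen g g = 1" and mgen_other: "h \<noteq> g \<Longrightarrow> mgen g h = 0"
  by (auto simp: mgen_def)

lemma valid_mono_zero [simp]: "valid_mono par (\<lambda>_. 0)"
  by (simp add: valid_mono_def supp_def)

lemma gn_mult_mon: "gn g * mon m = cn (msign genpar (mgen g) m) * mon (madd (mgen g) m)"
  by (simp add: mon_mult flip: mon_mgen)

lemma gn_mult_mon_min:
  assumes "\<And>h. h \<in> supp m \<Longrightarrow> g \<le> h"
  shows "gn g * mon m = mon (madd (mgen g) m)"
  by (simp add: gn_mult_mon msign_min[OF assms])

text \<open>The least generator is peeled off first, because multiplying from the left by a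
  generator that is not above the others costs no sign (\<open>gn_mult_mon_min\<close>). The measure
  is the total degree.\<close>

lemma mono_induct [consumes 1, case_names zero gen]:
  fixes m :: "'g::linorder mono"
  assumes "finite (supp m)" "P (\<lambda>_. 0)"
    "\<And>g m. finite (supp m) \<Longrightarrow> (\<And>h. h \<in> supp m \<Longrightarrow> g \<le> h) \<Longrightarrow> P m \<Longrightarrow> P (madd (mgen g) m)"
  shows "P m"
  using assms(1)
proof (induction "sum m (supp m)" arbitrary: m rule: less_induct)
  case less
  show ?case
  proof (cases "supp m = {}")
    case True
    then have "m = (\<lambda>_. 0)" by (auto simp: supp_def)
    then show ?thesis using assms(2) by simp
  next
    case False
    define g where "g = Min (supp m)"
    have g: "g \<in> supp m" "\<And>h. h \<in> supp m \<Longrightarrow> g \<le> h"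
      using False less.prems by (auto simp: g_def)
    define m' where "m' = m(g := m g - 1)"
    have m: "m = madd (mgen g) m'" using g(1) by (auto simp: m'_def mgen_def supp_def)
    have sub: "supp m' \<subseteq> supp m" by (auto simp: m'_def supp_def split: if_splits)
    then have fin: "finite (supp m')" using less.prems by (rule finite_subset)
    have "sum m' (supp m') = sum m' (supp m)"
      using less.prems sub by (intro sum.mono_neutral_left) (auto simp: supp_def)
    also have "\<dots> < sum m (supp m)"
      using less.prems g(1) by (intro sum_strict_mono_ex1) (auto simp: m'_def supp_def)
    finally have "P m'" using less.hyps fin by blast
    then show ?thesis using assms(3)[OF fin] g(2) sub m by (metis subsetD)
  qed
qed

text \<open>The later uniqueness arguments rest on this: additive maps that agree on constants and
  obey the same rule for \<open>gn g * a\<close> coincide.\<close>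

lemma sv_induct [case_names cn add gn]:
  assumes "\<And>c. P (cn c)" "\<And>a b. P a \<Longrightarrow> P b \<Longrightarrow> P (a + b)" "\<And>g a. P a \<Longrightarrow> P (gn g * a)"
  shows "P a"
proof -
  have P: "P (cn c * mon m)" if "finite (supp m)" for c m
    using that
  proof (induction m rule: mono_induct)
    case zero
    then show ?case using assms(1)[of c] by (simp add: mon_zero)
  next
    case (gen g m)
    then have "cn c * mon (madd (mgen g) m) = gn g * (cn c * mon m)"
      by (simp add: gn_mult_mon_min cn_left_commute)
    then show ?case using assms(3) gen.IH by metis
  qed
  have "P (\<Sum>m\<in>A. cn (cf a m) * mon m)" if "finite A" "A \<subseteq> {m. cf a m \<noteq> 0}" for A
    using that
  proof (induction A rule: finite_induct)
    case empty
    then show ?case using assms(1)[of 0] by simp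
  next
    case (insert m A)
    then have "finite (supp m)" using cf_valid[of a m] by (simp add: valid_mono_def)
    then show ?case using insert P assms(2) by simp
  qed
  from this[OF finite_cf[of a] order_refl] show ?thesis by (simp flip: sv_expand)
qed

text \<open>The target is any ring with central scalars, not necessarily supercommutative. Thus one
  construction yields endomorphisms and, with triangular matrices as target,
  superderivations.\<close>

locale gen_hom =
  fixes sc :: "complex \<Rightarrow> 's::ring_1" and \<phi> :: "gen \<Rightarrow> 's"
  assumes sc_add: "sc (a + b) = sc a + sc b"
    and sc_mult: "sc (a * b) = sc a * sc b"
    and sc_one: "sc 1 = 1"
    and sc_central: "x * sc a = sc a * x"
    and comm: "\<phi> g * \<phi> h =
      (if odd (genpar g) \<and> odd (genpar h) then - (\<phi> h * \<phi> g) else \<phi> h * \<phi> g)"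
    and sq: "odd (genpar g) \<Longrightarrow> \<phi> g * \<phi> g = 0"
begin

definition evm :: "gen mono \<Rightarrow> 's" where
  "evm m = prod_list (map (\<lambda>g. \<phi> g ^ m g) (sorted_list_of_set (supp m)))"

definition hom :: "sv \<Rightarrow> 's" where
  "hom a = (\<Sum>m | cf a m \<noteq> 0. sc (cf a m) * evm m)"

lemma sc_left: "x * (sc a * y) = sc a * (x * y)"
  by (metis mult.assoc sc_central)

lemma sc_zero: "sc 0 = 0"
  using sc_add[of 0 0] by simp

lemma sc_uminus: "sc (- a) = - sc a"
  using sc_add[of a "- a"] sc_zero by (simp add: eq_neg_iff_add_eq_0 add.commute)

lemma evm_zero: "evm (\<lambda>_. 0) = 1"
  by (simp add: evm_def supp_def)

lemma evm_min:
  assumes "finite (supp m)" "\<And>h. h \<in> supp m \<Longrightarrow> g \<le> h"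
  shows "evm m = \<phi> g ^ m g * evm (m(g := 0))"
proof (cases "m g = 0")
  case True
  then have "m(g := 0) = m" by auto
  then show ?thesis using True by simp
next
  case False
  let ?A = "supp (m(g := 0))"
  have eq: "supp m = insert g ?A" using False by (auto simp: supp_def)
  have "?A \<subseteq> supp m" by (auto simp: supp_def)
  then have fin: "finite ?A" using assms(1) by (rule finite_subset)
  have g: "g \<notin> ?A" by (auto simp: supp_def)
  have "sorted_list_of_set (supp m) = g # sorted_list_of_set ?A"
    using fin g eq assms(2) by (simp add: insort_is_Cons)
  moreover have "map (\<lambda>h. \<phi> h ^ m h) (sorted_list_of_set ?A) =
      map (\<lambda>h. \<phi> h ^ (m(g := 0)) h) (sorted_list_of_set ?A)"
    using fin g by auto
  ultimately show ?thesis by (simp only: evm_def list.map prod_list.Cons)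
qed

lemma comm_power:
  "\<phi> g * \<phi> h ^ k = sc (if odd (genpar g) \<and> odd (genpar h) then (-1) ^ k else 1) * \<phi> h ^ k * \<phi> g"
proof (induction k)
  case 0
  then show ?case by (simp add: sc_one)
next
  case (Suc k)
  have "\<phi> g * \<phi> h ^ Suc k = sc (if odd (genpar g) \<and> odd (genpar h) then - 1 else 1) * (\<phi> h * (\<phi> g * \<phi> h ^ k))"
    using comm[of g h] by (simp add: sc_one sc_uminus flip: mult.assoc)
  also have "\<dots> = sc (if odd (genpar g) \<and> odd (genpar h) then - 1 else 1) *
      sc (if odd (genpar g) \<and> odd (genpar h) then (-1) ^ k else 1) * (\<phi> h * \<phi> h ^ k * \<phi> g)"
    unfolding Suc.IH by (simp add: mult.assoc) (metis mult.assoc sc_central)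
  finally show ?case by (auto simp: sc_mult[symmetric] sc_one sc_uminus mult.assoc)
qed

text \<open>All the sign bookkeeping of the universal property is here: a new generator is sorted
  into an ordered product. Induction removes the least element \<open>h\<close> of the support. If
  \<open>g \<le> h\<close> the product is already ordered; otherwise \<open>g\<close> jumps over the
  power of \<open>h\<close> and the rest is the induction hypothesis.\<close>

lemma gen_evm:
  assumes "valid_mono genpar m"
  shows "\<phi> g * evm m = (if valid_mono genpar (madd (mgen g) m)
    then sc (msign genpar (mgen g) m) * evm (madd (mgen g) m) else 0)"
proof -
  have "finite A \<Longrightarrow> \<forall>m. supp m = A \<longrightarrow> valid_mono genpar m \<longrightarrow>
    \<phi> g * evm m = (if valid_mono genpar (madd (mgen g) m)
      then sc (msign genpar (mgen g) m) * evm (madd (mgen g) m) else 0)" for A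
  proof (induction A rule: finite_linorder_min_induct)
    case empty
    show ?case
    proof (intro allI impI)
      fix m :: "gen mono" assume "supp m = {}"
      then have m: "m = (\<lambda>_. 0)" by (auto simp: supp_def)
      have "evm (mgen g) = \<phi> g ^ mgen g g * evm ((mgen g)(g := 0))"
        by (rule evm_min) auto
      moreover have "(mgen g)(g := 0) = (\<lambda>_. 0)" by (auto simp: mgen_def)
      ultimately have "evm (mgen g) = \<phi> g" by (simp add: evm_zero mgen_def)
      then show "\<phi> g * evm m = (if valid_mono genpar (madd (mgen g) m)
          then sc (msign genpar (mgen g) m) * evm (madd (mgen g) m) else 0)"
        using m by (simp add: evm_zero sc_one)
    qed
  next
    case (insert h A)
    show ?case
    proof (intro allI impI)
      fix m assume sm: "supp m = insert h A" and vm: "valid_mono genpar m"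
      let ?m = "madd (mgen g) m"
      have fin: "finite (supp m)" using sm insert by simp
      have fin': "finite (supp ?m)" "finite (supp (m(h := 0)))"
      proof -
        have "supp ?m \<subseteq> insert g (supp m)" "supp (m(h := 0)) \<subseteq> supp m"
          by (auto simp: mgen_def supp_def split: if_splits)
        then show "finite (supp ?m)" "finite (supp (m(h := 0)))"
          using fin by (auto intro: finite_subset)
      qed
      show "\<phi> g * evm m = (if valid_mono genpar ?m then sc (msign genpar (mgen g) m) * evm ?m else 0)"
      proof (cases "g \<le> h")
        case True
        then have le: "g \<le> k" if "k \<in> supp m" for k using that sm insert.hyps(2) by fastforce
        then have le': "g \<le> k" if "k \<in> supp ?m" for k
          using that by (auto simp: supp_def mgen_def split: if_splits)
        have up: "?m(g := 0) = m(g := 0)" by (auto simp: mgen_def)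
        have e: "\<phi> g * evm m = \<phi> g ^ Suc (m g) * evm (m(g := 0))"
          by (subst evm_min[OF fin le]) (auto simp: mult.assoc)
        have e': "evm ?m = \<phi> g ^ Suc (m g) * evm (m(g := 0))"
          by (subst evm_min[OF fin'(1) le']) (simp_all add: up)
        show ?thesis
        proof (cases "valid_mono genpar ?m")
          case True
          then show ?thesis using e e' msign_min[of m g genpar, OF le] by (simp add: sc_one)
        next
          case False
          \<comment> \<open>Adding \<open>g\<close> can break validity only if \<open>g\<close> is
            odd and already present; then \<open>sq\<close> makes the left side vanish as
            well.\<close>
          then obtain k where k: "odd (genpar k)" "?m k > 1"
            using fin' by (auto simp: valid_mono_def not_le)
          have "m k \<le> 1" using vm k(1) unfolding valid_mono_def by blast
          then have "k = g" "m g = 1" using k(2) by (auto simp: mgen_def split: if_splits)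
          then show ?thesis using e False k(1) sq by (simp add: numeral_2_eq_2)
        qed
      next
        case False
        then have hg: "h < g" by simp
        define m' where "m' = m(h := 0)"
        have sm': "supp m' = A" using sm insert.hyps(2) by (auto simp: m'_def supp_def)
        have vm': "valid_mono genpar m'" by (rule valid_mono_le[OF vm]) (simp add: m'_def)
        define s :: complex where
          "s = (if odd (genpar g) \<and> odd (genpar h) then (-1) ^ m h else 1)"
        have hm: "evm m = \<phi> h ^ m h * evm m'" unfolding m'_def
          using sm insert.hyps(2) by (intro evm_min[OF fin]) fastforce
        have up: "?m(h := 0) = madd (mgen g) m'" using hg by (auto simp: m'_def mgen_def)
        have "evm ?m = \<phi> h ^ ?m h * evm (?m(h := 0))"
          using sm insert.hyps(2) hg
          by (intro evm_min[OF fin'(1)]) (fastforce simp: supp_def mgen_def split: if_splits)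
        then have hm2: "evm ?m = \<phi> h ^ m h * evm (madd (mgen g) m')"
          unfolding up using hg by (simp add: mgen_other)
        have "valid_mono genpar ?m \<longleftrightarrow> valid_mono genpar (madd (mgen g) m')"
        proof
          assume "valid_mono genpar ?m"
          then show "valid_mono genpar (madd (mgen g) m')"
            by (rule valid_mono_le) (simp add: m'_def)
        next
          assume v: "valid_mono genpar (madd (mgen g) m')"
          have "?m k \<le> 1" if "odd (genpar k)" for k
          proof (cases "k = h")
            case True
            then show ?thesis using that vm hg unfolding valid_mono_def by (simp add: mgen_other)
          next
            case False
            then have "madd (mgen g) m' k = ?m k" by (simp add: m'_def)
            then show ?thesis using that v unfolding valid_mono_def by metis
          qed
          then show "valid_mono genpar ?m" using fin' by (simp add: valid_mono_def)
        qed
        moreover have "msign genpar (mgen g) m = s * msign genpar (mgen g) m'"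
        proof -
          define d where "d = (\<lambda>k. if k = h then m h else 0)"
          have "m = madd d m'" by (auto simp: d_def m'_def)
          then have "msign genpar (mgen g) m = msign genpar (mgen g) d * msign genpar (mgen g) m'"
            using msign_madd_right[of genpar d m' "mgen g"] vm valid_mgen[of genpar g]
            by (simp add: valid_mono_def)
          moreover have "msign genpar (mgen g) d = s"
          proof -
            have mh: "m h \<noteq> 0" using sm by (auto simp: supp_def)
            have "{(u, v). mgen g u \<noteq> 0 \<and> d v \<noteq> 0 \<and> odd (genpar u) \<and> odd (genpar v) \<and> v < u} =
                (if odd (genpar g) \<and> odd (genpar h) then {(g, h)} else {})"
              using hg mh by (auto simp: mgen_def d_def split: if_splits)
            moreover have "m h = 1" if "odd (genpar h)"
              using vm mh that unfolding valid_mono_def by (metis One_nat_def le_antisym Suc_leI neq0_conv)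
            ultimately show ?thesis by (simp add: msign_def s_def)
          qed
          ultimately show ?thesis by simp
        qed
        moreover have "\<phi> g * evm m = sc s * \<phi> h ^ m h * (\<phi> g * evm m')"
          unfolding hm mult.assoc[symmetric] comm_power s_def ..
        moreover have "\<phi> g * evm m' = (if valid_mono genpar (madd (mgen g) m')
          then sc (msign genpar (mgen g) m') * evm (madd (mgen g) m') else 0)"
          using insert.IH sm' vm' by blast
        ultimately show ?thesis
          unfolding hm2
          by (simp add: sc_mult mult.assoc sc_left[of "\<phi> h ^ m h"])
      qed
    qed
  qed
  moreover have "finite (supp m)" using assms by (simp add: valid_mono_def)
  ultimately show ?thesis using assms by blast
qed

lemma hom_sum_superset:
  assumes "finite A" "{m. cf a m \<noteq> 0} \<subseteq> A"
  shows "hom a = (\<Sum>m\<in>A. sc (cf a m) * evm m)"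
  unfolding hom_def using assms by (intro sum.mono_neutral_left) (auto simp: sc_zero)

lemma hom_add [simp]: "hom (a + b) = hom a + hom b"
proof -
  let ?A = "{m. cf a m \<noteq> 0} \<union> {m. cf b m \<noteq> 0}"
  have A: "finite ?A" using finite_cf by simp
  have "hom (a + b) = (\<Sum>m\<in>?A. sc (cf (a + b) m) * evm m)"
    by (intro hom_sum_superset[OF A]) auto
  also have "\<dots> = hom a + hom b"
    by (simp add: sc_add distrib_right sum.distrib flip: hom_sum_superset[OF A])
  finally show ?thesis .
qed

lemma hom_zero [simp]: "hom 0 = 0"
  by (simp add: hom_def)

lemma hom_uminus [simp]: "hom (- a) = - hom a"
  using hom_add[of a "- a"] by (simp add: eq_neg_iff_add_eq_0 add.commute)

lemma hom_diff [simp]: "hom (a - b) = hom a - hom b"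
  using hom_add[of a "- b"] by simp

lemma hom_sum: "hom (sum f A) = (\<Sum>x\<in>A. hom (f x))"
  by (induction A rule: infinite_finite_induct) auto

lemma hom_scale [simp]: "hom (cn c * a) = sc c * hom a"
  by (subst hom_sum_superset[of "{m. cf a m \<noteq> 0}"])
    (auto simp: finite_cf sc_mult mult.assoc sum_distrib_left hom_def)

lemma hom_mon: "hom (mon m) = (if valid_mono genpar m then evm m else 0)"
  by (subst hom_sum_superset[of "{m}"]) (auto simp: cf_mon sc_one sc_zero)

lemma hom_one [simp]: "hom 1 = 1"
  using hom_mon[of "\<lambda>_. 0"] by (simp add: mon_zero evm_zero valid_mono_def supp_def)

lemma hom_cn [simp]: "hom (cn c) = sc c"
  using hom_scale[of c 1] by simp

lemma hom_gn [simp]: "hom (gn g) = \<phi> g"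
proof -
  have "\<phi> g * evm (\<lambda>_. 0) = evm (mgen g)"
    using gen_evm[of "\<lambda>_. 0" g] by (simp add: sc_one)
  then show ?thesis using hom_mon[of "mgen g"] by (simp add: mon_mgen evm_zero)
qed

lemma hom_gn_mult: "hom (gn g * a) = \<phi> g * hom a"
proof -
  have "gn g * a = (\<Sum>m | cf a m \<noteq> 0. cn (cf a m) * (gn g * mon m))"
    by (subst (1) sv_expand[of a]) (simp add: sum_distrib_left cn_left_commute)
  then have "gn g * a = (\<Sum>m | cf a m \<noteq> 0.
      cn (cf a m) * (cn (msign genpar (mgen g) m) * mon (madd (mgen g) m)))"
    by (simp only: gn_mult_mon)
  then have "hom (gn g * a) = (\<Sum>m | cf a m \<noteq> 0. sc (cf a m) *
      (sc (msign genpar (mgen g) m) * hom (mon (madd (mgen g) m))))"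
    by (simp only: hom_sum hom_scale)
  also have "\<dots> = (\<Sum>m | cf a m \<noteq> 0. sc (cf a m) * (\<phi> g * evm m))"
    using cf_valid[of a] by (intro sum.cong refl) (simp add: hom_mon gen_evm)
  also have "\<dots> = (\<Sum>m | cf a m \<noteq> 0. \<phi> g * (sc (cf a m) * evm m))"
    by (intro sum.cong refl) (metis mult.assoc sc_central)
  finally show ?thesis by (simp add: hom_def sum_distrib_left)
qed

lemma hom_mult [simp]: "hom (a * b) = hom a * hom b"
  by (induction a rule: sv_induct) (auto simp: distrib_right mult.assoc hom_gn_mult)

end

section \<open>Parity, superderivations and differential homomorphisms\<close>

lemma mpar_madd_mgen:
  assumes "finite (supp m)"
  shows "mpar par (madd (mgen g) m) = (par g + mpar par m) mod 2"
proof -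
  let ?A = "insert g (supp m)"
  have s: "(\<Sum>h\<in>supp x. x h * par h) = (\<Sum>h\<in>?A. x h * par h)" if "supp x \<subseteq> ?A" for x
    using that assms by (intro sum.mono_neutral_left) (auto simp: supp_def)
  have "(\<Sum>h\<in>supp (madd (mgen g) m). madd (mgen g) m h * par h) =
      (\<Sum>h\<in>?A. mgen g h * par h + m h * par h)"
    by (subst s) (auto simp: supp_def mgen_def distrib_right split: if_splits)
  also have "\<dots> = (\<Sum>h\<in>supp (mgen g). mgen g h * par h) + (\<Sum>h\<in>supp m. m h * par h)"
    by (simp only: sum.distrib) (subst (1 2) s, auto)
  finally show ?thesis unfolding mpar_def by (simp add: mod_add_right_eq)
qed

lemma msign_mgen_mgen:
  "msign par (mgen g) (mgen h) = (if odd (par g) \<and> odd (par h) \<and> h < g then -1 else 1)"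
proof -
  have "{(u, v). mgen g u \<noteq> 0 \<and> mgen h v \<noteq> 0 \<and> odd (par u) \<and> odd (par v) \<and> v < u} =
      (if odd (par g) \<and> odd (par h) \<and> h < g then {(g, h)} else {})"
    by (auto simp: mgen_def split: if_splits)
  then show ?thesis by (simp add: msign_def)
qed

lemma gn_sq:
  assumes "odd (genpar g)"
  shows "gn g * gn g = 0"
proof -
  have "madd (mgen g) (mgen g) g = 2" by simp
  then have "\<not> valid_mono genpar (madd (mgen g) (mgen g))"
    using assms unfolding valid_mono_def by (metis not_numeral_le_zero numeral_le_one_iff semiring_norm(69))
  then show ?thesis using mon_mult[of "mgen g" "mgen g"] by (simp add: mon_mgen mon_invalid)
qed

lemma gn_comm:
  "gn g * gn h = (if odd (genpar g) \<and> odd (genpar h) then - (gn h * gn g) else gn h * gn g)"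
proof (cases "g = h")
  case True
  then show ?thesis using gn_sq by auto
next
  case False
  have c: "madd (mgen h) (mgen g) = madd (mgen g) (mgen h)" by (auto simp: add.commute)
  have 1: "gn g * gn h = cn (msign genpar (mgen g) (mgen h)) * mon (madd (mgen g) (mgen h))"
    using mon_mult[of "mgen g" "mgen h"] by (simp only: mon_mgen)
  have 2: "gn h * gn g = cn (msign genpar (mgen h) (mgen g)) * mon (madd (mgen g) (mgen h))"
    using mon_mult[of "mgen h" "mgen g"] by (simp only: mon_mgen c)
  consider "g < h" "\<not> h < g" | "h < g" "\<not> g < h"
    using False by (metis less_asym neqE)
  then show ?thesis
    unfolding 1 2 msign_mgen_mgen by cases (simp_all del: less_prod_simp)
qed

text \<open>The parity automorphism. It exists because the defining relations are homogeneous, so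
  both sides acquire the same sign.\<close>

interpretation sgh: gen_hom cn "\<lambda>g. if odd (genpar g) then - gn g else gn g"
proof
  fix a :: complex and x :: sv
  show "x * cn a = cn a * x" by (rule cn_central)
next
  fix g h
  show "(if odd (genpar g) then - gn g else gn g) * (if odd (genpar h) then - gn h else gn h) =
    (if odd (genpar g) \<and> odd (genpar h)
     then - ((if odd (genpar h) then - gn h else gn h) * (if odd (genpar g) then - gn g else gn g))
     else (if odd (genpar h) then - gn h else gn h) * (if odd (genpar g) then - gn g else gn g))"
    using gn_comm[of g h] by (cases "odd (genpar g)"; cases "odd (genpar h)") simp_all
qed (simp_all add: cn_mult gn_sq)

definition sg :: "sv \<Rightarrow> sv" where "sg = sgh.hom"

lemma sg_simps [simp]:
  "sg (a + b) = sg a + sg b" "sg (a - b) = sg a - sg b" "sg (- a) = - sg a" "sg 0 = 0" "sg 1 = 1"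
  "sg (a * b) = sg a * sg b" "sg (cn c) = cn c"
  by (simp_all add: sg_def)

lemma sg_gn: "sg (gn g) = (if odd (genpar g) then - gn g else gn g)"
  by (simp add: sg_def)

lemma sg_sum: "sg (sum f A) = (\<Sum>x\<in>A. sg (f x))"
  by (simp add: sg_def sgh.hom_sum)

lemma sg_sg [simp]: "sg (sg a) = a"
  by (induction a rule: sv_induct) (auto simp: sg_gn)

lemma sg_mon: "finite (supp m) \<Longrightarrow> sg (mon m) = cn ((-1) ^ mpar genpar m) * mon m"
proof (induction m rule: mono_induct)
  case zero
  then show ?case by (simp add: mon_zero mpar_def supp_def)
next
  case (gen g m)
  have p: "mpar genpar m < 2" by (simp add: mpar_def)
  show ?case
    using gen p by (cases "odd (genpar g)"; cases "mpar genpar m = 0")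
      (auto simp: mpar_madd_mgen sg_gn less_2_cases_iff odd_iff_mod_2_eq_one mod_Suc
        even_iff_mod_2_eq_zero mod_add_eq[symmetric] simp flip: gn_mult_mon_min)
qed

lemma cf_sg: "cf (sg a) m = (-1) ^ mpar genpar m * cf a m"
proof -
  have "sg a = (\<Sum>x | cf a x \<noteq> 0. cn (cf a x) * (cn ((-1) ^ mpar genpar x) * mon x))"
    using cf_valid[of a] by (subst sv_expand[of a]) (auto simp: sg_sum sg_mon valid_mono_def intro!: sum.cong)
  then have "cf (sg a) m = (\<Sum>x | cf a x \<noteq> 0. cf a x * ((-1) ^ mpar genpar x * cf (mon x) m))"
    by simp
  also have "\<dots> = (\<Sum>x | cf a x \<noteq> 0. if x = m then (-1) ^ mpar genpar m * cf a m else 0)"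
    using cf_valid[of a] by (intro sum.cong refl) (auto simp: cf_mon)
  also have "\<dots> = (-1) ^ mpar genpar m * cf a m"
    using finite_cf[of a] by (auto simp: sum.delta)
  finally show ?thesis .
qed

lemma sinv_cf: "sinv genpar (cf a) = cf (sg a)"
  by (auto simp: sinv_def cf_sg)

text \<open>The Koszul sign for moving something of parity \<open>e\<close> past \<open>a\<close>,
  in a form that also covers inhomogeneous \<open>a\<close>.\<close>

definition tw :: "nat \<Rightarrow> sv \<Rightarrow> sv" where "tw e a = (if even e then a else sg a)"

lemma tw_simps [simp]:
  "tw e (a + b) = tw e a + tw e b" "tw e (a - b) = tw e a - tw e b" "tw e (- a) = - tw e a"
  "tw e 0 = 0" "tw e 1 = 1" "tw e (a * b) = tw e a * tw e b" "tw e (cn c) = cn c"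
  by (simp_all add: tw_def)

text \<open>Homogeneity as an eigenvector equation for \<open>sg\<close>. The parity counts only
  modulo 2, whereas \<open>homog\<close> requires the reduced value 0 or 1; sums of parities can
  thus be used as they come.\<close>

definition hpar :: "nat \<Rightarrow> sv \<Rightarrow> bool" where
  "hpar e a \<longleftrightarrow> sg a = (if even e then a else - a)"

lemma hpar_cong: "even e = even e' \<Longrightarrow> hpar e a = hpar e' a"
  by (simp add: hpar_def)

lemma hpar_zero [simp]: "hpar e 0"
  by (simp add: hpar_def)

lemma hpar_cn: "even e \<Longrightarrow> hpar e (cn c)"
  by (simp add: hpar_def)

lemma hpar_add: "hpar e a \<Longrightarrow> hpar e b \<Longrightarrow> hpar e (a + b)"
  by (auto simp: hpar_def)

lemma hpar_diff: "hpar e a \<Longrightarrow> hpar e b \<Longrightarrow> hpar e (a - b)"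
  by (auto simp: hpar_def)

lemma hpar_uminus: "hpar e a \<Longrightarrow> hpar e (- a)"
  by (auto simp: hpar_def)

lemma hpar_sum: "(\<And>x. x \<in> A \<Longrightarrow> hpar e (f x)) \<Longrightarrow> hpar e (sum f A)"
  by (induction A rule: infinite_finite_induct) (auto intro: hpar_add)

lemma hpar_mult: "hpar e a \<Longrightarrow> hpar f b \<Longrightarrow> hpar (e + f) (a * b)"
  by (auto simp: hpar_def)

lemma hpar_cn_mult: "hpar e a \<Longrightarrow> hpar e (cn c * a)"
  by (auto simp: hpar_def)

lemma hpar_gn: "hpar (genpar g) (gn g)"
  by (simp add: hpar_def sg_gn)

lemma tw_hpar: "hpar f a \<Longrightarrow> tw e a = (if odd e \<and> odd f then - a else a)"
  by (simp add: tw_def hpar_def)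

lemma tw_tw: "tw e (tw f a) = tw (e + f) a"
  by (simp add: tw_def)

lemma tw_cong: "even e = even f \<Longrightarrow> tw e = tw f"
  by (simp add: tw_def fun_eq_iff)

lemma gn_supercomm: "gn g * a = tw (genpar g) a * gn g"
proof (induction a rule: sv_induct)
  case (cn c)
  then show ?case by (simp add: cn_central)
next
  case (add a b)
  then show ?case by (simp add: algebra_simps)
next
  case (gn h a)
  have "gn g * (gn h * a) = tw (genpar g) (gn h) * (gn g * a)"
    using gn_comm[of g h] by (auto simp: tw_def sg_gn mult.assoc[symmetric])
  then show ?case using gn by (simp add: mult.assoc)
qed

lemma supercomm:
  assumes "hpar e a"
  shows "a * b = tw e b * a"
proof (induction b rule: sv_induct)
  case (cn c)
  then show ?case by (simp add: cn_central)
next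
  case (add b c)
  then show ?case by (simp add: algebra_simps)
next
  case (gn g b)
  have "a * gn g = tw e (gn g) * a"
    using gn_supercomm[of g a] assms by (auto simp: tw_def hpar_def sg_gn split: if_splits)
  then show ?case using gn by (simp flip: mult.assoc) (simp add: mult.assoc)
qed

lemma sv_eq_uminus: "(a :: sv) = - a \<Longrightarrow> a = 0"
proof (rule sv_eqI)
  fix m assume "a = - a"
  then have "cf a m = - cf a m" by (metis cf_simps(4))
  then show "cf a m = cf 0 m" by simp
qed

lemma odd_sq:
  assumes "hpar e a" "odd e"
  shows "a * a = 0"
proof -
  have "a * a = - (a * a)"
    using supercomm[OF assms(1), of a] assms by (simp add: tw_def hpar_def)
  then show ?thesis by (rule sv_eq_uminus)
qed

section \<open>Parity-preserving homomorphisms and superderivations\<close>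

definition is_hom :: "(sv \<Rightarrow> sv) \<Rightarrow> bool" where
  "is_hom h \<longleftrightarrow> (\<forall>a b. h (a + b) = h a + h b) \<and> (\<forall>a b. h (a * b) = h a * h b) \<and>
    (\<forall>c. h (cn c) = cn c) \<and> (\<forall>a. h (sg a) = sg (h a))"

text \<open>The last clause says that \<open>d\<close> itself has parity \<open>e\<close>; the
  Leibniz rule is stated with \<open>tw\<close> so that \<open>a\<close> may be
  inhomogeneous.\<close>

definition is_der :: "nat \<Rightarrow> (sv \<Rightarrow> sv) \<Rightarrow> bool" where
  "is_der e d \<longleftrightarrow> (\<forall>a b. d (a + b) = d a + d b) \<and> (\<forall>c. d (cn c) = 0) \<and>
    (\<forall>a b. d (a * b) = d a * b + tw e a * d b) \<and>
    (\<forall>a. sg (d a) = (if even e then d (sg a) else - d (sg a)))"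

lemma ex_hom:
  assumes "\<And>g. hpar (genpar g) (f g)"
  shows "\<exists>h. is_hom h \<and> (\<forall>g. h (gn g) = f g)"
proof -
  have comm: "f g * f h = (if odd (genpar g) \<and> odd (genpar h) then - (f h * f g) else f h * f g)" for g h
    using supercomm[OF assms, of g "f h"] tw_hpar[OF assms, of "genpar g" h] by auto
  have sq: "odd (genpar g) \<Longrightarrow> f g * f g = 0" for g by (rule odd_sq[OF assms])
  interpret F: gen_hom cn f
    by (rule gen_hom.intro; (rule cn_simps(3) cn_mult cn_simps(2) cn_central comm | erule sq))
  have "F.hom (sg a) = sg (F.hom a)" for a
    using assms by (induction a rule: sv_induct) (auto simp: sg_gn hpar_def)
  then have "is_hom F.hom" by (simp add: is_hom_def)
  then show ?thesis by (intro exI[of _ F.hom]) simp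
qed

text \<open>A map \<open>d\<close> is a superderivation twisted by the \<open>e\<close>-th power of the parity
 automorphism \<open>\<sigma>\<close> iff \<open>a \<mapsto> ((\<sigma>\<^sup>e a, d a), (0, a))\<close> is multiplicative; so superderivations come from
 the universal property applied to upper triangular matrices.\<close>

datatype ut = UT (uta: sv) (utb: sv) (utc: sv)

instantiation ut :: ring_1
begin
definition "0 = UT 0 0 0"
definition "1 = UT 1 0 1"
definition "x + y = UT (uta x + uta y) (utb x + utb y) (utc x + utc y)"
definition "x - y = UT (uta x - uta y) (utb x - utb y) (utc x - utc y)"
definition "- x = UT (- uta x) (- utb x) (- utc x)"
definition "x * y = UT (uta x * uta y) (uta x * utb y + utb x * utc y) (utc x * utc y)"
instance
  by standard (auto simp: zero_ut_def one_ut_def plus_ut_def minus_ut_def uminus_ut_def times_ut_def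
      algebra_simps ut.expand)
end

lemma is_der_one: "is_der e d \<Longrightarrow> d 1 = 0"
  unfolding is_der_def by (metis cn_simps(2))

lemma ex_der:
  assumes "\<And>g. hpar (genpar g + e) (f g)"
  shows "\<exists>d. is_der e d \<and> (\<forall>g. d (gn g) = f g)"
proof -
  let ?sc = "\<lambda>c. UT (cn c) 0 (cn c)"
  let ?\<phi> = "\<lambda>g. UT (tw e (gn g)) (f g) (gn g)"
  have gf: "gn g * f h = (if odd (genpar g) \<and> odd (genpar h + e) then - (f h * gn g) else f h * gn g)" for g h
    using gn_supercomm[of g "f h"] tw_hpar[OF assms, of "genpar g" h] by auto
  have tg: "tw e (gn g) = (if odd e \<and> odd (genpar g) then - gn g else gn g)" for g
    by (rule tw_hpar[OF hpar_gn])
  have comm: "?\<phi> g * ?\<phi> h = (if odd (genpar g) \<and> odd (genpar h) then - (?\<phi> h * ?\<phi> g) else ?\<phi> h * ?\<phi> g)" for g h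
  proof -
    have "tw e (gn g) * f h + f g * gn h = (if odd (genpar g) \<and> odd (genpar h)
       then - (tw e (gn h) * f g + f h * gn g) else tw e (gn h) * f g + f h * gn g)"
      unfolding tg by (cases "odd (genpar g)"; cases "odd (genpar h)"; cases "odd e") (simp_all add: gf)
    moreover have "tw e (gn g) * tw e (gn h) = (if odd (genpar g) \<and> odd (genpar h)
       then - (tw e (gn h) * tw e (gn g)) else tw e (gn h) * tw e (gn g))"
      unfolding tg using gn_comm[of g h] by auto
    ultimately show ?thesis using gn_comm[of g h] by (auto simp: times_ut_def uminus_ut_def)
  qed
  have sq: "?\<phi> g * ?\<phi> g = 0" if "odd (genpar g)" for g
    using that gn_sq[OF that] gf[of g g]
    by (cases "odd e") (auto simp: times_ut_def zero_ut_def tg)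
  have sc: "?sc (a + b) = ?sc a + ?sc b" "?sc (a * b) = ?sc a * ?sc b" "?sc 1 = 1" "x * ?sc a = ?sc a * x"
    for a b x
    by (simp_all add: cn_mult times_ut_def plus_ut_def one_ut_def cn_central[of "uta x"]
        cn_central[of "utb x"] cn_central[of "utc x"])
  interpret U: gen_hom ?sc ?\<phi>
    by (rule gen_hom.intro; (rule sc comm | erule sq))
  define d where "d = (\<lambda>a. utb (U.hom a))"
  have a: "uta (U.hom a) = tw e a \<and> utc (U.hom a) = a" for a
    by (induction a rule: sv_induct) (auto simp: plus_ut_def times_ut_def)
  have add: "d (a + b) = d a + d b" for a b by (simp add: d_def plus_ut_def)
  have mult: "d (a * b) = d a * b + tw e a * d b" for a b
    using a by (simp add: d_def times_ut_def add.commute)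
  have dcn: "d (cn c) = 0" for c by (simp add: d_def)
  have dgn: "d (gn g) = f g" for g by (simp add: d_def)
  have "sg (d a) = (if even e then d (sg a) else - d (sg a))" for a
  proof (induction a rule: sv_induct)
    case (gn g a)
    have "sg (f g) = (if even (genpar g + e) then f g else - f g)"
      using assms[of g] by (simp add: hpar_def)
    moreover have "d (- x) = - d x" for x using mult[of "cn (-1)" x] dcn[of "-1"] by simp
    ultimately show ?case using gn
      by (cases "odd e"; cases "odd (genpar g)") (simp_all add: mult dgn sg_gn tw_def algebra_simps)
  qed (auto simp: add dcn)
  then have "is_der e d" using add mult dcn by (simp add: is_der_def)
  then show ?thesis using dgn by blast
qed

lemma is_homD:
  assumes "is_hom h"
  shows "h (a + b) = h a + h b" "h (a * b) = h a * h b" "h (cn c) = cn c" "h (sg a) = sg (h a)"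
    "h 0 = 0" "h 1 = 1" "h (- a) = - h a" "h (a - b) = h a - h b"
proof -
  show 1: "h (a + b) = h a + h b" "h (a * b) = h a * h b" "h (cn c) = cn c" "h (sg a) = sg (h a)" for a b
    using assms by (auto simp: is_hom_def)
  show "h 0 = 0" "h 1 = 1"
    using assms cn_simps(1,2) unfolding is_hom_def by metis+
  show 2: "h (- a) = - h a" for a
    using 1(2)[of "cn (-1)" a] assms by (simp add: is_hom_def) (metis cn_simps(2,4) mult_1 mult_minus_left)
  show "h (a - b) = h a - h b" using 1(1)[of a "- b"] 2 by simp
qed

lemma is_hom_tw: "is_hom h \<Longrightarrow> h (tw e a) = tw e (h a)"
  by (simp add: tw_def is_homD)

lemma is_hom_sum: "is_hom h \<Longrightarrow> h (sum f A) = (\<Sum>x\<in>A. h (f x))"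
  by (induction A rule: infinite_finite_induct) (auto simp: is_homD)

lemma is_hom_hpar: "is_hom h \<Longrightarrow> hpar e a \<Longrightarrow> hpar e (h a)"
  unfolding hpar_def by (metis is_homD(4,7))

lemma is_derD:
  assumes "is_der e d"
  shows "d (a + b) = d a + d b" "d (a * b) = d a * b + tw e a * d b" "d (cn c) = 0"
    "d 0 = 0" "d 1 = 0" "d (cn c * a) = cn c * d a" "d (- a) = - d a" "d (a - b) = d a - d b"
    "sg (d a) = (if even e then d (sg a) else - d (sg a))"
proof -
  show 1: "d (a + b) = d a + d b" "d (a * b) = d a * b + tw e a * d b" "d (cn c) = 0"
    "sg (d a) = (if even e then d (sg a) else - d (sg a))" for a b c
    using assms by (auto simp: is_der_def)
  show "d 0 = 0" using 1(3)[of 0] by simp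
  show "d 1 = 0" by (rule is_der_one[OF assms])
  show 2: "d (cn c * a) = cn c * d a" for c a by (simp add: 1)
  show 3: "d (- a) = - d a" for a using 2[of "-1" a] by simp
  show "d (a - b) = d a - d b" using 1(1)[of a "- b"] 3 by simp
qed

lemma is_der_sum: "is_der e d \<Longrightarrow> d (sum f A) = (\<Sum>x\<in>A. d (f x))"
  by (induction A rule: infinite_finite_induct) (auto simp: is_derD)

lemma is_der_hpar:
  assumes "is_der e d" "hpar f a"
  shows "hpar (e + f) (d a)"
  using assms is_derD(9)[OF assms(1), of a] is_derD(7)[OF assms(1), of a]
  unfolding hpar_def by (auto split: if_splits)

section \<open>Generated subalgebras\<close>

inductive_set alg :: "sv set \<Rightarrow> sv set" for S where
  alg_cn: "cn c \<in> alg S"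
| alg_gen: "s \<in> S \<Longrightarrow> s \<in> alg S"
| alg_add: "a \<in> alg S \<Longrightarrow> b \<in> alg S \<Longrightarrow> a + b \<in> alg S"
| alg_mult: "a \<in> alg S \<Longrightarrow> b \<in> alg S \<Longrightarrow> a * b \<in> alg S"

lemma alg_zero [simp]: "0 \<in> alg S" and alg_one [simp]: "1 \<in> alg S"
  using alg_cn[of 0 S] alg_cn[of 1 S] by simp_all

lemma alg_uminus: "a \<in> alg S \<Longrightarrow> - a \<in> alg S"
  using alg_mult[OF alg_cn[of "-1"]] by fastforce

lemma alg_diff: "a \<in> alg S \<Longrightarrow> b \<in> alg S \<Longrightarrow> a - b \<in> alg S"
  using alg_add[of a S "- b"] alg_uminus by simp

lemma alg_sum: "(\<And>x. x \<in> A \<Longrightarrow> f x \<in> alg S) \<Longrightarrow> sum f A \<in> alg S"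
  by (induction A rule: infinite_finite_induct) (auto intro: alg_add)

lemma alg_subset:
  assumes "a \<in> alg S" "S \<subseteq> alg T"
  shows "a \<in> alg T"
  using assms by induction (auto intro: alg.intros)

lemma alg_mono: "S \<subseteq> T \<Longrightarrow> alg S \<subseteq> alg T"
  using alg_subset alg.alg_gen by blast

lemma alg_sg:
  assumes "\<And>s. s \<in> S \<Longrightarrow> sg s \<in> alg S" "a \<in> alg S"
  shows "sg a \<in> alg S"
  using assms(2) by induction (auto intro: alg.intros assms(1))

lemma alg_tw:
  assumes "\<And>s. s \<in> S \<Longrightarrow> sg s \<in> alg S" "a \<in> alg S"
  shows "tw e a \<in> alg S"
  using alg_sg[OF assms] assms(2) by (simp add: tw_def)

lemma alg_der:
  assumes "is_der e d" "\<And>s. s \<in> S \<Longrightarrow> d s \<in> alg S" "\<And>s. s \<in> S \<Longrightarrow> sg s \<in> alg S" "a \<in> alg S"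
  shows "d a \<in> alg S"
  using assms(4)
proof induction
  case (alg_mult a b)
  then show ?case using alg_tw[of S a e] assms(3) by (auto simp: is_derD[OF assms(1)] intro!: alg.alg_add alg.alg_mult)
qed (auto simp: is_derD[OF assms(1)] assms(2) intro: alg.alg_add)

lemma alg_hom:
  assumes "is_hom h" "\<And>s. s \<in> S \<Longrightarrow> h s \<in> alg T" "a \<in> alg S"
  shows "h a \<in> alg T"
  using assms(3) by induction (auto simp: is_homD[OF assms(1)] assms(2) intro: alg.intros)

lemma alg_hom_eq:
  assumes "is_hom h" "is_hom k" "\<And>s. s \<in> S \<Longrightarrow> h s = k s" "a \<in> alg S"
  shows "h a = k a"
  using assms(4) by induction (auto simp: is_homD[OF assms(1)] is_homD[OF assms(2)] assms(3))

lemma is_hom_comp: "is_hom h \<Longrightarrow> is_hom k \<Longrightarrow> is_hom (\<lambda>a. h (k a))"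
  by (simp add: is_hom_def)

lemma is_hom_id: "is_hom (\<lambda>a. a)"
  by (simp add: is_hom_def)

lemma genpar_simp: "genpar (k, l, m) = (pp k + pp l + 1 + m) mod 2"
  by (simp add: genpar_def)

section \<open>The odd derivation D and differential homomorphisms\<close>

definition DD :: "sv \<Rightarrow> sv" where
  "DD = (SOME d. is_der 1 d \<and> (\<forall>g. d (gn g) = (case g of (k, l, m) \<Rightarrow> gn (k, l, Suc m))))"

lemma DD_spec: "is_der 1 DD \<and> (\<forall>g. DD (gn g) = (case g of (k, l, m) \<Rightarrow> gn (k, l, Suc m)))"
proof -
  have "hpar (genpar g + 1) (case g of (k, l, m) \<Rightarrow> gn (k, l, Suc m))" for g
  proof -
    obtain k l m where g: "g = (k, l, m)" by (cases g) auto
    have "even (genpar (k, l, m) + 1) = even (genpar (k, l, Suc m))"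
      by (simp add: genpar_simp mod_2_eq_odd)
    then show ?thesis using hpar_gn[of "(k, l, Suc m)"] by (simp add: g hpar_def)
  qed
  from ex_der[OF this] have "\<exists>d. is_der 1 d \<and> (\<forall>g. d (gn g) = (case g of (k, l, m) \<Rightarrow> gn (k, l, Suc m)))" .
  then show ?thesis unfolding DD_def by (rule someI_ex)
qed

lemma DD_der: "is_der 1 DD" using DD_spec by blast

lemma DD_gn [simp]: "DD (gn (k, l, m)) = gn (k, l, Suc m)" using DD_spec by simp

lemma DD_simps [simp]:
  "DD (a + b) = DD a + DD b" "DD (cn c) = 0" "DD 0 = 0" "DD 1 = 0" "DD (cn c * a) = cn c * DD a"
  "DD (- a) = - DD a" "DD (a - b) = DD a - DD b"
  by (simp_all add: is_derD[OF DD_der])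

lemma DD_mult: "DD (a * b) = DD a * b + sg a * DD b"
  by (simp add: is_derD[OF DD_der] tw_def)

lemma sg_DD: "sg (DD a) = - DD (sg a)"
  using is_derD(9)[OF DD_der, of a] by simp

lemma DD_sum: "DD (sum f A) = (\<Sum>x\<in>A. DD (f x))"
  by (rule is_der_sum[OF DD_der])

lemma hpar_DD: "hpar e a \<Longrightarrow> hpar (Suc e) (DD a)"
  using is_der_hpar[OF DD_der] by fastforce

lemma hpar_DD_pow: "hpar e a \<Longrightarrow> hpar (e + m) ((DD ^^ m) a)"
  by (induction m) (auto dest: hpar_DD)

lemma DD_pow_gn [simp]: "(DD ^^ m) (gn (k, l, i)) = gn (k, l, i + m)"
  by (induction m) auto

lemma DD_pow_simps [simp]:
  "(DD ^^ m) (a + b) = (DD ^^ m) a + (DD ^^ m) b" "(DD ^^ m) (cn c * a) = cn c * (DD ^^ m) a"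
  "(DD ^^ m) 0 = 0" "(DD ^^ m) (a - b) = (DD ^^ m) a - (DD ^^ m) b"
  by (induction m) auto

text \<open>Source of \<open>rho\<close>, \<open>Theta\<close> and \<open>Psi\<close>. The images of
  the derived generators are forced, and commutation with \<open>DD\<close> spreads from generators
  to products by the Leibniz rule because \<open>h\<close> preserves parity.\<close>

lemma ex_dhom:
  assumes "\<And>i j. hpar (genpar (i, j, 0)) (f i j)"
  shows "\<exists>h. is_hom h \<and> (\<forall>a. h (DD a) = DD (h a)) \<and> (\<forall>i j. h (gn (i, j, 0)) = f i j)"
proof -
  have "hpar (genpar g) (case g of (i, j, m) \<Rightarrow> (DD ^^ m) (f i j))" for g
  proof -
    obtain i j m where g: "g = (i, j, m)" by (cases g) auto
    have "even (genpar (i, j, 0) + m) = even (genpar (i, j, m))"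
      by (simp add: genpar_simp mod_2_eq_odd)
    then show ?thesis using hpar_DD_pow[OF assms, of i j m] by (simp add: g hpar_def)
  qed
  from ex_hom[OF this] obtain h where h: "is_hom h"
    "\<And>g. h (gn g) = (case g of (i, j, m) \<Rightarrow> (DD ^^ m) (f i j))" by blast
  have "h (DD a) = DD (h a)" for a
  proof (induction a rule: sv_induct)
    case (gn g a)
    have "h (DD (gn g)) = DD (h (gn g))" by (cases g) (simp add: h(2))
    then show ?case using gn by (simp add: DD_mult is_homD[OF h(1)])
  qed (auto simp: is_homD[OF h(1)])
  then show ?thesis using h by (intro exI[of _ h]) simp
qed

section \<open>The derivation and the bracket\<close>

declare cf_simps [simp del] cf_cn_mult [simp del] cf_sum [simp del]

lemma cf_in_VV [simp]: "cf a \<in> VV"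
  by (rule cf)

lemma cf_transfer:
  "sadd (cf a) (cf b) = cf (a + b)" "sscale c (cf a) = cf (cn c * a)" "Vmul (cf a) (cf b) = cf (a * b)"
  "szero = cf 0" "svar g = cf (gn g)" "sconst c = cf (cn c)" "sone = cf 1"
proof -
  show "sscale c (cf a) = cf (cn c * a)" by (rule ext) (simp add: sscale_def cf_cn_mult)
qed (simp_all add: plus_sv.rep_eq times_sv.rep_eq szero_def gn.rep_eq cn.rep_eq one_sv.rep_eq cf_simps)

lemmas cf_ops = cf_transfer(1-3,5-7)

lemma homog_imp_hpar:
  assumes "homog genpar (cf a) e"
  shows "hpar e a"
proof -
  have "cf (sg a) m = cf (if even e then a else - a) m" for m
    using assms by (cases "cf a m = 0") (auto simp: cf_sg homog_def cf_simps)
  then show ?thesis unfolding hpar_def by (rule sv_eqI)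
qed

lemma hpar_imp_homog:
  assumes "hpar e a" "e < 2"
  shows "homog genpar (cf a) e"
  unfolding homog_def
proof (intro allI impI)
  fix m assume m: "cf a m \<noteq> 0"
  have "(-1) ^ mpar genpar m * cf a m = (if even e then cf a m else - cf a m)"
    using assms(1) cf_sg[of a m] by (auto simp: hpar_def cf_simps split: if_splits)
  then have "even (mpar genpar m) = even e"
    using m by (cases "even (mpar genpar m)"; cases "even e") auto
  moreover have "mpar genpar m < 2" by (simp add: mpar_def)
  ultimately show "mpar genpar m = e"
    using assms(2) by (auto simp: less_2_cases_iff)
qed

lemma VV_ex: "p \<in> VV \<Longrightarrow> \<exists>a. p = cf a"
  using Sv_inverse by metis

text \<open>\<open>Dder\<close> is a definite description, so both halves are owed:
  \<open>DD\<close> satisfies its clauses, and any competitor agrees with \<open>DD\<close> by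
  \<open>sv_induct\<close>.\<close>

lemma Dder_cf: "Dder (cf a) = cf (DD a)"
proof -
  let ?d = "\<lambda>p. if p \<in> VV then cf (DD (Sv p)) else szero"
  have d: "?d (cf a) = cf (DD a)" for a by (simp add: cf_inverse)
  have "Dder = ?d"
    unfolding Dder_def
  proof (rule the_equality, goal_cases)
    case 1
    have mult: "?d (Vmul y z) = sadd (Vmul (?d y) z) (sscale ((-1) ^ e) (Vmul y (?d z)))"
      if yz: "y \<in> VV" "z \<in> VV" and e: "homog genpar y e" for y z e
    proof -
      obtain a b where ab: "y = cf a" "z = cf b" using VV_ex[OF yz(1)] VV_ex[OF yz(2)] by blast
      have "sg a = cn ((-1) ^ e) * a"
        using homog_imp_hpar[of a e] e ab by (auto simp: hpar_def)
      then show ?thesis unfolding ab cf_ops d by (simp add: DD_mult mult.assoc)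
    qed
    have add: "?d (sadd p q) = sadd (?d p) (?d q)" if pq: "p \<in> VV" "q \<in> VV" for p q
    proof -
      obtain a b where ab: "p = cf a" "q = cf b" using VV_ex[OF pq(1)] VV_ex[OF pq(2)] by blast
      show ?thesis unfolding ab cf_ops d by simp
    qed
    have scale: "?d (sscale c p) = sscale c (?d p)" if pq: "p \<in> VV" for c p
    proof -
      obtain a where a: "p = cf a" using VV_ex[OF pq] by blast
      show ?thesis unfolding a cf_ops d by simp
    qed
    have var: "?d (svar (k, l, m)) = svar (k, l, Suc m)" for k l m
      unfolding cf_ops d by simp
    show ?case using mult add scale var by auto
  next
    case (2 d')
    have VV: "d' (cf a) \<in> VV" for a using 2 cf_in_VV by blast
    have out: "p \<notin> VV \<Longrightarrow> d' p = szero" for p using 2 by blast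
    have addd: "d' (cf (a + b)) = sadd (d' (cf a)) (d' (cf b))" for a b
      using 2 unfolding cf_transfer(1)[symmetric] by (metis cf_in_VV)
    have scale: "d' (cf (cn c * a)) = sscale c (d' (cf a))" for c a
      using 2 unfolding cf_transfer(2)[symmetric] by (metis cf_in_VV)
    have var: "d' (cf (gn (k, l, m))) = cf (gn (k, l, Suc m))" for k l m
      using 2 unfolding cf_transfer(5)[symmetric] by metis
    have mult: "d' (cf (a * b)) = sadd (Vmul (d' (cf a)) (cf b)) (sscale ((-1) ^ e) (Vmul (cf a) (d' (cf b))))"
      if "homog genpar (cf a) e" for a b e
      using 2 that unfolding cf_transfer(3)[symmetric] by (metis cf_in_VV)
    have "d' (cf a) = cf (DD a)" for a
    proof (induction a rule: sv_induct)
      case (cn c)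
      obtain b where b: "d' (cf 1) = cf b" using VV_ex[OF VV] by blast
      have "homog genpar (cf 1) 0" by (rule hpar_imp_homog) (auto simp: hpar_def)
      \<comment> \<open>The Leibniz rule for \<open>1 * 1\<close> makes the value at 1 equal to its
        own double, so it vanishes.\<close>
      from mult[OF this, of 1] have "cf b = cf (b + b)" by (simp add: b cf_transfer)
      then have "b = 0" by (simp add: cf_inject)
      then show ?case using scale[of c 1] b by (simp add: cf_transfer)
    next
      case (add a b)
      then show ?case by (simp add: addd cf_transfer)
    next
      case (gn g a)
      obtain k l m where g: "g = (k, l, m)" by (cases g) auto
      have "homog genpar (cf (gn g)) (genpar g)"
        by (rule hpar_imp_homog[OF hpar_gn]) (simp add: genpar_def split: prod.splits)
      moreover have "sg (gn g) = cn ((-1) ^ genpar g) * gn g" by (simp add: sg_gn)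
      ultimately show ?case using gn mult[of "gn g" "genpar g" a]
        by (simp add: g var cf_transfer DD_mult mult.assoc)
    qed
    then show ?case using out by (auto simp: fun_eq_iff cf_inverse dest!: VV_ex)
  qed
  from fun_cong[OF this, of "cf a"] show ?thesis by (simp add: cf_inverse)
qed

lemma Dpow_cf: "Dpow m (cf a) = cf ((DD ^^ m) a)"
  unfolding Dpow_def by (induction m) (auto simp: Dder_cf)

definition bars :: "mat \<Rightarrow> sv" where
  "bars X = (\<Sum>(k, l)\<in>{(k, l). X k l \<noteq> 0}. cn (X k l) * gn (k, l, 0))"

lemma bar_cf: "bar X = cf (bars X)"
proof
  fix m
  show "bar X m = cf (bars X) m"
    unfolding bar_def bars_def cf_sum by (intro sum.cong) (auto simp: gn.rep_eq cf_cn_mult)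
qed

lemma bars_superset:
  assumes "finite A" "\<And>k l. X k l \<noteq> 0 \<Longrightarrow> (k, l) \<in> A"
  shows "bars X = (\<Sum>(k, l)\<in>A. cn (X k l) * gn (k, l, 0))"
  unfolding bars_def using assms by (intro sum.mono_neutral_left) auto

lemma bars_Emat: "bars (Emat k l) = gn (k, l, 0)"
  by (subst bars_superset[of "{(k, l)}"]) (auto simp: Emat_def split: if_splits)

lemma bars_lin:
  assumes "finite {(k, l). X k l \<noteq> 0}" "finite {(k, l). Y k l \<noteq> 0}"
  shows "bars (\<lambda>a b. c * X a b + d * Y a b) = cn c * bars X + cn d * bars Y"
proof -
  let ?A = "{(k, l). X k l \<noteq> 0} \<union> {(k, l). Y k l \<noteq> 0}"
  have A: "finite ?A" using assms by simp
  have s: "bars Z = (\<Sum>(k, l)\<in>?A. cn (Z k l) * gn (k, l, 0))" if "\<And>k l. Z k l \<noteq> 0 \<Longrightarrow> (k, l) \<in> ?A" for Z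
    by (rule bars_superset[OF A that])
  have "bars (\<lambda>a b. c * X a b + d * Y a b) =
      (\<Sum>(k, l)\<in>?A. cn c * (cn (X k l) * gn (k, l, 0)) + cn d * (cn (Y k l) * gn (k, l, 0)))"
    by (subst s) (auto simp: cn_mult distrib_right mult.assoc intro!: sum.cong)
  also have "\<dots> = cn c * bars X + cn d * bars Y"
    by (simp add: s[of X] s[of Y] sum.distrib sum_distrib_left case_prod_unfold)
  finally show ?thesis .
qed

lemma finite_Emat: "finite {(a, b). Emat k l a b \<noteq> 0}"
  by (rule finite_subset[of _ "{(k, l)}"]) (auto simp: Emat_def split: if_splits)

section \<open>Brackets of generators, one power of \<chi> at a time\<close>

definition brs :: "nat \<Rightarrow> nat \<Rightarrow> nat \<Rightarrow> nat \<Rightarrow> nat \<Rightarrow> sv" where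
  "brs k l i j t = (if t = 0 then cn ((-1) ^ ((pp k + pp l) * (pp i + pp j + 1))) *
      ((if l = i then gn (k, j, 0) else 0) -
       cn ((-1) ^ ((pp k + pp l) * (pp i + pp j))) * (if k = j then gn (i, l, 0) else 0))
    else if t = 1 \<and> k = j \<and> l = i then cn ((-1) ^ pp k) else 0)"

lemma bars_ebr: "bars (ebr k l i j) = (if l = i then gn (k, j, 0) else 0) -
    cn ((-1) ^ ((pp k + pp l) * (pp i + pp j))) * (if k = j then gn (i, l, 0) else 0)"
proof -
  let ?s = "(-1) ^ ((pp k + pp l) * (pp i + pp j)) :: complex"
  have "ebr k l i j = (\<lambda>a b. (if l = i then 1 else 0) * Emat k j a b +
      (- (?s * (if k = j then 1 else 0))) * Emat i l a b)"
    by (auto simp: ebr_def fun_eq_iff)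
  then have "bars (ebr k l i j) = bars (\<lambda>a b. (if l = i then 1 else 0) * Emat k j a b +
      (- (?s * (if k = j then 1 else 0))) * Emat i l a b)" by (rule arg_cong)
  also have "\<dots> = cn (if l = i then 1 else 0) * gn (k, j, 0) +
      cn (- (?s * (if k = j then 1 else 0))) * gn (i, l, 0)"
    by (simp only: bars_lin[OF finite_Emat finite_Emat] bars_Emat)
  finally have "bars (ebr k l i j) = cn (if l = i then 1 else 0) * gn (k, j, 0) +
      cn (- (?s * (if k = j then 1 else 0))) * gn (i, l, 0)" .
  then show ?thesis by auto
qed

lemma strform_Emat: "strform (Emat k l) (Emat i j) = (if k = j \<and> l = i then (-1) ^ pp k else 0)"
proof -
  have "{(i, j). Emat k l i j \<noteq> 0} = {(k, l)}" by (auto simp: Emat_def split: if_splits)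
  then show ?thesis unfolding strform_def by (auto simp: Emat_def)
qed

lemma neg_one_power_cong: "even a = even b \<Longrightarrow> (-1 :: complex) ^ a = (-1) ^ b"
  by (cases "even a") auto

lemma brgen_cf: "brgen k l i j t = cf (brs k l i j t)"
proof -
  have e: "(-1 :: complex) ^ (((pp k + pp l) mod 2) * ((pp i + pp j) mod 2 + 1)) =
      (-1) ^ ((pp k + pp l) * (pp i + pp j + 1))"
    by (rule neg_one_power_cong) (simp add: mod_2_eq_odd)
  show ?thesis unfolding brgen_def brs_def e
    by (auto simp: cf_transfer bar_cf bars_ebr strform_Emat)
qed

text \<open>From D \<chi> + \<chi> D = -2 \<chi>^2 one gets (D + \<chi>) \<chi>^k = (-1)^k \<chi>^k
  (D + \<chi>). So the coefficient of \<chi>^t collects D of the old one and, with the opposite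
  sign, the coefficient of \<chi>^(t-1).\<close>

primrec bgen :: "nat \<Rightarrow> nat \<Rightarrow> nat \<Rightarrow> nat \<Rightarrow> nat \<Rightarrow> nat \<Rightarrow> sv" where
  "bgen k l i j 0 = brs k l i j"
| "bgen k l i j (Suc m) = (\<lambda>t. cn ((-1) ^ (pp k + pp l + t)) *
    (DD (bgen k l i j m t) - (if t = 0 then 0 else bgen k l i j m (t - 1))))"

lemma hpar_brs: "hpar (genpar (i, j, 0) + (pp k + pp l + t)) (brs k l i j t)"
proof -
  have 1: "hpar (genpar (i, j, 0) + (pp k + pp l)) (gn (k, j, 0))" if "l = i"
    using hpar_gn[of "(k, j, 0)"] that by (simp add: hpar_def genpar_simp mod_2_eq_odd)
  have 2: "hpar (genpar (i, j, 0) + (pp k + pp l)) (gn (i, l, 0))" if "k = j"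
    using hpar_gn[of "(i, l, 0)"] that by (simp add: hpar_def genpar_simp mod_2_eq_odd)
  have "hpar (genpar (i, j, 0) + (pp k + pp l + t)) (brs k l i j t)" if "t = 0"
    using 1 2 that unfolding brs_def by (auto intro!: hpar_cn_mult hpar_diff hpar_uminus)
  moreover have "hpar (genpar (i, j, 0) + (pp k + pp l + t)) (brs k l i j t)" if "t = 1"
    using that unfolding brs_def by (auto intro!: hpar_cn simp: genpar_simp mod_2_eq_odd)
  moreover have "hpar (genpar (i, j, 0) + (pp k + pp l + t)) (brs k l i j t)" if "t \<noteq> 0" "t \<noteq> 1"
    using that unfolding brs_def by auto
  ultimately show ?thesis by blast
qed

lemma hpar_bgen: "hpar (genpar (i, j, m) + (pp k + pp l + t)) (bgen k l i j m t)"
proof (induction m arbitrary: t)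
  case 0
  then show ?case by (simp add: hpar_brs)
next
  case (Suc m)
  have "hpar (genpar (i, j, Suc m) + (pp k + pp l + t)) (DD (bgen k l i j m t))"
    using hpar_DD[OF Suc.IH[of t]] by (simp add: hpar_def genpar_simp mod_2_eq_odd)
  moreover have "hpar (genpar (i, j, Suc m) + (pp k + pp l + t)) (bgen k l i j m (t - 1))" if "t \<noteq> 0"
    using Suc.IH[of "t - 1"] that by (cases t) (simp_all add: hpar_def genpar_simp mod_2_eq_odd)
  ultimately show ?case by (auto intro!: hpar_cn_mult hpar_diff)
qed

text \<open>\<open>bet k l t\<close> is the coefficient of \<open>\<chi>\<^sup>t\<close> in the bracket with the generator \<open>e\<^sub>k\<^sub>l\<close>. The
 sesquilinearity rule forces the recursion in \<open>bgen\<close>, and since \<open>\<chi>\<close> is odd the parity alternates with \<open>t\<close>.\<close>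

definition bet :: "nat \<Rightarrow> nat \<Rightarrow> nat \<Rightarrow> sv \<Rightarrow> sv" where
  "bet k l t = (SOME d. is_der (pp k + pp l + t) d \<and>
    (\<forall>g. d (gn g) = (case g of (i, j, m) \<Rightarrow> bgen k l i j m t)))"

lemma bet_spec: "is_der (pp k + pp l + t) (bet k l t) \<and>
    (\<forall>g. bet k l t (gn g) = (case g of (i, j, m) \<Rightarrow> bgen k l i j m t))"
proof -
  have "hpar (genpar g + (pp k + pp l + t)) (case g of (i, j, m) \<Rightarrow> bgen k l i j m t)" for g
    using hpar_bgen by (cases g) simp
  from ex_der[OF this] show ?thesis unfolding bet_def by (rule someI_ex)
qed

lemma bet_der: "is_der (pp k + pp l + t) (bet k l t)"
  using bet_spec by blast

lemma bet_gn: "bet k l t (gn (i, j, m)) = bgen k l i j m t"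
  using bet_spec by simp

lemma is_der_cong: "even e = even f \<Longrightarrow> is_der e d \<Longrightarrow> is_der f d"
  unfolding is_der_def using tw_cong[of e f] by auto

lemma is_der_zero: "is_der e (\<lambda>_. 0)"
  by (simp add: is_der_def)

text \<open>A sesquilinearity rule need only be checked on generators: both sides expand over
  products in the same way. The map \<open>d'\<close> stands for the coefficient one power of \<chi>
  lower, whence its opposite parity.\<close>

lemma is_der_DD:
  assumes d: "is_der e d" and d': "is_der (Suc e) d'"
    and gen: "\<And>g. d (DD (gn g)) = cn ((-1) ^ e) * (DD (d (gn g)) - d' (gn g))"
  shows "d (DD a) = cn ((-1) ^ e) * (DD (d a) - d' a)"
proof (induction a rule: sv_induct)
  case (cn c)
  then show ?case by (simp add: is_derD(3,4)[OF d] is_derD(3)[OF d'])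
next
  case (add a b)
  show ?case unfolding DD_simps(1) is_derD(1)[OF d] is_derD(1)[OF d'] add
    by (simp add: algebra_simps)
next
  case (gn g a)
  define x where "x = gn g"
  have s: "sg (d x) = (if even e then d (sg x) else - d (sg x))" by (rule is_derD(9)[OF d])
  have "d (DD (x * a)) = d (DD x) * a + tw e (DD x) * d a + (d (sg x) * DD a + tw e (sg x) * d (DD a))"
    by (simp add: DD_mult is_derD(1,2)[OF d])
  also have "\<dots> = cn ((-1) ^ e) * (DD (d x) - d' x) * a + tw e (DD x) * d a +
      (d (sg x) * DD a + tw e (sg x) * (cn ((-1) ^ e) * (DD (d a) - d' a)))"
    unfolding gn x_def gen ..
  also have "\<dots> = cn ((-1) ^ e) * (DD (d (x * a)) - d' (x * a))"
    unfolding is_derD(2)[OF d] is_derD(2)[OF d'] DD_simps(1) DD_mult s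
    by (cases "even e") (simp_all add: tw_def sg_DD algebra_simps)
  finally show ?case by (simp only: x_def)
qed

lemma bet_DD:
  "bet k l t (DD a) = cn ((-1) ^ (pp k + pp l + t)) *
    (DD (bet k l t a) - (if t = 0 then 0 else bet k l (t - 1) a))"
proof -
  define d' where "d' = (if t = 0 then (\<lambda>_. 0) else bet k l (t - 1))"
  have "is_der (Suc (pp k + pp l + t)) d'"
    unfolding d'_def using is_der_zero is_der_cong[OF _ bet_der[of k l "t - 1"]]
    by (cases t) auto
  moreover have "bet k l t (DD (gn g)) = cn ((-1) ^ (pp k + pp l + t)) * (DD (bet k l t (gn g)) - d' (gn g))" for g
    by (cases g) (simp add: bet_gn d'_def)
  ultimately have "bet k l t (DD a) = cn ((-1) ^ (pp k + pp l + t)) * (DD (bet k l t a) - d' a)"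
    using is_der_DD[OF bet_der] by blast
  then show ?thesis by (simp add: d'_def)
qed

text \<open>Again a definite description. In the uniqueness half the derived generators are settled
  first, by induction on the number of derivatives, and \<open>sv_induct\<close> does the
  rest.\<close>

lemma Br_cf: "Br k l (cf a) t = cf (bet k l t a)"
proof -
  let ?B = "\<lambda>w t. if w \<in> VV then cf (bet k l t (Sv w)) else szero"
  let ?px = "(pp k + pp l + 1) mod 2"
  have B: "?B (cf a) = (\<lambda>t. cf (bet k l t a))" for a by (simp add: cf_inverse)
  have px: "(-1 :: complex) ^ (?px + 1) = (-1) ^ (pp k + pp l)"
    by (rule neg_one_power_cong) (simp add: mod_2_eq_odd)
  have px': "(-1 :: complex) ^ ((?px + 1) * e) = (-1) ^ ((pp k + pp l) * e)" for e
    by (rule neg_one_power_cong) (simp add: mod_2_eq_odd)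
  have Dchi: "cscale ((-1) ^ (pp k + pp l)) (cDchi (\<lambda>t. cf (bet k l t a))) = (\<lambda>t. cf (bet k l t (DD a)))" for a
  proof
    fix t
    have "cscale ((-1) ^ (pp k + pp l)) (cDchi (\<lambda>t. cf (bet k l t a))) t =
        cf (cn ((-1) ^ (pp k + pp l)) * (cn (if even t then 1 else -1) * DD (bet k l t a) +
          (if t = 0 then 0 else cn (if even (t - 1) then 1 else -1) * bet k l (t - 1) a)))"
      unfolding cscale_def cDchi_def Dder_cf
      by (cases "t = 0") (simp_all add: cf_transfer del: cf_simps)
    also have "cn ((-1) ^ (pp k + pp l)) * (cn (if even t then 1 else -1) * DD (bet k l t a) +
          (if t = 0 then 0 else cn (if even (t - 1) then 1 else -1) * bet k l (t - 1) a)) = bet k l t (DD a)"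
      unfolding bet_DD by (cases t) (auto simp: power_add cn_mult algebra_simps)
    finally show "cscale ((-1) ^ (pp k + pp l)) (cDchi (\<lambda>t. cf (bet k l t a))) t = cf (bet k l t (DD a))" .
  qed
  have mulrule: "(\<lambda>t. cf (bet k l t (a * b))) =
      cadd (cscale ((-1) ^ ((pp k + pp l) * e)) (cmul_left (cf a) e (\<lambda>t. cf (bet k l t b))))
        (cmul_right (\<lambda>t. cf (bet k l t a)) (cf b))" if e: "homog genpar (cf a) e" for a b e
  proof
    fix t
    have "tw (pp k + pp l + t) a = cn ((-1) ^ ((pp k + pp l) * e)) * (cn ((-1) ^ (t * e)) * a)"
      unfolding tw_hpar[OF homog_imp_hpar[OF e]]
      by (cases "even e"; cases "even t"; cases "even (pp k + pp l)") (simp_all)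
    then show "cf (bet k l t (a * b)) = cadd (cscale ((-1) ^ ((pp k + pp l) * e))
        (cmul_left (cf a) e (\<lambda>t. cf (bet k l t b)))) (cmul_right (\<lambda>t. cf (bet k l t a)) (cf b)) t"
      by (simp add: cadd_def cscale_def cmul_left_def cmul_right_def cf_transfer is_derD(2)[OF bet_der]
          mult.assoc add.commute)
  qed
  have "Br k l = ?B"
    unfolding Br_def Let_def px px'
  proof (rule the_equality, goal_cases)
    case 1
    have mult: "?B (Vmul y z) = cadd (cscale ((-1) ^ ((pp k + pp l) * e)) (cmul_left y e (?B z)))
        (cmul_right (?B y) z)" if yz: "y \<in> VV" "z \<in> VV" and e: "homog genpar y e" for y z e
    proof -
      obtain a b where ab: "y = cf a" "z = cf b" using VV_ex[OF yz(1)] VV_ex[OF yz(2)] by blast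
      show ?thesis using mulrule[of a e b] e unfolding ab cf_ops B by simp
    qed
    have add: "?B (sadd p q) = cadd (?B p) (?B q)" if pq: "p \<in> VV" "q \<in> VV" for p q
    proof -
      obtain a b where ab: "p = cf a" "q = cf b" using VV_ex[OF pq(1)] VV_ex[OF pq(2)] by blast
      show ?thesis unfolding ab cf_ops B by (simp add: cadd_def cf_transfer is_derD(1)[OF bet_der])
    qed
    have scale: "?B (sscale c p) = cscale c (?B p)" if pq: "p \<in> VV" for c p
    proof -
      obtain a where a: "p = cf a" using VV_ex[OF pq] by blast
      show ?thesis unfolding a cf_ops B by (simp add: cscale_def cf_transfer is_derD(6)[OF bet_der])
    qed
    have var: "?B (svar (i, j, 0)) = brgen k l i j" for i j
      unfolding cf_ops B by (auto simp: bet_gn brgen_cf fun_eq_iff)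
    have vars: "?B (svar (i, j, Suc m)) = cscale ((-1) ^ (pp k + pp l)) (cDchi (?B (svar (i, j, m))))" for i j m
      unfolding cf_ops B Dchi by simp
    show ?case using mult add scale var vars by auto
  next
    case (2 B')
    have out: "w \<notin> VV \<Longrightarrow> B' w = (\<lambda>_. szero)" for w using 2 by blast
    have addd: "B' (cf (a + b)) = cadd (B' (cf a)) (B' (cf b))" for a b
      using 2 unfolding cf_transfer(1)[symmetric] by (metis cf_in_VV)
    have scale: "B' (cf (cn c * a)) = cscale c (B' (cf a))" for c a
      using 2 unfolding cf_transfer(2)[symmetric] by (metis cf_in_VV)
    have var: "B' (cf (gn (i, j, 0))) = brgen k l i j" for i j
      using 2 unfolding cf_transfer(5)[symmetric] by metis
    have vars: "B' (cf (gn (i, j, Suc m))) = cscale ((-1) ^ (pp k + pp l)) (cDchi (B' (cf (gn (i, j, m)))))" for i j m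
      using 2 unfolding cf_transfer(5)[symmetric] by metis
    have mult: "B' (cf (a * b)) = cadd (cscale ((-1) ^ ((pp k + pp l) * e)) (cmul_left (cf a) e (B' (cf b))))
                              (cmul_right (B' (cf a)) (cf b))" if "homog genpar (cf a) e" for a b e
      using 2 that unfolding cf_transfer(3)[symmetric] by (metis cf_in_VV)
    have gen: "B' (cf (gn (i, j, m))) = (\<lambda>t. cf (bet k l t (gn (i, j, m))))" for i j m
    proof (induction m)
      case 0
      then show ?case by (auto simp: var brgen_cf bet_gn fun_eq_iff)
    next
      case (Suc m)
      then show ?case using Dchi[of "gn (i, j, m)"] by (simp add: vars)
    qed
    have "B' (cf a) = (\<lambda>t. cf (bet k l t a))" for a
    proof (induction a rule: sv_induct)
      case (cn c)
      have "homog genpar (cf 1) 0" by (rule hpar_imp_homog) (auto simp: hpar_def)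
      then have e: "B' (cf 1) t m = cadd (cscale ((-1) ^ ((pp k + pp l) * 0)) (cmul_left (cf 1) 0 (B' (cf 1))))
          (cmul_right (B' (cf 1)) (cf 1)) t m" for t m
        using mult[of 1 0 1] by simp
      \<comment> \<open>The values of \<open>B'\<close> are not assumed to be polynomials, so
        multiplication by 1 is evaluated monomial by monomial: the rule doubles the coefficient at a
        valid monomial and gives 0 at an invalid one.\<close>
      have "B' (cf 1) t m = 0" for t m
        using e[of t m] unfolding cadd_def cscale_def cmul_left_def cmul_right_def sadd_def sscale_def
          cf_transfer(7)[symmetric] smul_sone_left smul_sone_right
        by (cases "valid_mono genpar m") simp_all
      then have "B' (cf 1) = (\<lambda>t. cf 0)" by (simp add: fun_eq_iff cf_simps)
      then show ?case using scale[of c 1]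
        by (simp add: cscale_def cf_transfer is_derD(3)[OF bet_der])
    next
      case (add a b)
      then show ?case by (simp add: addd cadd_def cf_transfer is_derD(1)[OF bet_der])
    next
      case (gn g a)
      obtain i j m where g: "g = (i, j, m)" by (cases g) auto
      have h: "homog genpar (cf (gn g)) (genpar g)"
        by (rule hpar_imp_homog[OF hpar_gn]) (simp add: genpar_def split: prod.splits)
      have "B' (cf (gn g)) = (\<lambda>t. cf (bet k l t (gn g)))" unfolding g by (rule gen)
      then show ?case unfolding mult[OF h] mulrule[OF h] gn by simp
    qed
    then show ?case using out by (auto simp: fun_eq_iff cf_inverse dest!: VV_ex)
  qed
  from fun_cong[OF fun_cong[OF this, of "cf a"], of t] show ?thesis by (simp add: cf_inverse)
qed

section \<open>Brackets with elements of the orthosymplectic algebra\<close>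

lemma alg_gen_cf: "alg_gen (cf ` S) = cf ` alg S"
proof (intro equalityI subsetI)
  fix p assume "p \<in> alg_gen (cf ` S)"
  then show "p \<in> cf ` alg S"
  proof induction
    case (ag_const c)
    then show ?case by (auto simp: cf_transfer intro: alg.intros)
  next
    case (ag_gen s)
    then show ?case by (auto intro: alg.intros)
  next
    case (ag_add p q)
    then show ?case by (auto simp: cf_transfer intro: alg.intros)
  next
    case (ag_mul p q)
    then show ?case by (auto simp: cf_transfer intro: alg.intros)
  qed
next
  fix p assume "p \<in> cf ` alg S"
  then obtain a where a: "p = cf a" "a \<in> alg S" by blast
  have "cf a \<in> alg_gen (cf ` S)" using a(2)
  proof induction
    case (alg_cn c)
    then show ?case using ag_const[of c "cf ` S"] by (simp add: cf_transfer)
  next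
    case (alg_gen s)
    then show ?case by (auto intro: alg_gen.intros)
  next
    case (alg_add a b)
    then show ?case using ag_add[of "cf a" "cf ` S" "cf b"] by (simp add: cf_transfer)
  next
    case (alg_mult a b)
    then show ?case using ag_mul[of "cf a" "cf ` S" "cf b"] by (simp add: cf_transfer)
  qed
  then show "p \<in> alg_gen (cf ` S)" using a(1) by simp
qed

text \<open>The coefficient of \<open>\<chi>\<^sup>t\<close> in the bracket with the matrix \<open>X\<close>.\<close>

definition xi :: "mat \<Rightarrow> nat \<Rightarrow> sv \<Rightarrow> sv" where
  "xi X t a = (\<Sum>(p, q)\<in>{(p, q). X p q \<noteq> 0}. cn (X p q) * bet p q t a)"

lemma brk_cf: "brk X (cf a) t = cf (xi X t a)"
proof
  fix m
  show "brk X (cf a) t m = cf (xi X t a) m"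
    unfolding brk_def xi_def cf_sum by (intro sum.cong) (auto simp: Br_cf cf_cn_mult)
qed

lemma xi_superset:
  assumes "finite A" "\<And>k l. X k l \<noteq> 0 \<Longrightarrow> (k, l) \<in> A"
  shows "xi X t a = (\<Sum>(k, l)\<in>A. cn (X k l) * bet k l t a)"
  unfolding xi_def using assms by (intro sum.mono_neutral_left) auto

lemma is_der_lincomb:
  assumes "\<And>p. p \<in> A \<Longrightarrow> is_der e (d p)"
  shows "is_der e (\<lambda>a. \<Sum>p\<in>A. cn (c p) * d p a)"
proof -
  have "sg (\<Sum>p\<in>A. cn (c p) * d p a) = (\<Sum>p\<in>A. cn (c p) * (if even e then d p (sg a) else - d p (sg a)))" for a
    unfolding sg_sum using is_derD(9)[OF assms] by (intro sum.cong) auto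
  moreover have "(\<Sum>p\<in>A. cn (c p) * d p (a * b)) =
      (\<Sum>p\<in>A. cn (c p) * d p a) * b + tw e a * (\<Sum>p\<in>A. cn (c p) * d p b)" for a b
  proof -
    have "(\<Sum>p\<in>A. cn (c p) * d p (a * b)) =
        (\<Sum>p\<in>A. cn (c p) * d p a * b + tw e a * (cn (c p) * d p b))"
      using is_derD(2)[OF assms]
      by (intro sum.cong refl) (simp add: distrib_left mult.assoc cn_left_commute)
    then show ?thesis by (simp add: sum.distrib sum_distrib_left sum_distrib_right)
  qed
  moreover have "(\<Sum>p\<in>A. cn (c p) * d p (a + b)) =
      (\<Sum>p\<in>A. cn (c p) * d p a) + (\<Sum>p\<in>A. cn (c p) * d p b)" for a b
    using is_derD(1)[OF assms] by (simp add: distrib_left sum.distrib)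
  moreover have "(\<Sum>p\<in>A. cn (c p) * d p (cn x)) = 0" for x
    using is_derD(3)[OF assms] by simp
  ultimately show ?thesis unfolding is_der_def by (cases "even e") (simp_all add: sum_negf)
qed

lemma even_pp: "even (pp i) = odd i"
  by (simp add: pp_def)

section \<open>The orthosymplectic algebra: signs, \<theta>-fixed matrices and their
  brackets\<close>

locale osp =
  fixes n :: nat
  assumes n_pos: "n \<ge> 1"
begin

abbreviation "I \<equiv> Iset n"
abbreviation "pr \<equiv> primeI n"
abbreviation "th \<equiv> thsign n"
abbreviation "\<delta> \<equiv> dl n"

lemma finite_I [simp]: "finite I" and finite_II [simp]: "finite (I \<times> I)"
  by (simp_all add: Iset_def)

lemma pr_I [simp]: "i \<in> I \<Longrightarrow> pr i \<in> I"
  by (auto simp: Iset_def primeI_def)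

lemma pr_pr [simp]: "i \<in> I \<Longrightarrow> pr (pr i) = i"
  by (auto simp: Iset_def primeI_def)

lemma pr_le_iff: "i \<in> I \<Longrightarrow> j \<in> I \<Longrightarrow> pr i \<le> pr j \<longleftrightarrow> j \<le> i"
  by (auto simp: Iset_def primeI_def)

lemma even_pr [simp]: "i \<in> I \<Longrightarrow> even (pr i) = even i"
  by (auto simp: Iset_def primeI_def)

lemma pp_pr [simp]: "i \<in> I \<Longrightarrow> pp (pr i) = pp i"
  by (simp add: pp_def)

lemma dl_pr: "k \<in> I \<Longrightarrow> \<delta> k + \<delta> (pr k) = pp k"
  unfolding dl_def pp_def Iset_def primeI_def by (auto; presburger)

lemma even_dl_pr: "k \<in> I \<Longrightarrow> even (\<delta> (pr k)) \<longleftrightarrow> (even (\<delta> k) \<longleftrightarrow> odd k)"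
  using dl_pr[of k] even_pp[of k] by (metis even_add)

lemma bij_pr: "bij_betw pr I I"
  by (rule bij_betw_byWitness[of _ pr]) auto

lemma sum_pr: "(\<Sum>k\<in>I. f (pr k)) = (\<Sum>k\<in>I. f k)"
  by (rule sum.reindex_bij_betw[OF bij_pr])

text \<open>This expresses that \<theta> is an involution. Here and below, sign identities reduce to
  the parity of an exponent.\<close>

lemma th_mult_th: "i \<in> I \<Longrightarrow> j \<in> I \<Longrightarrow> th i j * th (pr j) (pr i) = 1"
  unfolding thsign_def power_add[symmetric]
  by (rule trans[OF neg_one_power_cong[of _ 0]]) (auto simp: even_pp even_dl_pr)

lemma th_sq: "th i j * th i j = 1"
  unfolding thsign_def power_add[symmetric]
  by (rule trans[OF neg_one_power_cong[of _ 0]]) auto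

lemma th_swap: "th d a * th a d = (-1) ^ (pp a + pp d)"
  unfolding thsign_def power_add[symmetric]
  by (rule neg_one_power_cong) (auto simp: even_pp)

text \<open>Up to a Koszul sign the signs of \<theta> form a cocycle. This makes the \<theta>-fixed
  matrices closed under the superbracket, as \<open>xi_0_Fb\<close> needs.\<close>

lemma th_cocycle:
  assumes "even (pp a + pp l) = even q"
  shows "th d a * th a l = - ((-1) ^ (q * (pp d + pp a))) * th d l"
proof -
  have "th d a * th a l = (-1) ^ (1 + q * (pp d + pp a)) * th d l"
    unfolding thsign_def power_add[symmetric] using assms
    by (intro neg_one_power_cong) (auto simp: even_pp)
  then show ?thesis by simp
qed

lemma Fm_eq: "Fm n i j a b = (if a = i \<and> b = j then 1 else 0) + th i j * (if a = pr j \<and> b = pr i then 1 else 0)"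
  by (simp add: Fm_def Emat_def)

lemma Fm_swap: "i \<in> I \<Longrightarrow> j \<in> I \<Longrightarrow> Fm n i j = (\<lambda>a b. th i j * Fm n (pr j) (pr i) a b)"
  using th_mult_th[of i j] by (auto simp: Fm_eq fun_eq_iff algebra_simps)

text \<open>Matrices of parity \<open>q\<close> in the orthosymplectic algebra; the second condition is invariance under \<open>\<theta>\<close>.\<close>

definition elt :: "mat \<Rightarrow> nat \<Rightarrow> bool" where
  "elt X q \<longleftrightarrow> (\<forall>a b. X a b \<noteq> 0 \<longrightarrow> a \<in> I \<and> b \<in> I \<and> even (pp a + pp b) = even q) \<and>
    (\<forall>a\<in>I. \<forall>b\<in>I. X (pr b) (pr a) = th a b * X a b)"

lemma elt_Fm:
  assumes "i \<in> I" "j \<in> I"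
  shows "elt (Fm n i j) (pp i + pp j)"
proof -
  have "Fm n i j (pr b) (pr a) = th a b * Fm n i j a b" if ab: "a \<in> I" "b \<in> I" for a b
  proof -
    have "pr b = i \<and> pr a = j \<longleftrightarrow> a = pr j \<and> b = pr i" "pr b = pr j \<and> pr a = pr i \<longleftrightarrow> a = i \<and> b = j"
      using ab assms by (metis pr_pr)+
    moreover define x y :: complex
      where "x = (if a = i \<and> b = j then 1 else 0)" and "y = (if a = pr j \<and> b = pr i then 1 else 0)"
    ultimately have F: "Fm n i j (pr b) (pr a) = y + th i j * x" "Fm n i j a b = x + th i j * y"
      by (simp_all only: Fm_eq)
    have t: "th (pr j) (pr i) * th i j = 1" using th_mult_th[OF assms] by (simp only: mult.commute)
    show ?thesis
    proof (cases "a = i \<and> b = j")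
      case True
      then have "x = 1" "th a b = th i j" by (simp_all add: x_def)
      then show ?thesis unfolding F by (simp add: distrib_left mult.assoc[symmetric] th_sq)
    next
      case x: False
      show ?thesis
      proof (cases "a = pr j \<and> b = pr i")
        case True
        then have "th a b * th i j = 1" using t by (simp only:)
        moreover have "x = 0" unfolding x_def using x by (rule if_not_P)
        moreover have "y = 1" unfolding y_def using True by (rule if_P)
        ultimately show ?thesis unfolding F by simp
      next
        case False
        have "x = 0" unfolding x_def using x by (rule if_not_P)
        moreover have "y = 0" unfolding y_def using False by (rule if_not_P)
        ultimately show ?thesis unfolding F by simp
      qed
    qed
  qed
  then show ?thesis unfolding elt_def using assms by (auto simp: Fm_eq split: if_splits)
qed

lemma elt_I: "elt X q \<Longrightarrow> X a b \<noteq> 0 \<Longrightarrow> a \<in> I \<and> b \<in> I"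
  and elt_par: "elt X q \<Longrightarrow> X a b \<noteq> 0 \<Longrightarrow> even (pp a + pp b) = even q"
  and elt_inv: "elt X q \<Longrightarrow> a \<in> I \<Longrightarrow> b \<in> I \<Longrightarrow> X (pr b) (pr a) = th a b * X a b"
  by (auto simp: elt_def)

definition Fb :: "nat \<Rightarrow> nat \<Rightarrow> sv" where "Fb i j = bars (Fm n i j)"
definition Eb :: "nat \<Rightarrow> nat \<Rightarrow> sv" where "Eb i j = cn (1/2 * (-1) ^ pp i) * Fb i j"

lemma Fb_eq: "Fb i j = gn (i, j, 0) + cn (th i j) * gn (pr j, pr i, 0)"
proof -
  have "Fm n i j = (\<lambda>a b. 1 * Emat i j a b + th i j * Emat (pr j) (pr i) a b)"
    by (simp add: Fm_def)
  then have "Fb i j = bars (\<lambda>a b. 1 * Emat i j a b + th i j * Emat (pr j) (pr i) a b)"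
    unfolding Fb_def by (rule arg_cong)
  then show ?thesis by (simp only: bars_lin[OF finite_Emat finite_Emat] bars_Emat) simp
qed

lemma finite_Fm: "finite {(a, b). Fm n i j a b \<noteq> 0}"
proof -
  have "Fm n i j a b = 0" if "\<not> (a = i \<and> b = j)" "\<not> (a = pr j \<and> b = pr i)" for a b
    using that by (simp only: Fm_eq if_False) simp
  then have "{(a, b). Fm n i j a b \<noteq> 0} \<subseteq> {(i, j), (pr j, pr i)}" by blast
  then show ?thesis by (rule finite_subset) simp
qed

lemma bars_Em: "bars (Em n i j) = Eb i j"
proof -
  have "Em n i j = (\<lambda>a b. (1/2 * (-1) ^ pp i) * Fm n i j a b + 0 * Fm n i j a b)"
    by (simp add: Em_def)
  then have "bars (Em n i j) = bars (\<lambda>a b. (1/2 * (-1) ^ pp i) * Fm n i j a b + 0 * Fm n i j a b)"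
    by (rule arg_cong)
  then show ?thesis by (simp only: bars_lin[OF finite_Fm finite_Fm]) (simp add: Eb_def Fb_def)
qed

lemma hpar_Fb: "i \<in> I \<Longrightarrow> j \<in> I \<Longrightarrow> hpar (genpar (i, j, 0)) (Fb i j)"
  using hpar_gn[of "(i, j, 0)"] hpar_gn[of "(pr j, pr i, 0)"]
  by (auto simp: Fb_eq genpar_simp add.commute intro!: hpar_add hpar_cn_mult)

lemma Fb_swap: "i \<in> I \<Longrightarrow> j \<in> I \<Longrightarrow> Fb i j = cn (th i j) * Fb (pr j) (pr i)"
  using th_mult_th[of i j] by (simp add: Fb_eq distrib_left cn_mult[symmetric] mult.assoc[symmetric] add.commute)

lemma xi_der:
  assumes "elt X q"
  shows "is_der (q + t) (xi X t)"
proof -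
  have "is_der (q + t) (bet (fst p) (snd p) t)" if "p \<in> {(p, q). X p q \<noteq> 0}" for p
  proof -
    have "even (pp (fst p) + pp (snd p) + t) = even (q + t)"
      using elt_par[OF assms, of "fst p" "snd p"] that by auto
    then show ?thesis by (rule is_der_cong[OF _ bet_der])
  qed
  from is_der_lincomb[of "{(p, q). X p q \<noteq> 0}", OF this, of "\<lambda>p. p" "\<lambda>p. X (fst p) (snd p)"]
  show ?thesis unfolding xi_def case_prod_unfold by simp
qed

lemma xi_II:
  assumes "elt X q"
  shows "xi X t a = (\<Sum>k\<in>I. \<Sum>l\<in>I. cn (X k l) * bet k l t a)"
  unfolding sum.cartesian_product using elt_I[OF assms] by (intro xi_superset) auto

lemma xi_DD:
  assumes "elt X q"
  shows "xi X t (DD a) = cn ((-1) ^ (q + t)) * (DD (xi X t a) - (if t = 0 then 0 else xi X (t - 1) a))"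
proof -
  have c: "cn (X k l) * bet k l t (DD a) = cn ((-1) ^ (q + t)) * (DD (cn (X k l) * bet k l t a) -
      (if t = 0 then 0 else cn (X k l) * bet k l (t - 1) a))" for k l
  proof (cases "X k l = 0")
    case False
    then have "(-1 :: complex) ^ (pp k + pp l + t) = (-1) ^ (q + t)"
      using elt_par[OF assms, of k l] by (intro neg_one_power_cong) auto
    then show ?thesis unfolding bet_DD by (simp add: right_diff_distrib cn_left_commute[of "cn (X k l)"])
  qed simp
  show ?thesis
    unfolding xi_II[OF assms] c
    by (cases "t = 0") (simp_all add: DD_sum sum_subtractf sum_distrib_left right_diff_distrib)
qed

lemma xi_0_gn:
  assumes X: "elt X q" and ab: "a \<in> I" "b \<in> I"
  shows "xi X 0 (gn (a, b, 0)) = cn ((-1) ^ (q * (pp a + pp b + 1))) *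
    ((\<Sum>k\<in>I. cn (X k a) * gn (k, b, 0)) - cn ((-1) ^ (q * (pp a + pp b))) * (\<Sum>l\<in>I. cn (X b l) * gn (a, l, 0)))"
proof -
  let ?s = "(-1) ^ (q * (pp a + pp b + 1)) :: complex" and ?s' = "(-1) ^ (q * (pp a + pp b)) :: complex"
  have t: "cn (X k l) * bet k l 0 (gn (a, b, 0)) =
    (if l = a then cn ?s * (cn (X k l) * gn (k, b, 0)) else 0) -
    (if k = b then cn ?s * (cn ?s' * (cn (X k l) * gn (a, l, 0))) else 0)" for k l
  proof (cases "X k l = 0")
    case False
    then have e: "even (pp k + pp l) = even q" using elt_par[OF X] by blast
    have "(-1 :: complex) ^ ((pp k + pp l) * (pp a + pp b + 1)) = ?s"
      "(-1 :: complex) ^ ((pp k + pp l) * (pp a + pp b)) = ?s'"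
      using e by (auto intro!: neg_one_power_cong)
    then show ?thesis
      by (simp add: bet_gn brs_def right_diff_distrib cn_left_commute[of "cn (X k l)"])
  next
    case True
    then have "l = a \<Longrightarrow> X k a = 0" "k = b \<Longrightarrow> X b l = 0" by auto
    then show ?thesis using True by simp
  qed
  have "xi X 0 (gn (a, b, 0)) =
    (\<Sum>k\<in>I. cn ?s * (cn (X k a) * gn (k, b, 0))) - (\<Sum>l\<in>I. cn ?s * (cn ?s' * (cn (X b l) * gn (a, l, 0))))"
    unfolding xi_II[OF X] t sum_subtractf
    using ab by (subst (2) sum.swap) (simp add: sum.delta')
  then show ?thesis by (simp add: sum_distrib_left right_diff_distrib)
qed

lemma xi_1_gn:
  assumes X: "elt X q" and ab: "a \<in> I" "b \<in> I"
  shows "xi X 1 (gn (a, b, 0)) = cn (X b a * (-1) ^ pp b)"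
proof -
  have "cn (X k l) * bet k l 1 (gn (a, b, 0)) =
    (if l = a then if k = b then cn (X k l * (-1) ^ pp k) else 0 else 0)" for k l
    by (simp add: bet_gn brs_def cn_mult)
  then show ?thesis using ab by (simp add: xi_II[OF X] sum.delta')
qed

lemma xi_ge2_gn:
  assumes X: "elt X q" and "t \<ge> 2"
  shows "xi X t (gn (a, b, 0)) = 0"
  using assms(2) by (simp add: xi_def bet_gn brs_def)

lemma xi_outside:
  assumes X: "elt X q" and "a \<notin> I" "b \<notin> I"
  shows "xi X t (gn (a, b, m)) = 0"
proof (induction m arbitrary: t)
  case 0
  then show ?case unfolding xi_II[OF X] using assms
    by (intro sum.neutral ballI) (auto simp: bet_gn brs_def)
next
  case (Suc m)
  show ?case using xi_DD[OF X, of t "gn (a, b, m)"] Suc by simp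
qed

text \<open>The bracket in gl is applied to both halves of \<open>Fb d a\<close>. In the reflected
  half the two sums trade places, because \<open>X\<close> is \<theta>-invariant: \<open>A\<close>
  and \<open>B\<close> supply exactly the missing reflected halves, so that only combinations
  \<open>Fb\<close> remain.\<close>

lemma xi_0_Fb:
  assumes X: "elt X q" and d: "d \<in> I" "a \<in> I"
  shows "xi X 0 (Fb d a) = cn ((-1) ^ (q * (pp d + pp a + 1))) *
    ((\<Sum>k\<in>I. cn (X k d) * Fb k a) - cn ((-1) ^ (q * (pp d + pp a))) * (\<Sum>l\<in>I. cn (X a l) * Fb d l))"
proof -
  let ?s = "cn ((-1) ^ (q * (pp d + pp a + 1)))"
  let ?c = "(-1) ^ (q * (pp d + pp a)) :: complex"
  note D = is_derD[OF xi_der[OF X, of 0]]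
  have cc: "?c * ?c = 1" by (simp add: power_mult_distrib[symmetric])
  have 1: "th d a * X (pr l) (pr a) = - ?c * (X a l * th d l)" if "l \<in> I" for l
  proof (cases "X a l = 0")
    case True
    then show ?thesis using elt_inv[OF X] that d by simp
  next
    case False
    then have "th d a * th a l = - ?c * th d l" using elt_par[OF X] by (intro th_cocycle) blast
    moreover have "X (pr l) (pr a) = th a l * X a l" by (rule elt_inv[OF X d(2) that])
    ultimately show ?thesis by (metis mult.assoc mult.commute)
  qed
  have 2: "th d a * (- ?c * X (pr d) (pr k)) = X k d * th k a" if "k \<in> I" for k
  proof (cases "X k d = 0")
    case True
    then show ?thesis using elt_inv[OF X] that d by simp
  next
    case False
    then have e: "even (pp d + pp k) = even q" using elt_par[OF X] by (metis add.commute)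
    have "th k d * th d a = - ((-1) ^ ((pp d + pp a) * (pp k + pp d))) * th k a"
      by (rule th_cocycle) simp
    also have "(-1 :: complex) ^ ((pp d + pp a) * (pp k + pp d)) = ?c"
      using e by (intro neg_one_power_cong) auto
    finally have "?c * (th k d * th d a) = - (?c * ?c) * th k a" by simp
    then have "- ?c * (th k d * th d a) = th k a" using cc by simp
    moreover have "X (pr d) (pr k) = th k d * X k d" by (rule elt_inv[OF X that d(1)])
    ultimately show ?thesis by (metis mult.assoc mult.commute)
  qed
  have A: "cn (th d a) * (\<Sum>k\<in>I. cn (X k (pr a)) * gn (k, pr d, 0)) =
    - (cn ?c * (\<Sum>l\<in>I. cn (X a l) * (cn (th d l) * gn (pr l, pr d, 0))))"
    unfolding sum_pr[of "\<lambda>k. cn (X k (pr a)) * gn (k, pr d, 0)", symmetric] sum_distrib_left sum_negf[symmetric]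
    by (intro sum.cong refl) (simp only: mult.assoc[symmetric] cn_mult[symmetric] mult_minus_left[symmetric] cn_simps(4)[symmetric] 1)
  have B: "cn (th d a) * (cn ?c * (\<Sum>l\<in>I. cn (X (pr d) l) * gn (pr a, l, 0))) =
    - (\<Sum>k\<in>I. cn (X k d) * (cn (th k a) * gn (pr a, pr k, 0)))"
    unfolding sum_pr[of "\<lambda>l. cn (X (pr d) l) * gn (pr a, l, 0)", symmetric] sum_distrib_left sum_negf[symmetric]
    by (intro sum.cong refl) (simp only: mult.assoc[symmetric] cn_mult[symmetric] mult_minus_left[symmetric] cn_simps(4)[symmetric] 2[symmetric], simp)
  have "xi X 0 (Fb d a) = xi X 0 (gn (d, a, 0)) + cn (th d a) * xi X 0 (gn (pr a, pr d, 0))"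
    by (simp only: Fb_eq D(1,6))
  also have "xi X 0 (gn (pr a, pr d, 0)) = ?s *
    ((\<Sum>k\<in>I. cn (X k (pr a)) * gn (k, pr d, 0)) - cn ?c * (\<Sum>l\<in>I. cn (X (pr d) l) * gn (pr a, l, 0)))"
    using d by (simp add: xi_0_gn[OF X] add.commute)
  also have "cn (th d a) * (?s * ((\<Sum>k\<in>I. cn (X k (pr a)) * gn (k, pr d, 0)) -
      cn ?c * (\<Sum>l\<in>I. cn (X (pr d) l) * gn (pr a, l, 0)))) =
    ?s * ((\<Sum>k\<in>I. cn (X k d) * (cn (th k a) * gn (pr a, pr k, 0))) -
      cn ?c * (\<Sum>l\<in>I. cn (X a l) * (cn (th d l) * gn (pr l, pr d, 0))))"
    unfolding cn_left_commute[of "cn (th d a)"] right_diff_distrib[of "cn (th d a)"] A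
      B[unfolded cn_left_commute[of "cn (th d a)"]] by simp
  finally show ?thesis
    unfolding xi_0_gn[OF X d] by (simp add: Fb_eq distrib_left sum.distrib right_diff_distrib)
qed

text \<open>The factor 2 arises because \<theta>-invariance of \<open>X\<close> lets it pair equally
  with both halves of \<open>Fb d a\<close>.\<close>

lemma xi_1_Fb:
  assumes X: "elt X q" and d: "d \<in> I" "a \<in> I"
  shows "xi X 1 (Fb d a) = cn (2 * (-1) ^ pp a * X a d)"
proof -
  have "X (pr d) (pr a) = th a d * X a d" by (rule elt_inv[OF X d(2,1)])
  then have "th d a * (X (pr d) (pr a) * (-1) ^ pp d) = (th d a * th a d) * X a d * (-1) ^ pp d"
    by simp
  also have "\<dots> = (-1) ^ pp a * X a d" unfolding th_swap power_add by (cases "even d") (simp_all add: pp_def)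
  finally have "X a d * (-1) ^ pp a + th d a * (X (pr d) (pr a) * (-1) ^ pp d) = 2 * (-1) ^ pp a * X a d"
    by simp
  then show ?thesis
    using d by (simp only: Fb_eq is_derD(1,6)[OF xi_der[OF X, of 1]] xi_1_gn[OF X] pr_I pp_pr
        cn_mult[symmetric] cn_simps(3)[symmetric])
qed

lemma xi_ge2_Fb:
  assumes X: "elt X q" and "t \<ge> 2"
  shows "xi X t (Fb a b) = 0"
  by (simp add: Fb_eq is_derD(1,6)[OF xi_der[OF X]] xi_ge2_gn[OF X assms(2)])

end

section \<open>Reduction modulo the ideal\<close>

context osp
begin

text \<open>\<open>gg k\<close> is the subdiagonal entry of \<open>f\<close> in row \<open>k\<close>; it is a sign, and \<open>gg 1 = 1\<close>.\<close>

definition gg :: "nat \<Rightarrow> complex" where "gg k = (-1) ^ \<delta> (k - 1)"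

lemma gg_sq [simp]: "gg k * gg k = 1"
  by (simp add: gg_def power_mult_distrib[symmetric])

lemma gg_nz [simp]: "gg k \<noteq> 0"
  by (simp add: gg_def)

lemma fm_eq: "fm n a b = (if a = b + 1 \<and> 1 \<le> b \<and> b \<le> 4 * n then gg a else 0)"
proof -
  have t: "Fm n (i + 1) i a b = (if i = b then if a = b + 1 then 1 else 0 else 0) +
      (if i = 4 * n + 1 - b then if a = b + 1 \<and> b \<le> 4 * n then (-1) ^ (pp i + 1) else 0 else 0)"
    if i: "i \<in> {1..2 * n}" for i
  proof -
    have "th (i + 1) i = (-1) ^ (pp i + 1)"
      unfolding thsign_def using i by (intro neg_one_power_cong) (auto simp: even_pp dl_def)
    moreover have "a = pr i \<and> b = pr (i + 1) \<longleftrightarrow> i = 4 * n + 1 - b \<and> a = b + 1 \<and> b \<le> 4 * n"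
      using i by (auto simp: primeI_def)
    moreover have "a = i + 1 \<and> b = i \<longleftrightarrow> i = b \<and> a = b + 1" by auto
    ultimately show ?thesis by (simp only: Fm_eq) simp
  qed
  have "fm n a b = (\<Sum>i\<in>{1..2 * n}. (if i = b then if a = b + 1 then 1 else 0 else 0)) +
      (\<Sum>i\<in>{1..2 * n}. if i = 4 * n + 1 - b then if a = b + 1 \<and> b \<le> 4 * n then (-1) ^ (pp i + 1) else 0 else 0)"
    unfolding fm_def sum.distrib[symmetric] by (rule sum.cong[OF refl]) (rule t)
  also have "\<dots> = (if b \<in> {1..2 * n} then if a = b + 1 then 1 else 0 else 0) +
      (if 4 * n + 1 - b \<in> {1..2 * n} then if a = b + 1 \<and> b \<le> 4 * n then (-1) ^ (pp (4 * n + 1 - b) + 1) else 0 else 0)"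
    by (simp add: sum.delta)
  also have "\<dots> = (if a = b + 1 \<and> 1 \<le> b \<and> b \<le> 4 * n then gg a else 0)"
  proof (cases "a = b + 1 \<and> 1 \<le> b \<and> b \<le> 4 * n")
    case True
    show ?thesis
    proof (cases "b \<le> 2 * n")
      case b: True
      then have "gg a = 1" using True by (simp add: gg_def dl_def)
      then show ?thesis using True b by auto
    next
      case b: False
      then have "4 * n + 1 - b \<in> {1..2 * n}" using True by auto
      moreover have "(-1 :: complex) ^ (pp (4 * n + 1 - b) + 1) = (-1) ^ \<delta> (a - 1)"
      proof (rule neg_one_power_cong)
        have "even (4 * n + 1 - b) \<longleftrightarrow> odd b" using True by auto
        moreover have "even b \<Longrightarrow> 2 * n + 2 \<le> b" using b by presburger
        ultimately show "even (pp (4 * n + 1 - b) + 1) = even (\<delta> (a - 1))"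
          using True by (auto simp: pp_def dl_def)
      qed
      ultimately show ?thesis using True b by (auto simp: gg_def)
    qed
  next
    case False
    then show ?thesis by auto
  qed
  finally show ?thesis .
qed

definition sf :: "mat \<Rightarrow> complex" where "sf X = strform (fm n) X"

lemma sf_eq: "sf X = (\<Sum>j\<in>{1..4 * n}. (-1) ^ pp (j + 1) * gg (j + 1) * X j (j + 1))"
proof -
  have "{(i, j). fm n i j \<noteq> 0} = (\<lambda>j. (j + 1, j)) ` {1..4 * n}"
    by (auto simp: fm_eq)
  moreover have "inj_on (\<lambda>j. (j + 1, j)) {1..4 * n}" by (auto simp: inj_on_def)
  ultimately show ?thesis
    unfolding sf_def strform_def by (simp add: sum.reindex fm_eq)
qed

lemma sf_sum: "sf (\<lambda>a b. \<Sum>p\<in>A. c p * G p a b) = (\<Sum>p\<in>A. c p * sf (G p))"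
proof -
  have "sf (\<lambda>a b. \<Sum>p\<in>A. c p * G p a b) =
    (\<Sum>j\<in>{1..4 * n}. \<Sum>p\<in>A. c p * ((-1) ^ pp (j + 1) * gg (j + 1) * G p j (j + 1)))"
    unfolding sf_eq sum_distrib_left by (intro sum.cong refl) simp
  then show ?thesis by (simp add: sum.swap[of _ A] sf_eq sum_distrib_left)
qed

lemma sf_scale: "sf (\<lambda>a b. c * G a b) = c * sf G"
  using sf_sum[of "\<lambda>_. c" "\<lambda>_. G" "{()}"] by simp

text \<open>The form with \<open>f\<close> sees only the superdiagonal, and there both halves of
  \<open>F\<close> contribute the same amount.\<close>

lemma sf_Fm:
  assumes kl: "k \<in> I" "l \<in> I"
  shows "sf (Fm n k l) = (if l = k + 1 then 2 * (-1) ^ pp l * gg l else 0)"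
proof -
  have I: "pr k \<le> 4 * n + 1" "pr l \<le> 4 * n + 1" "1 \<le> pr k" "1 \<le> pr l"
    using pr_I kl by (auto simp: Iset_def)
  show ?thesis
  proof (cases "l = k + 1")
    case True
    have pl: "pr k = pr l + 1" using True kl by (auto simp: primeI_def Iset_def)
    have t: "(-1) ^ pp (j + 1) * gg (j + 1) * Fm n k l j (j + 1) =
      (if j = k then (-1) ^ pp l * gg l else 0) + (if j = pr l then th k l * ((-1) ^ pp (pr k) * gg (pr k)) else 0)" for j
    proof -
      have "j = k \<and> j + 1 = l \<longleftrightarrow> j = k" "j = pr l \<and> j + 1 = pr k \<longleftrightarrow> j = pr l"
        using True pl by auto
      then show ?thesis using True pl by (simp only: Fm_eq) (simp add: algebra_simps)
    qed
    have "sf (Fm n k l) = (-1) ^ pp l * gg l + th k l * ((-1) ^ pp (pr k) * gg (pr k))"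
      unfolding sf_eq t sum.distrib using kl I pl True by (auto simp: sum.delta Iset_def)
    moreover have "th k l * ((-1) ^ pp (pr k) * gg (pr k)) = (-1) ^ pp l * gg l"
    proof -
      have "even (\<delta> (pr l)) \<longleftrightarrow> (even (\<delta> l) \<longleftrightarrow> odd l)" by (rule even_dl_pr[OF kl(2)])
      moreover have "pr k - 1 = pr l" "l - 1 = k" using pl True by auto
      moreover have "\<delta> k = 0 \<or> even k" "\<delta> l = 0 \<or> even l" by (auto simp: dl_def)
      ultimately show ?thesis
        using kl True unfolding thsign_def gg_def power_add[symmetric]
        by (intro neg_one_power_cong) (auto simp: even_pp)
    qed
    ultimately show ?thesis using True by simp
  next
    case False
    have t: "Fm n k l j (j + 1) = 0" if "j \<in> {1..4 * n}" for j
    proof -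
      have "\<not> (j = k \<and> j + 1 = l)" "\<not> (j = pr l \<and> j + 1 = pr k)"
        using False kl that by (auto simp: primeI_def Iset_def)
      then show ?thesis by (simp only: Fm_eq if_False) simp
    qed
    then show ?thesis using False by (simp add: sf_eq)
  qed
qed

section \<open>The affine algebras, the reduction map and the ideal\<close>

definition FS :: "sv set" where "FS = {(DD ^^ m) (Fb i j) | i j m. i \<in> I \<and> j \<in> I}"
definition PS :: "sv set" where "PS = {(DD ^^ m) (Fb i j) | i j m. i \<in> I \<and> j \<in> I \<and> j \<le> i}"

lemma PS_FS: "PS \<subseteq> FS"
  by (auto simp: PS_def FS_def)

lemma Vg_cf: "Vg n = cf ` alg FS"
proof -
  have "{Dpow m (bar (Fm n i j)) | i j m. i \<in> I \<and> j \<in> I} = cf ` FS"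
    unfolding FS_def bar_cf Dpow_cf Fb_def by blast
  then show ?thesis by (simp add: Vg_def alg_gen_cf)
qed

lemma Vp_cf: "Vp n = cf ` alg PS"
proof -
  have "{Dpow m (bar (Fm n i j)) | i j m. i \<in> I \<and> j \<in> I \<and> j \<le> i} = cf ` PS"
    unfolding PS_def bar_cf Dpow_cf Fb_def by blast
  then show ?thesis by (simp add: Vp_def alg_gen_cf)
qed

lemma sg_hpar_alg: "hpar e s \<Longrightarrow> s \<in> alg S \<Longrightarrow> sg s \<in> alg S"
  unfolding hpar_def using alg_uminus by (auto split: if_splits)

lemma FS_I: "i \<in> I \<Longrightarrow> j \<in> I \<Longrightarrow> (DD ^^ m) (Fb i j) \<in> FS"
  and PS_I: "i \<in> I \<Longrightarrow> j \<in> I \<Longrightarrow> j \<le> i \<Longrightarrow> (DD ^^ m) (Fb i j) \<in> PS"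
  by (auto simp: FS_def PS_def)

lemma sg_FS: "s \<in> FS \<Longrightarrow> sg s \<in> alg FS" and sg_PS: "s \<in> PS \<Longrightarrow> sg s \<in> alg PS"
proof -
  show "s \<in> FS \<Longrightarrow> sg s \<in> alg FS"
    using hpar_DD_pow[OF hpar_Fb] sg_hpar_alg alg.alg_gen[of s FS] unfolding FS_def by blast
  show "s \<in> PS \<Longrightarrow> sg s \<in> alg PS"
    using hpar_DD_pow[OF hpar_Fb] sg_hpar_alg alg.alg_gen[of s PS] unfolding PS_def by blast
qed

lemma Fb_FS: "i \<in> I \<Longrightarrow> j \<in> I \<Longrightarrow> Fb i j \<in> alg FS"
  and Fb_PS: "i \<in> I \<Longrightarrow> j \<in> I \<Longrightarrow> j \<le> i \<Longrightarrow> Fb i j \<in> alg PS"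
  using FS_I[of i j 0] PS_I[of i j 0] alg.alg_gen by auto

lemma DD_FS: "s \<in> FS \<Longrightarrow> DD s \<in> FS" and DD_PS: "s \<in> PS \<Longrightarrow> DD s \<in> PS"
proof -
  have "DD ((DD ^^ m) a) = (DD ^^ Suc m) a" for m a by simp
  then show "s \<in> FS \<Longrightarrow> DD s \<in> FS" "s \<in> PS \<Longrightarrow> DD s \<in> PS"
    unfolding FS_def PS_def by blast+
qed

lemma alg_DD_FS: "a \<in> alg FS \<Longrightarrow> DD a \<in> alg FS" and alg_DD_PS: "a \<in> alg PS \<Longrightarrow> DD a \<in> alg PS"
  using alg_der[OF DD_der] DD_FS DD_PS sg_FS sg_PS alg.alg_gen by meson+

lemma alg_DD_pow_FS: "a \<in> alg FS \<Longrightarrow> (DD ^^ m) a \<in> alg FS"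
  by (induction m) (auto intro: alg_DD_FS)

lemma xi_Fb_FS:
  assumes X: "elt X q" and d: "d \<in> I" "a \<in> I"
  shows "xi X t (Fb d a) \<in> alg FS"
proof -
  consider "t = 0" | "t = 1" | "t \<ge> 2" by linarith
  then show ?thesis
  proof cases
    case 1
    show ?thesis unfolding 1 xi_0_Fb[OF X d]
      by (intro alg.alg_mult alg.alg_cn alg_diff alg_sum Fb_FS d)
  next
    case 2
    show ?thesis unfolding 2 xi_1_Fb[OF X d] by (rule alg.alg_cn)
  next
    case 3
    show ?thesis unfolding xi_ge2_Fb[OF X 3] by simp
  qed
qed

lemma xi_FS:
  assumes X: "elt X q" and a: "a \<in> alg FS"
  shows "xi X t a \<in> alg FS"
proof (rule alg_der[OF xi_der[OF X] _ sg_FS a])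
  have "xi X t ((DD ^^ m) (Fb i j)) \<in> alg FS" if "i \<in> I" "j \<in> I" for i j m t
  proof (induction m arbitrary: t)
    case 0
    then show ?case using xi_Fb_FS[OF X] that by simp
  next
    case (Suc m)
    have "(DD ^^ Suc m) (Fb i j) = DD ((DD ^^ m) (Fb i j))" by simp
    then show ?case unfolding xi_DD[OF X] \<open>_ = DD _\<close>
      using Suc alg_DD_FS by (auto intro!: alg.alg_mult alg.alg_cn alg_diff)
  qed
  then show "xi X t s \<in> alg FS" if "s \<in> FS" for s
    using that unfolding FS_def by blast
qed

text \<open>On all of the big algebra \<open>rho\<close> is defined through the projection \<open>e \<mapsto> (e + \<theta> e) / 2\<close>, whence the
 factors \<open>1/2\<close>; on the orthosymplectic generators it is the identity below the diagonal and \<open>(f|\<cdot>)\<close> above.\<close>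

definition rho :: "sv \<Rightarrow> sv" where
  "rho = (SOME h. is_hom h \<and> (\<forall>a. h (DD a) = DD (h a)) \<and> (\<forall>i j. h (gn (i, j, 0)) =
    (if i \<in> I \<and> j \<in> I then if j \<le> i then cn (1/2) * Fb i j else cn (1/2 * sf (Fm n i j)) else gn (i, j, 0))))"

lemma rho_spec: "is_hom rho \<and> (\<forall>a. rho (DD a) = DD (rho a)) \<and> (\<forall>i j. rho (gn (i, j, 0)) =
    (if i \<in> I \<and> j \<in> I then if j \<le> i then cn (1/2) * Fb i j else cn (1/2 * sf (Fm n i j)) else gn (i, j, 0)))"
proof -
  have "hpar (genpar (i, j, 0)) (if i \<in> I \<and> j \<in> I then if j \<le> i then cn (1/2) * Fb i j
      else cn (1/2 * sf (Fm n i j)) else gn (i, j, 0))" for i j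
  proof -
    have "hpar (genpar (i, j, 0)) (cn (1/2 * sf (Fm n i j)))" if "i \<in> I" "j \<in> I"
    proof (cases "j = i + 1")
      case True
      then have "even (genpar (i, j, 0))" by (auto simp: genpar_simp pp_def)
      then show ?thesis by (rule hpar_cn)
    next
      case False
      then show ?thesis using sf_Fm[OF that] by simp
    qed
    then show ?thesis using hpar_Fb hpar_gn[of "(i, j, 0)"] hpar_cn_mult by auto
  qed
  from ex_dhom[OF this] show ?thesis unfolding rho_def by (rule someI_ex)
qed

lemma rho_hom: "is_hom rho" and rho_DD: "rho (DD a) = DD (rho a)"
  using rho_spec by blast+

lemma rho_DD_pow: "rho ((DD ^^ m) a) = (DD ^^ m) (rho a)"
  by (induction m) (auto simp: rho_DD)

lemma rho_gn_out: "i \<notin> I \<Longrightarrow> rho (gn (i, j, 0)) = gn (i, j, 0)"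
  using rho_spec by simp

lemma rho_Fb:
  assumes "i \<in> I" "j \<in> I"
  shows "rho (Fb i j) = (if j \<le> i then Fb i j else cn (sf (Fm n i j)))"
proof -
  have le: "pr i \<le> pr j \<longleftrightarrow> j \<le> i" by (rule pr_le_iff[OF assms])
  have g: "rho (gn (i, j, 0)) = (if j \<le> i then cn (1/2) * Fb i j else cn (1/2 * sf (Fm n i j)))"
    "rho (gn (pr j, pr i, 0)) = (if j \<le> i then cn (1/2) * Fb (pr j) (pr i) else cn (1/2 * sf (Fm n (pr j) (pr i))))"
    using rho_spec assms le by simp_all
  have "rho (Fb i j) = rho (gn (i, j, 0)) + cn (th i j) * rho (gn (pr j, pr i, 0))"
    by (simp only: Fb_eq is_homD[OF rho_hom])
  moreover have "sf (Fm n i j) = th i j * sf (Fm n (pr j) (pr i))"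
    by (subst Fm_swap[OF assms]) (rule sf_scale)
  moreover have "cn (th i j) * (cn (1/2) * Fb (pr j) (pr i)) = cn (1/2) * Fb i j"
    unfolding Fb_swap[OF assms] by (simp only: mult.assoc[symmetric] cn_mult[symmetric] mult.commute)
  moreover have "cn (1/2) * x + cn (1/2) * x = x" for x
    by (simp add: distrib_right[symmetric] flip: cn_simps(3))
  ultimately show ?thesis unfolding g by (auto simp flip: cn_mult cn_simps(3))
qed

lemma rho_PS: "a \<in> alg PS \<Longrightarrow> rho a = a"
  by (rule alg_hom_eq[OF rho_hom is_hom_id]) (auto simp: PS_def rho_DD_pow rho_Fb)

inductive_set JS :: "sv set" where
  JS_zero: "0 \<in> JS"
| JS_gen: "a \<in> alg FS \<Longrightarrow> X \<in> nset n \<Longrightarrow> a * (DD ^^ m) (bars X - cn (sf X)) \<in> JS"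
| JS_add: "a \<in> JS \<Longrightarrow> b \<in> JS \<Longrightarrow> a + b \<in> JS"

lemma Jset_cf: "Jset n = cf ` JS"
proof (intro equalityI subsetI)
  fix p assume "p \<in> Jset n"
  then show "p \<in> cf ` JS"
  proof induction
    case J_zero
    then show ?case using JS_zero by (auto simp: cf_transfer)
  next
    case (J_gen a X m)
    then obtain b where b: "a = cf b" "b \<in> alg FS" by (auto simp: Vg_cf)
    have "Vmul a (Dpow m (sadd (bar X) (sconst (- strform (fm n) X)))) = cf (b * (DD ^^ m) (bars X - cn (sf X)))"
      unfolding b bar_cf cf_transfer Dpow_cf sf_def by simp
    then show ?case using JS_gen[OF b(2) J_gen(2)] by auto
  next
    case (J_add p q)
    then show ?case using JS_add by (auto simp: cf_transfer)
  qed
next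
  fix p assume "p \<in> cf ` JS"
  then obtain a where a: "p = cf a" "a \<in> JS" by blast
  have "cf a \<in> Jset n" using a(2)
  proof induction
    case JS_zero
    then show ?case using J_zero[of n] by (simp add: cf_transfer)
  next
    case (JS_gen a X m)
    then have "Vmul (cf a) (Dpow m (sadd (bar X) (sconst (- strform (fm n) X)))) \<in> Jset n"
      by (intro J_gen) (auto simp: Vg_cf)
    then show ?case unfolding bar_cf cf_transfer Dpow_cf sf_def by simp
  next
    case (JS_add a b)
    then show ?case using J_add[of "cf a" n "cf b"] by (simp add: cf_transfer)
  qed
  then show "p \<in> Jset n" using a(1) by simp
qed

definition up :: "(nat \<times> nat) set" where "up = {(i, j). i \<in> I \<and> j \<in> I \<and> i < j}"

lemma finite_up: "finite up"
  by (rule finite_subset[of _ "I \<times> I"]) (auto simp: up_def)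

lemma nset_E:
  assumes "X \<in> nset n"
  obtains c where "X = (\<lambda>a b. \<Sum>p\<in>up. c p * Fm n (fst p) (snd p) a b)"
proof -
  obtain c where "X = (\<lambda>a b. \<Sum>(i, j)\<in>up. c i j * Fm n i j a b)"
    using assms unfolding nset_def up_def by auto
  then show ?thesis using that[of "\<lambda>p. c (fst p) (snd p)"] by (simp add: case_prod_unfold)
qed

lemma Fm_nset:
  assumes "i \<in> I" "j \<in> I" "i < j"
  shows "Fm n i j \<in> nset n"
proof -
  let ?c = "\<lambda>k l. if (k, l) = (i, j) then 1 else 0 :: complex"
  have "Fm n i j = (\<lambda>a b. \<Sum>(k, l)\<in>up. ?c k l * Fm n k l a b)"
  proof (intro ext)
    fix a b
    have "(\<Sum>(k, l)\<in>up. ?c k l * Fm n k l a b) = (\<Sum>p\<in>up. if p = (i, j) then Fm n i j a b else 0)"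
      unfolding case_prod_unfold by (rule sum.cong) (auto split: if_splits)
    also have "\<dots> = Fm n i j a b" using assms finite_up by (simp add: sum.delta up_def)
    finally show "Fm n i j a b = (\<Sum>(k, l)\<in>up. ?c k l * Fm n k l a b)" by simp
  qed
  then show ?thesis unfolding nset_def up_def by (intro CollectI exI[of _ ?c])
qed

lemma sum_II_swap:
  fixes c :: "'p \<Rightarrow> complex"
  assumes "\<And>p a b. p \<in> A \<Longrightarrow> G p a b \<noteq> 0 \<Longrightarrow> a \<in> I \<and> b \<in> I"
  shows "(\<Sum>p\<in>A. c p * G p a b) \<noteq> 0 \<Longrightarrow> (a, b) \<in> I \<times> I"
proof -
  assume "(\<Sum>p\<in>A. c p * G p a b) \<noteq> 0"
  then obtain p where "p \<in> A" "c p * G p a b \<noteq> 0" by (rule sum.not_neutral_contains_not_neutral)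
  then have "p \<in> A" "G p a b \<noteq> 0" by auto
  then show ?thesis using assms[of p a b] by simp
qed

lemma Fm_I: "p \<in> up \<Longrightarrow> Fm n (fst p) (snd p) a b \<noteq> 0 \<Longrightarrow> a \<in> I \<and> b \<in> I"
  using elt_I[OF elt_Fm[of "fst p" "snd p"], of a b] by (auto simp: up_def)

lemma bars_nset:
  "bars (\<lambda>a b. \<Sum>p\<in>up. c p * Fm n (fst p) (snd p) a b) = (\<Sum>p\<in>up. cn (c p) * Fb (fst p) (snd p))"
proof -
  have "bars (\<lambda>a b. \<Sum>p\<in>up. c p * Fm n (fst p) (snd p) a b) =
      (\<Sum>r\<in>I \<times> I. \<Sum>p\<in>up. cn (c p) * (cn (Fm n (fst p) (snd p) (fst r) (snd r)) * gn (fst r, snd r, 0)))"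
    by (subst bars_superset[OF finite_II sum_II_swap[OF Fm_I]])
      (auto simp: case_prod_unfold cn_sum cn_mult sum_distrib_right mult.assoc)
  also have "\<dots> = (\<Sum>p\<in>up. cn (c p) * Fb (fst p) (snd p))"
    unfolding Fb_def
    by (subst sum.swap, rule sum.cong[OF refl], subst bars_superset[OF finite_II])
      (use Fm_I in \<open>force simp: case_prod_unfold sum_distrib_left\<close>)+
  finally show ?thesis .
qed

lemma xi_nset:
  "xi (\<lambda>a b. \<Sum>p\<in>up. c p * Fm n (fst p) (snd p) a b) t w = (\<Sum>p\<in>up. cn (c p) * xi (Fm n (fst p) (snd p)) t w)"
proof -
  have "xi (\<lambda>a b. \<Sum>p\<in>up. c p * Fm n (fst p) (snd p) a b) t w =
      (\<Sum>r\<in>I \<times> I. \<Sum>p\<in>up. cn (c p) * (cn (Fm n (fst p) (snd p) (fst r) (snd r)) * bet (fst r) (snd r) t w))"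
    by (subst xi_superset[OF finite_II sum_II_swap[OF Fm_I]])
      (auto simp: case_prod_unfold cn_sum cn_mult sum_distrib_right mult.assoc)
  also have "\<dots> = (\<Sum>p\<in>up. cn (c p) * xi (Fm n (fst p) (snd p)) t w)"
    by (subst sum.swap, rule sum.cong[OF refl], subst xi_superset[OF finite_II])
      (use Fm_I in \<open>force simp: case_prod_unfold sum_distrib_left\<close>)+
  finally show ?thesis .
qed

lemma rho_JS: "a \<in> JS \<Longrightarrow> rho a = 0"
proof (induction rule: JS.induct)
  case (JS_gen a X m)
  obtain c where c: "X = (\<lambda>a b. \<Sum>p\<in>up. c p * Fm n (fst p) (snd p) a b)"
    using nset_E[OF JS_gen(2)] .
  have "rho (bars X) = (\<Sum>p\<in>up. cn (c p) * cn (sf (Fm n (fst p) (snd p))))"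
    unfolding c bars_nset is_hom_sum[OF rho_hom]
    by (intro sum.cong refl) (auto simp: is_homD[OF rho_hom] rho_Fb up_def)
  also have "\<dots> = cn (sf X)" unfolding c sf_sum by (simp add: cn_sum cn_mult)
  finally show ?case by (simp add: is_homD[OF rho_hom] rho_DD_pow)
qed (auto simp: is_homD[OF rho_hom])

lemma JS_mult_left: "x \<in> JS \<Longrightarrow> a \<in> alg FS \<Longrightarrow> a * x \<in> JS"
proof (induction rule: JS.induct)
  case (JS_gen b X m)
  then show ?case using JS.JS_gen[of "a * b" X m] by (simp add: mult.assoc alg.alg_mult)
qed (auto simp: distrib_left intro: JS.intros)

lemma JS_Fb: "i \<in> I \<Longrightarrow> j \<in> I \<Longrightarrow> i < j \<Longrightarrow> (DD ^^ m) (Fb i j - cn (sf (Fm n i j))) \<in> JS"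
  using JS_gen[OF alg_one Fm_nset, of i j m] by (simp add: Fb_def)

lemma hpar_nset_gen:
  assumes "i \<in> I" "j \<in> I" "i < j"
  shows "hpar (genpar (i, j, 0) + m) ((DD ^^ m) (Fb i j - cn (sf (Fm n i j))))"
proof (rule hpar_DD_pow, rule hpar_diff[OF hpar_Fb[OF assms(1,2)]])
  show "hpar (genpar (i, j, 0)) (cn (sf (Fm n i j)))"
  proof (cases "j = i + 1")
    case True
    then have "even (genpar (i, j, 0))" by (auto simp: genpar_simp pp_def)
    then show ?thesis by (rule hpar_cn)
  next
    case False
    then show ?thesis using sf_Fm[OF assms(1,2)] by simp
  qed
qed

lemma JS_sum: "(\<And>x. x \<in> A \<Longrightarrow> f x \<in> JS) \<Longrightarrow> sum f A \<in> JS"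
  by (induction A rule: infinite_finite_induct) (auto intro: JS.intros)

text \<open>The ideal is generated by left multiples only. A homogeneous generator can be moved past
  \<open>b\<close> at the cost of a \<open>tw\<close>; since an element of n may mix parities, it is
  first decomposed into the \<open>Fb\<close>.\<close>

lemma JS_mult_right: "x \<in> JS \<Longrightarrow> b \<in> alg FS \<Longrightarrow> x * b \<in> JS"
proof (induction rule: JS.induct)
  case (JS_gen a X m)
  obtain c where c: "X = (\<lambda>a b. \<Sum>p\<in>up. c p * Fm n (fst p) (snd p) a b)"
    using nset_E[OF JS_gen(2)] .
  let ?g = "\<lambda>p. (DD ^^ m) (Fb (fst p) (snd p) - cn (sf (Fm n (fst p) (snd p))))"
  have s: "(DD ^^ m) (sum f A) = (\<Sum>x\<in>A. (DD ^^ m) (f x))" for f :: "nat \<times> nat \<Rightarrow> sv" and A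
    by (induction A rule: infinite_finite_induct) auto
  have "(DD ^^ m) (bars X - cn (sf X)) = (DD ^^ m) (\<Sum>p\<in>up. cn (c p) * (Fb (fst p) (snd p) - cn (sf (Fm n (fst p) (snd p)))))"
    unfolding c bars_nset sf_sum
    by (simp add: cn_sum cn_mult sum_subtractf right_diff_distrib)
  also have "\<dots> = (\<Sum>p\<in>up. cn (c p) * ?g p)"
    unfolding s by (simp only: DD_pow_simps(2))
  finally have e: "(DD ^^ m) (bars X - cn (sf X)) = (\<Sum>p\<in>up. cn (c p) * ?g p)" .
  have "a * (cn (c p) * ?g p) * b \<in> JS" if p: "p \<in> up" for p
  proof -
    have pI: "fst p \<in> I" "snd p \<in> I" "fst p < snd p" using p by (auto simp: up_def)
    let ?e = "genpar (fst p, snd p, 0) + m"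
    have "a * (cn (c p) * ?g p) * b = a * (cn (c p) * (tw ?e b * ?g p))"
      using supercomm[OF hpar_nset_gen[OF pI], of m b] by (simp add: mult.assoc)
    also have "\<dots> = (a * (cn (c p) * tw ?e b)) * ?g p" by (simp add: mult.assoc)
    also have "\<dots> \<in> JS"
      using JS_gen.hyps(1) JS_gen.prems pI sg_FS
      by (intro JS_mult_left JS_Fb alg.alg_mult alg.alg_cn alg_tw) auto
    finally show ?thesis .
  qed
  then show ?case unfolding e sum_distrib_left sum_distrib_right by (rule JS_sum)
qed (auto simp: distrib_right intro: JS.intros)

lemma rho_FS: "a \<in> alg FS \<Longrightarrow> rho a \<in> alg FS"
proof (rule alg_hom[OF rho_hom])
  fix s assume "s \<in> FS"
  then obtain i j m where s: "s = (DD ^^ m) (Fb i j)" "i \<in> I" "j \<in> I" by (auto simp: FS_def)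
  have "rho (Fb i j) \<in> alg FS" using s by (simp add: rho_Fb Fb_FS alg.alg_cn)
  then show "rho s \<in> alg FS" unfolding s rho_DD_pow by (rule alg_DD_pow_FS)
qed

text \<open>Modulo the ideal every generator equals its image under \<open>rho\<close>, and for
  products the difference telescopes. Together with \<open>rho_JS\<close> this identifies the ideal
  with the kernel of \<open>rho\<close>.\<close>

lemma minus_rho_JS: "a \<in> alg FS \<Longrightarrow> a - rho a \<in> JS"
proof (induction rule: alg.induct)
  case (alg_cn c)
  then show ?case by (simp add: is_homD[OF rho_hom] JS_zero)
next
  case (alg_gen s)
  then obtain i j m where s: "s = (DD ^^ m) (Fb i j)" "i \<in> I" "j \<in> I" by (auto simp: FS_def)
  then show ?case
    using JS_Fb[of i j m] JS_zero by (auto simp: rho_DD_pow rho_Fb)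
next
  case (alg_add a b)
  then have "(a - rho a) + (b - rho b) \<in> JS" by (intro JS_add)
  then show ?case by (simp add: is_homD[OF rho_hom] algebra_simps)
next
  case (alg_mult a b)
  then have "(a - rho a) * b + rho a * (b - rho b) \<in> JS"
    by (intro JS_add JS_mult_left JS_mult_right rho_FS)
  then show ?case by (simp add: is_homD[OF rho_hom] algebra_simps)
qed

lemma JS_iff: "a \<in> alg FS \<Longrightarrow> a \<in> JS \<longleftrightarrow> rho a = 0"
  using rho_JS minus_rho_JS by fastforce

text \<open>By linearity it suffices to test against the spanning \<open>F_ij\<close>. Unlike a
  general element of n these have a parity, so that the bracket coefficients are
  superderivations.\<close>

definition WS :: "sv set" where
  "WS = {w \<in> alg PS. \<forall>i\<in>I. \<forall>j\<in>I. i < j \<longrightarrow> (\<forall>t. rho (xi (Fm n i j) t w) = 0)}"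

lemma Wset_cf: "Wset n = cf ` WS"
proof -
  have 1: "(\<forall>X\<in>nset n. \<forall>t. brk X (cf w) t \<in> Jset n) \<longleftrightarrow>
      (\<forall>i\<in>I. \<forall>j\<in>I. i < j \<longrightarrow> (\<forall>t. rho (xi (Fm n i j) t w) = 0))" (is "?L = ?R") if "w \<in> alg PS" for w
  proof -
    have w: "w \<in> alg FS" using that alg_mono[OF PS_FS] by blast
    have cfJ: "cf a \<in> Jset n \<longleftrightarrow> a \<in> JS" for a by (auto simp: Jset_cf cf_inject)
    have x: "xi (Fm n i j) t w \<in> alg FS" if "i \<in> I" "j \<in> I" for i j t
      by (rule xi_FS[OF elt_Fm[OF that] w])
    have J: "xi (Fm n i j) t w \<in> JS \<longleftrightarrow> rho (xi (Fm n i j) t w) = 0" if "i \<in> I" "j \<in> I" for i j t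
      by (rule JS_iff[OF x[OF that]])
    show ?thesis
    proof
      assume L: ?L
      then show ?R using J Fm_nset unfolding brk_cf cfJ by blast
    next
      assume R: ?R
      show ?L
      proof (intro ballI allI)
        fix X t assume "X \<in> nset n"
        then obtain c where c: "X = (\<lambda>a b. \<Sum>p\<in>up. c p * Fm n (fst p) (snd p) a b)" by (rule nset_E)
        have "cn (c p) * xi (Fm n (fst p) (snd p)) t w \<in> JS" if "p \<in> up" for p
          using R J that by (intro JS_mult_left alg.alg_cn) (auto simp: up_def)
        then have "xi X t w \<in> JS" unfolding c xi_nset by (rule JS_sum)
        then show "brk X (cf w) t \<in> Jset n" unfolding brk_cf cfJ .
      qed
    qed
  qed
  show ?thesis unfolding Wset_def WS_def Vp_cf using 1 by auto
qed

end

section \<open>The row determinant and gauge invariance\<close>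

text \<open>Inverting the permutations turns an expansion along a row into one along a column, the
  right direction for a Hessenberg matrix.\<close>

lemma sum_permutes_insert_right:
  assumes "finite S" "a \<notin> S"
  shows "(\<Sum>p | p permutes insert a S. F p) =
    (\<Sum>b\<in>insert a S. \<Sum>q | q permutes S. F (q \<circ> Transposition.transpose a b))"
proof -
  have "(\<Sum>p | p permutes insert a S. F p) = (\<Sum>p | p permutes insert a S. F (inv p))"
    by (rule sum_permutations_inverse)
  also have "\<dots> = (\<Sum>b\<in>insert a S. \<Sum>q | q permutes S. F (inv (Transposition.transpose a b \<circ> q)))"
    by (rule sum_over_permutations_insert[OF assms])
  also have "\<dots> = (\<Sum>b\<in>insert a S. \<Sum>q | q permutes S. F (inv q \<circ> Transposition.transpose a b))"
    by (intro sum.cong refl) (simp add: o_inv_distrib permutes_bij)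
  also have "\<dots> = (\<Sum>b\<in>insert a S. \<Sum>q | q permutes S. F (q \<circ> Transposition.transpose a b))"
    by (intro sum.cong refl sum_permutations_inverse[symmetric])
  finally show ?thesis .
qed

definition DDop :: "(nat \<Rightarrow> sv) \<Rightarrow> nat \<Rightarrow> sv" where
  "DDop q = (\<lambda>t. DD (q t) + (if t = 0 then 0 else sg (q (t - 1))))"

lemma Dop_cf: "Dop (\<lambda>t. cf (q t)) = (\<lambda>t. cf (DDop q t))"
proof
  fix t
  show "Dop (\<lambda>t. cf (q t)) t = cf (DDop q t)"
    by (cases "t = 0") (simp_all add: Dop_def DDop_def Dder_cf sinv_cf cf_transfer)
qed

context osp
begin

definition N :: nat where "N = 4 * n + 1"

lemma I_eq: "I = {1..N}"
  by (simp add: Iset_def N_def)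

lemma N_ge: "5 \<le> N"
  using n_pos by (simp add: N_def)

lemma fm_sub: "1 \<le> j \<Longrightarrow> j < N \<Longrightarrow> fm n (Suc j) j = gg (Suc j)"
  and fm_other: "b \<noteq> Suc j \<Longrightarrow> fm n b j = 0"
  by (auto simp: fm_eq N_def)

definition coef :: "nat \<Rightarrow> nat \<Rightarrow> sv" where
  "coef i j = (if i \<le> j then Eb j i else cn (- fm n i j))"

text \<open>Left multiplication of an operator by the entry \<open>A_ij\<close>.\<close>

definition act :: "nat \<Rightarrow> nat \<Rightarrow> (nat \<Rightarrow> sv) \<Rightarrow> nat \<Rightarrow> sv" where
  "act i j q = (\<lambda>t. coef i j * q t + (if i = j then DDop q t else 0))"

definition oneq :: "nat \<Rightarrow> sv" where "oneq = (\<lambda>t. if t = 0 then 1 else 0)"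

lemma Amat_cf: "Amat n i j t = cf (if t = 0 then coef i j else if t = 1 \<and> i = j then 1 else 0)"
  by (auto simp: Amat_def coef_def bar_cf bars_Em cf_transfer)

lemma opmul_Amat: "opmul (Amat n i j) (\<lambda>t. cf (q t)) = (\<lambda>t. cf (act i j q t))"
proof (intro ext)
  fix t m
  have z: "Vmul (Amat n i j s) ((Dop ^^ s) (\<lambda>t. cf (q t)) t) m = 0" if "s \<notin> {0, 1}" for s
  proof -
    have "Amat n i j s = (\<lambda>_. 0)" using that by (simp add: Amat_cf cf_simps)
    then show ?thesis by (simp add: smul_def)
  qed
  have "opmul (Amat n i j) (\<lambda>t. cf (q t)) t m =
      (\<Sum>s\<in>{0, 1}. Vmul (Amat n i j s) ((Dop ^^ s) (\<lambda>t. cf (q t)) t) m)"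
    unfolding opmul_def
  proof (rule sum.mono_neutral_left)
    show "{s. Amat n i j s \<noteq> szero} \<subseteq> {0, 1}" by (auto simp: Amat_cf cf_simps szero_def)
    show "\<forall>s\<in>{0, 1} - {s. Amat n i j s \<noteq> szero}. Vmul (Amat n i j s) ((Dop ^^ s) (\<lambda>t. cf (q t)) t) m = 0"
      by (auto simp: szero_def smul_def)
  qed simp
  also have "\<dots> = cf (act i j q t) m"
    by (simp add: Amat_cf Dop_cf cf_transfer act_def cf_simps)
  finally show "opmul (Amat n i j) (\<lambda>t. cf (q t)) t m = cf (act i j q t) m" .
qed

lemma foldr_opmul: "foldr opmul (map (\<lambda>i. Amat n i (\<sigma> i)) xs) opone =
    (\<lambda>t. cf (foldr (\<lambda>i. act i (\<sigma> i)) xs oneq t))"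
proof (induction xs)
  case Nil
  show ?case by (auto simp: opone_def oneq_def cf_transfer)
next
  case (Cons x xs)
  then show ?case by (simp add: opmul_Amat)
qed

definition rdetS :: "nat \<Rightarrow> sv" where
  "rdetS t = (\<Sum>\<sigma> | \<sigma> permutes {1..N}. cn (of_int (sign \<sigma>)) * foldr (\<lambda>i. act i (\<sigma> i)) [1..<N + 1] oneq t)"

lemma rdet_cf: "rdet n t = cf (rdetS t)"
proof
  fix m
  show "rdet n t m = cf (rdetS t) m"
    unfolding rdet_def rdetS_def cf_sum foldr_opmul by (simp add: cf_cn_mult N_def)
qed

lemma DDop_sum: "DDop (\<lambda>t. \<Sum>p\<in>A. cn (c p) * Q p t) = (\<lambda>t. \<Sum>p\<in>A. cn (c p) * DDop (Q p) t)"
  by (auto simp: DDop_def DD_sum sg_sum distrib_left sum.distrib fun_eq_iff)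

lemma act_sum: "act i j (\<lambda>t. \<Sum>p\<in>A. cn (c p) * Q p t) = (\<lambda>t. \<Sum>p\<in>A. cn (c p) * act i j (Q p) t)"
  unfolding act_def DDop_sum
  by (auto simp: sum_distrib_left distrib_left sum.distrib cn_left_commute fun_eq_iff)

lemma act_scale: "act i j (\<lambda>t. cn c * Q t) = (\<lambda>t. cn c * act i j Q t)"
  using act_sum[of i j "\<lambda>_. c" "\<lambda>_. Q" "{()}"] by simp

lemma act_zero: "act i j (\<lambda>t. 0) = (\<lambda>t. 0)"
  by (auto simp: act_def DDop_def)

lemma foldr_act_zero:
  assumes "b \<in> set xs" "\<And>q. act b (\<sigma> b) q = (\<lambda>t. 0)"
  shows "foldr (\<lambda>i. act i (\<sigma> i)) xs Q = (\<lambda>t. 0)"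
  using assms(1) by (induction xs) (auto simp: assms(2) act_zero)

lemma act_sub: "j < i \<Longrightarrow> act i j Q = (\<lambda>t. cn (- fm n i j) * Q t)"
  by (simp add: act_def coef_def)

text \<open>The row determinant of the submatrix with rows \<open>r, j + 1, \<dots>, N\<close> and columns \<open>j, \<dots>, N\<close>. Only two
 entries of its first column are nonzero, and the lower one is a scalar, which gives a two-term recursion.\<close>

definition TT :: "nat \<Rightarrow> nat \<Rightarrow> nat \<Rightarrow> sv" where
  "TT r j = (\<lambda>t. \<Sum>\<sigma> | \<sigma> permutes {j..N}. cn (of_int (sign \<sigma>)) *
    act r (\<sigma> j) (foldr (\<lambda>i. act i (\<sigma> i)) [Suc j..<N + 1] oneq) t)"

lemma rdetS_TT: "rdetS = TT 1 1"
proof -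
  have "[1..<N + 1] = 1 # [Suc 1..<N + 1]" by (rule upt_conv_Cons) (use N_ge in simp)
  then show ?thesis by (auto simp: rdetS_def TT_def fun_eq_iff)
qed

lemma TT_N: "TT r N = act r N oneq"
  by (simp add: TT_def)

text \<open>Column \<open>j\<close> can be taken by row \<open>r\<close>, which leaves the block
  starting at \<open>Suc j\<close>, or by row \<open>Suc j\<close>. In the second case the entry is
  a scalar, so it leaves the ordered product without disturbing the other factors, and
  \<open>r\<close> remains the top row.\<close>

lemma TT_step:
  assumes j: "1 \<le> j" "j < N"
  shows "TT r j = (\<lambda>t. act r j (TT (Suc j) (Suc j)) t + cn (gg (Suc j)) * TT r (Suc j) t)"
proof
  fix t
  let ?S = "{Suc j..N}"
  let ?F = "\<lambda>\<sigma>. cn (of_int (sign \<sigma>)) * act r (\<sigma> j) (foldr (\<lambda>i. act i (\<sigma> i)) [Suc j..<N + 1] oneq) t"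
  let ?R = "\<lambda>q. foldr (\<lambda>i. act i (q i)) [Suc (Suc j)..<N + 1] oneq"
  have S: "finite ?S" "j \<notin> ?S" "{j..N} = insert j ?S" using j by auto
  have list: "[Suc j..<N + 1] = Suc j # [Suc (Suc j)..<N + 1]" using j by (intro upt_conv_Cons) simp
  have b0: "(\<Sum>q | q permutes ?S. ?F (q \<circ> Transposition.transpose j j)) = act r j (TT (Suc j) (Suc j)) t"
  proof -
    have "act r j (TT (Suc j) (Suc j)) t = (\<Sum>q | q permutes ?S. cn (of_int (sign q)) *
        act r j (act (Suc j) (q (Suc j)) (?R q)) t)"
      unfolding TT_def by (subst act_sum) simp
    also have "\<dots> = (\<Sum>q | q permutes ?S. ?F q)"
    proof (rule sum.cong[OF refl])
      fix q assume "q \<in> {q. q permutes ?S}"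
      then have "q j = j" by (simp add: permutes_def)
      then show "cn (of_int (sign q)) * act r j (act (Suc j) (q (Suc j)) (?R q)) t = ?F q"
        unfolding list by simp
    qed
    finally show ?thesis by simp
  qed
  have b1: "(\<Sum>q | q permutes ?S. ?F (q \<circ> Transposition.transpose j (Suc j))) = cn (gg (Suc j)) * TT r (Suc j) t"
  proof -
    have "?F (q \<circ> Transposition.transpose j (Suc j)) =
        cn (gg (Suc j)) * (cn (of_int (sign q)) * act r (q (Suc j)) (?R q) t)" if q: "q permutes ?S" for q
    proof -
      let ?\<sigma> = "q \<circ> Transposition.transpose j (Suc j)"
      have qj: "q j = j" using q by (simp add: permutes_def)
      have "sign ?\<sigma> = - sign q"
        using permutes_imp_permutation[OF S(1) q]
        by (simp add: sign_compose permutation_swap_id sign_swap_id)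
      moreover have "?\<sigma> j = q (Suc j)" "?\<sigma> (Suc j) = j" using qj by simp_all
      moreover have "foldr (\<lambda>i. act i (?\<sigma> i)) [Suc (Suc j)..<N + 1] oneq = ?R q"
        by (intro foldr_cong refl) auto
      moreover have "act (Suc j) j (?R q) = (\<lambda>t. cn (- gg (Suc j)) * ?R q t)"
        using j by (simp add: act_sub fm_sub)
      ultimately have "?F ?\<sigma> = cn (of_int (- sign q)) * act r (q (Suc j)) (\<lambda>t. cn (- gg (Suc j)) * ?R q t) t"
        unfolding list by simp
      \<comment> \<open>The minus of the transposition cancels the minus of the subdiagonal
        entry.\<close>
      then show ?thesis
        unfolding act_scale by (simp add: mult.assoc[symmetric] cn_mult[symmetric] mult.commute)
    qed
    then show ?thesis unfolding TT_def sum_distrib_left by (intro sum.cong) auto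
  qed
  have b2: "(\<Sum>q | q permutes ?S. ?F (q \<circ> Transposition.transpose j b)) = 0" if b: "b \<in> ?S - {Suc j}" for b
  proof (rule sum.neutral, rule ballI)
    fix q assume "q \<in> {q. q permutes ?S}"
    then have qj: "q j = j" by (simp add: permutes_def)
    let ?\<sigma> = "q \<circ> Transposition.transpose j b"
    have "?\<sigma> b = j" using qj by simp
    then have "act b (?\<sigma> b) Q = (\<lambda>t. 0)" for Q using b by (simp add: act_sub fm_other)
    then have "foldr (\<lambda>i. act i (?\<sigma> i)) [Suc j..<N + 1] oneq = (\<lambda>t. 0)"
      using b by (intro foldr_act_zero[of b]) auto
    then show "?F ?\<sigma> = 0" by (simp add: act_zero)
  qed
  have "TT r j t = (\<Sum>b\<in>insert j ?S. \<Sum>q | q permutes ?S. ?F (q \<circ> Transposition.transpose j b))"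
    unfolding TT_def S(3) by (rule sum_permutes_insert_right[OF S(1,2)])
  also have "\<dots> = (\<Sum>b\<in>{j, Suc j}. \<Sum>q | q permutes ?S. ?F (q \<circ> Transposition.transpose j b))"
    using j b2 by (intro sum.mono_neutral_right) auto
  also have "\<dots> = act r j (TT (Suc j) (Suc j)) t + cn (gg (Suc j)) * TT r (Suc j) t"
    using b0 b1 by simp
  finally show "TT r j t = act r j (TT (Suc j) (Suc j)) t + cn (gg (Suc j)) * TT r (Suc j) t" .
qed

text \<open>Back substitution for the Hessenberg system \<open>A S = (L, 0, \<dots>, 0)\<close> with last component \<open>1\<close>; \<open>SS 0\<close> is \<open>L\<close>.
 The inner conditional is only there for the termination proof.\<close>

function SS :: "nat \<Rightarrow> nat \<Rightarrow> sv" where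
  "SS a = (if a \<ge> N then oneq
    else (\<lambda>t. cn (gg (Suc a)) * (\<Sum>b\<in>{Suc a..N}. act (Suc a) b (if b \<in> {Suc a..N} then SS b else oneq) t)))"
  by auto
termination by (relation "measure (\<lambda>a. N - a)") auto

declare SS.simps [simp del]

lemma SS_N: "SS N = oneq"
  by (subst SS.simps) simp

lemma SS_rec: "a < N \<Longrightarrow> SS a t = cn (gg (Suc a)) * (\<Sum>b\<in>{Suc a..N}. act (Suc a) b (SS b) t)"
  by (subst SS.simps) (auto intro!: sum.cong arg_cong2[where f = "(*)"])

definition hh :: "nat \<Rightarrow> complex" where "hh j = (\<Prod>k\<in>{Suc j..N}. gg k)"

lemma hh_N: "hh N = 1"
  by (simp add: hh_def)

lemma hh_step: "j < N \<Longrightarrow> hh j = gg (Suc j) * hh (Suc j)"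
  unfolding hh_def by (subst prod.atLeast_Suc_atMost) auto

text \<open>A noncommutative Cramer rule: both sides obey the same two-term recursion. The row
  \<open>r\<close> stays arbitrary because the recursion also calls the block whose top row is
  \<open>Suc j\<close>.\<close>

lemma TT_SS:
  assumes "j \<le> N" "1 \<le> j"
  shows "TT r j = (\<lambda>t. cn (hh j) * (\<Sum>k\<in>{j..N}. act r k (SS k) t))"
  using assms
proof (induction j arbitrary: r rule: inc_induct)
  case base
  then show ?case using TT_N[of r] by (simp add: hh_N SS_N)
next
  case (step j)
  have j: "1 \<le> j" "j < N" using step by auto
  have "TT (Suc j) (Suc j) = (\<lambda>t. cn (hh (Suc j)) * (\<Sum>k\<in>{Suc j..N}. act (Suc j) k (SS k) t))"
    by (rule step.IH) simp
  also have "\<dots> = (\<lambda>t. cn (hh j) * SS j t)"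
  proof
    fix t
    have "hh j * gg (Suc j) = hh (Suc j)" using hh_step[OF j(2)] by (simp add: mult.commute mult.left_commute)
    then show "cn (hh (Suc j)) * (\<Sum>k\<in>{Suc j..N}. act (Suc j) k (SS k) t) = cn (hh j) * SS j t"
      unfolding SS_rec[OF j(2)] by (simp add: mult.assoc[symmetric] cn_mult[symmetric])
  qed
  finally have T: "TT (Suc j) (Suc j) = (\<lambda>t. cn (hh j) * SS j t)" .
  have T': "TT r (Suc j) = (\<lambda>t. cn (hh (Suc j)) * (\<Sum>k\<in>{Suc j..N}. act r k (SS k) t))"
    by (rule step.IH) simp
  have "{j..N} = insert j {Suc j..N}" using j by auto
  then show ?case unfolding TT_step[OF j] T T' act_scale
    using j hh_step[OF j(2)] by (simp add: distrib_left mult.assoc[symmetric] cn_mult[symmetric])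
qed

lemma rdetS_SS: "rdetS t = cn (hh 1) * SS 0 t"
proof -
  have "gg (Suc 0) = 1" by (simp add: gg_def dl_def)
  then show ?thesis unfolding rdetS_TT using TT_SS[of 1 1] SS_rec[of 0 t] N_ge by simp
qed

lemma Eb_PS: "i \<in> I \<Longrightarrow> j \<in> I \<Longrightarrow> j \<le> i \<Longrightarrow> Eb i j \<in> alg PS"
  unfolding Eb_def by (intro alg.alg_mult alg.alg_cn Fb_PS)

lemma alg_sg_PS: "a \<in> alg PS \<Longrightarrow> sg a \<in> alg PS"
  using alg_sg sg_PS by blast

lemma DDop_PS: "(\<And>t. q t \<in> alg PS) \<Longrightarrow> DDop q t \<in> alg PS"
  by (auto simp: DDop_def intro!: alg.alg_add alg_DD_PS alg_sg_PS)

lemma SS_PS: "a \<le> N \<Longrightarrow> SS a t \<in> alg PS"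
proof (induction "N - a" arbitrary: a t rule: less_induct)
  case less
  show ?case
  proof (cases "a = N")
    case True
    then show ?thesis unfolding True SS_N by (simp add: oneq_def)
  next
    case False
    then have a: "a < N" using less.prems by simp
    have "act (Suc a) b (SS b) t \<in> alg PS" if b: "b \<in> {Suc a..N}" for b
    proof -
      have S: "SS b t \<in> alg PS" for t using less.hyps[of b t] a b by auto
      have "coef (Suc a) b \<in> alg PS" using b by (auto simp: coef_def I_eq intro!: Eb_PS)
      then show ?thesis unfolding act_def using S DDop_PS[of "SS b" t]
        by (auto intro!: alg.alg_add alg.alg_mult)
    qed
    then show ?thesis unfolding SS_rec[OF a] by (intro alg.alg_mult alg.alg_cn alg_sum)
  qed
qed

lemma SS_supp: "a \<le> N \<Longrightarrow> t > N - a \<Longrightarrow> SS a t = 0"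
proof (induction "N - a" arbitrary: a t rule: less_induct)
  case less
  show ?case
  proof (cases "a = N")
    case True
    then show ?thesis using less.prems unfolding True SS_N by (simp add: oneq_def)
  next
    case False
    then have a: "a < N" using less.prems by simp
    have "act (Suc a) b (SS b) t = 0" if b: "b \<in> {Suc a..N}" for b
    proof -
      have "SS b t = 0" "SS b (t - 1) = 0" using less.hyps[of b] a b less.prems by auto
      then show ?thesis by (simp add: act_def DDop_def)
    qed
    then show ?thesis unfolding SS_rec[OF a] by simp
  qed
qed

text \<open>The generators attached to the index \<open>N + 1\<close> have zero bracket with the orthosymplectic algebra,
 so that applying operators to \<open>yy 0\<close> turns operators into elements without losing information.\<close>

definition yy :: "nat \<Rightarrow> sv" where "yy t = gn (Suc N, Suc N, t)"

lemma out_I: "Suc N \<notin> I"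
  by (simp add: I_eq)

definition ev :: "(nat \<Rightarrow> sv) \<Rightarrow> sv" where "ev q = (\<Sum>t\<le>N. q t * yy t)"

text \<open>The hypothesis keeps the raised top term within the cutoff \<open>N\<close> of
  \<open>ev\<close>.\<close>

lemma ev_DDop:
  assumes "q N = 0"
  shows "ev (DDop q) = DD (ev q)"
proof -
  have "DD (ev q) = (\<Sum>t\<le>N. DD (q t) * yy t) + (\<Sum>t\<le>N. sg (q t) * yy (Suc t))"
    unfolding ev_def DD_sum by (simp add: DD_mult yy_def sum.distrib)
  also have "(\<Sum>t\<le>N. sg (q t) * yy (Suc t)) = (\<Sum>t<N. sg (q t) * yy (Suc t))"
    using assms by (intro sum.mono_neutral_right) (auto simp: order.order_iff_strict)
  also have "\<dots> = (\<Sum>t\<in>{1..N}. sg (q (t - 1)) * yy t)"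
    by (rule sum.reindex_bij_witness[of _ "\<lambda>t. t - 1" Suc]) auto
  also have "\<dots> = (\<Sum>t\<le>N. (if t = 0 then 0 else sg (q (t - 1))) * yy t)"
    by (intro sum.mono_neutral_cong_left) auto
  finally show ?thesis by (simp add: ev_def DDop_def distrib_right sum.distrib)
qed

definition ss :: "nat \<Rightarrow> sv" where "ss a = ev (SS a)"

lemma ss_N: "ss N = yy 0"
proof -
  have "ss N = (\<Sum>t\<le>N. if t = 0 then yy 0 else 0)"
    unfolding ss_def ev_def SS_N oneq_def by (intro sum.cong) auto
  then show ?thesis by (simp add: sum.delta)
qed

lemma ss_rec:
  assumes a: "a < N"
  shows "ss a = cn (gg (Suc a)) * (DD (ss (Suc a)) + (\<Sum>b\<in>{Suc a..N}. Eb b (Suc a) * ss b))"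
proof -
  have e: "ev (act (Suc a) b (SS b)) = (if b = Suc a then DD (ss (Suc a)) else 0) + Eb b (Suc a) * ss b"
    if b: "b \<in> {Suc a..N}" for b
  proof -
    have "ev (act (Suc a) b (SS b)) = Eb b (Suc a) * ss b + (if b = Suc a then ev (DDop (SS b)) else 0)"
      using b by (auto simp: ev_def act_def coef_def ss_def distrib_right sum.distrib sum_distrib_left mult.assoc)
    moreover have "SS b N = 0" using b by (intro SS_supp) auto
    ultimately show ?thesis using ev_DDop[of "SS b"] by (auto simp: ss_def)
  qed
  have "ss a = cn (gg (Suc a)) * (\<Sum>b\<in>{Suc a..N}. ev (act (Suc a) b (SS b)))"
    unfolding ss_def ev_def SS_rec[OF a] sum_distrib_left sum_distrib_right
    by (subst sum.swap) (simp add: mult.assoc)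
  also have "(\<Sum>b\<in>{Suc a..N}. ev (act (Suc a) b (SS b))) =
     (\<Sum>b\<in>{Suc a..N}. (if b = Suc a then DD (ss (Suc a)) else 0) + Eb b (Suc a) * ss b)"
    by (rule sum.cong[OF refl]) (rule e)
  also have "\<dots> = DD (ss (Suc a)) + (\<Sum>b\<in>{Suc a..N}. Eb b (Suc a) * ss b)"
    using a by (simp add: sum.distrib sum.delta)
  finally show ?thesis .
qed

lemma rho_yy: "rho (yy t) = yy t"
proof -
  have "yy t = (DD ^^ t) (gn (Suc N, Suc N, 0))" by (simp add: yy_def)
  then show ?thesis using rho_gn_out[OF out_I] by (simp only: rho_DD_pow)
qed

lemma rho_ss: "a \<le> N \<Longrightarrow> rho (ss a) = ss a"
  unfolding ss_def ev_def is_hom_sum[OF rho_hom]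
  by (intro sum.cong refl) (simp add: is_homD[OF rho_hom] rho_PS[OF SS_PS] rho_yy)

lemma rho_Eb:
  assumes "k \<in> I" "l \<in> I"
  shows "rho (Eb k l) = (if l \<le> k then Eb k l else if l = k + 1 then - cn (gg l) else 0)"
proof -
  have "rho (Eb k l) = cn (1 / 2 * (-1) ^ pp k) * (if l \<le> k then Fb k l else cn (sf (Fm n k l)))"
    unfolding Eb_def by (simp only: is_homD[OF rho_hom] rho_Fb[OF assms])
  moreover have "1 / 2 * (-1) ^ pp k * (2 * (-1) ^ pp (k + 1) * gg l) = - gg l"
    by (simp add: pp_def)
  ultimately show ?thesis
    using sf_Fm[OF assms] by (auto simp: Eb_def cn_mult[symmetric] cn_simps(4)[symmetric] simp del: cn_simps(4))
qed

text \<open>This is row \<open>l\<close> of the system without its derivative term: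
  \<open>rho\<close> turns \<open>Eb (l - 1) l\<close> into the subdiagonal entry
  \<open>- gg l\<close> and kills what lies further above the diagonal. Since \<open>l\<close>
  exceeds 1, the right side of that row is 0.\<close>

lemma rho_Eb_sum:
  assumes "1 \<le> m" "m < l" "l \<le> N"
  shows "(\<Sum>b\<in>{m..N}. rho (Eb b l) * ss b) = - DD (ss l)"
proof -
  have I: "b \<in> I" if "b \<in> {m..N}" for b using that assms by (auto simp: I_eq)
  have lI: "l \<in> I" using assms by (auto simp: I_eq)
  have "(\<Sum>b\<in>{m..N}. rho (Eb b l) * ss b) =
      (\<Sum>b\<in>{m..N}. (if b = l - 1 then - cn (gg l) * ss (l - 1) else 0) + (if l \<le> b then Eb b l * ss b else 0))"
    using assms by (intro sum.cong refl) (auto simp: rho_Eb[OF I lI])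
  also have "\<dots> = - cn (gg l) * ss (l - 1) + (\<Sum>b\<in>{m..N}. if l \<le> b then Eb b l * ss b else 0)"
  proof -
    have "l - 1 \<in> {m..N}" using assms by auto
    then show ?thesis by (simp add: sum.distrib sum.delta)
  qed
  also have "(\<Sum>b\<in>{m..N}. if l \<le> b then Eb b l * ss b else 0) = (\<Sum>b\<in>{l..N}. Eb b l * ss b)"
    using assms by (intro sum.mono_neutral_cong_right) auto
  also have "- cn (gg l) * ss (l - 1) = - (DD (ss l) + (\<Sum>b\<in>{l..N}. Eb b l * ss b))"
    using ss_rec[of "l - 1"] assms by (simp add: mult.assoc[symmetric] cn_mult[symmetric])
  finally show ?thesis by simp
qed

lemma xi_1_Eb:
  assumes X: "elt X q" and d: "d \<in> I" "a \<in> I"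
  shows "xi X 1 (Eb d a) = cn ((-1) ^ q * X a d)"
proof (cases "X a d = 0")
  case False
  then have "(-1 :: complex) ^ q = (-1) ^ (pp d + pp a)"
    using elt_par[OF X False] by (intro neg_one_power_cong) auto
  then have "1/2 * (-1) ^ pp d * (2 * (-1) ^ pp a * X a d) = (-1) ^ q * X a d"
    by (simp add: power_add)
  then show ?thesis
    unfolding Eb_def is_derD(6)[OF xi_der[OF X]] xi_1_Fb[OF X d] by (simp only: cn_mult[symmetric])
qed (simp add: Eb_def is_derD(6)[OF xi_der[OF X]] xi_1_Fb[OF X d] del: One_nat_def)

lemma xi_ge2_Eb: "elt X q \<Longrightarrow> 2 \<le> t \<Longrightarrow> xi X t (Eb d a) = 0"
  unfolding Eb_def by (simp add: is_derD(6)[OF xi_der] xi_ge2_Fb)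

lemma xi_0_Eb:
  assumes X: "elt X q" and d: "d \<in> I" "a \<in> I"
  shows "xi X 0 (Eb d a) = cn ((-1) ^ (q * (pp d + pp a))) * (\<Sum>k\<in>I. cn (X k d) * Eb k a) -
    cn ((-1) ^ q) * (\<Sum>l\<in>I. cn (X a l) * Eb d l)"
proof -
  let ?h = "1/2 * (-1) ^ pp d :: complex"
  let ?u = "(-1) ^ (q * (pp d + pp a + 1)) :: complex" and ?v = "(-1) ^ (q * (pp d + pp a)) :: complex"
  have 1: "cn (?h * ?u) * (cn (X k d) * Fb k a) = cn ?v * (cn (X k d) * Eb k a)" for k
  proof (cases "X k d = 0")
    case False
    have e: "even (pp k + pp d) = even q" by (rule elt_par[OF X False])
    have "(-1 :: complex) ^ (pp d + q * (pp d + pp a + 1)) = (-1) ^ (q * (pp d + pp a) + pp k)"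
      using e by (intro neg_one_power_cong) auto
    then have "?h * ?u * X k d = ?v * X k d * (1/2 * (-1) ^ pp k)" by (simp add: power_add)
    then show ?thesis unfolding Eb_def by (simp only: mult.assoc[symmetric] cn_mult[symmetric])
  qed simp
  have "(-1 :: complex) ^ (q * (pp d + pp a + 1) + q * (pp d + pp a)) = (-1) ^ q"
    by (intro neg_one_power_cong) auto
  then have "?u * ?v = (-1) ^ q" by (simp only: power_add)
  then have c: "?h * ?u * ?v = (-1) ^ q * ?h" by (metis mult.assoc mult.commute)
  have 2: "cn (?h * ?u) * (cn ?v * (cn (X a l) * Fb d l)) = cn ((-1) ^ q) * (cn (X a l) * Eb d l)" for l
  proof -
    have "?h * ?u * ?v * X a l = (-1) ^ q * X a l * ?h" unfolding c by (simp only: mult_ac)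
    then show ?thesis unfolding Eb_def by (simp only: mult.assoc[symmetric] cn_mult[symmetric])
  qed
  have "xi X 0 (Eb d a) = cn (?h * ?u) * ((\<Sum>k\<in>I. cn (X k d) * Fb k a) - cn ?v * (\<Sum>l\<in>I. cn (X a l) * Fb d l))"
    unfolding Eb_def is_derD(6)[OF xi_der[OF X]] xi_0_Fb[OF X d] by (simp only: mult.assoc cn_mult)
  then show ?thesis
    by (simp only: right_diff_distrib sum_distrib_left 1 2)
qed

lemma hpar_Eb: "i \<in> I \<Longrightarrow> j \<in> I \<Longrightarrow> hpar (pp i + pp j + 1) (Eb i j)"
  using hpar_cn_mult[OF hpar_Fb] unfolding Eb_def by (simp add: hpar_def genpar_simp mod_2_eq_odd)

lemma tw_Eb:
  assumes "i \<in> I" "j \<in> I"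
  shows "tw q (Eb i j) = cn ((-1) ^ (q * (pp i + pp j + 1))) * Eb i j"
  unfolding tw_hpar[OF hpar_Eb[OF assms]] by simp

section \<open>Invariance of the solution vector\<close>

context
  fixes X q
  assumes X: "elt X q" and up: "\<And>a b. X a b \<noteq> 0 \<Longrightarrow> a < b"
begin

lemma rho_xi_ss_step:
  assumes a: "a < N"
  shows "rho (xi X t (ss a)) = cn (gg (Suc a)) *
    (cn ((-1) ^ (q + t)) * (DD (rho (xi X t (ss (Suc a)))) - (if t = 0 then 0 else rho (xi X (t - 1) (ss (Suc a))))) +
     (\<Sum>b\<in>{Suc a..N}. rho (xi X t (Eb b (Suc a))) * ss b + tw (q + t) (Eb b (Suc a)) * rho (xi X t (ss b))))"
proof -
  note D = is_derD[OF xi_der[OF X]] and H = is_homD[OF rho_hom]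
  have "rho (xi X t (Eb b (Suc a) * ss b)) =
      rho (xi X t (Eb b (Suc a))) * ss b + tw (q + t) (Eb b (Suc a)) * rho (xi X t (ss b))"
    if b: "b \<in> {Suc a..N}" for b
  proof -
    have "rho (Eb b (Suc a)) = Eb b (Suc a)" using b by (intro rho_PS Eb_PS) (auto simp: I_eq)
    then show ?thesis using b by (simp add: D(2) H(1,2) rho_ss is_hom_tw[OF rho_hom])
  qed
  then show ?thesis
    unfolding ss_rec[OF a] D(6) D(1) xi_DD[OF X] is_der_sum[OF xi_der[OF X]]
    by (simp add: H(1,2,3,5,8) is_hom_sum[OF rho_hom] rho_DD if_distrib[of rho])
qed

lemma sum_X: "1 \<le> m \<Longrightarrow> m \<le> Suc a \<Longrightarrow> (\<Sum>c\<in>I. cn (X a c) * f c) = (\<Sum>c\<in>{m..N}. cn (X a c) * f c)"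
  unfolding I_eq
proof (rule sum.mono_neutral_right)
  assume m: "1 \<le> m" "m \<le> Suc a"
  show "\<forall>i\<in>{1..N} - {m..N}. cn (X a i) * f i = 0"
  proof
    fix i assume "i \<in> {1..N} - {m..N}"
    then have "\<not> a < i" using m by auto
    then have "X a i = 0" using up by blast
    then show "cn (X a i) * f i = 0" by simp
  qed
qed auto

text \<open>The infinitesimal gauge transformation of the Hessenberg matrix, applied to the solution vector.\<close>

lemma gauge_id:
  assumes a: "a < N"
  shows "(\<Sum>b\<in>{Suc a..N}. rho (xi X 0 (Eb b (Suc a))) * ss b) =
    cn ((-1) ^ q) * (\<Sum>c\<in>I. cn (X (Suc a) c) * DD (ss c)) - cn (gg (Suc a)) * (\<Sum>c\<in>I. cn (X a c) * ss c) +
    (\<Sum>b\<in>{Suc a..N}. tw q (Eb b (Suc a)) * (\<Sum>c\<in>I. cn (X b c) * ss c))"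
proof -
  let ?a = "Suc a" and ?B = "{Suc a..N}"
  have I: "b \<in> I" if "b \<in> ?B" for b using that by (auto simp: I_eq)
  have aI: "?a \<in> I" using a by (simp add: I_eq)
  let ?v = "\<lambda>b. cn ((-1) ^ (q * (pp b + pp ?a)))"
  have "(\<Sum>b\<in>?B. rho (xi X 0 (Eb b ?a)) * ss b) =
    (\<Sum>b\<in>?B. \<Sum>k\<in>I. ?v b * (cn (X k b) * rho (Eb k ?a)) * ss b) -
    (\<Sum>b\<in>?B. \<Sum>l\<in>I. cn ((-1) ^ q) * (cn (X ?a l) * (rho (Eb b l) * ss b)))"
    unfolding sum_subtractf[symmetric] using I aI
    by (intro sum.cong refl)
      (simp add: xi_0_Eb[OF X] is_homD(2,3,8)[OF rho_hom] is_hom_sum[OF rho_hom] left_diff_distrib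
        sum_distrib_left sum_distrib_right mult.assoc sum_subtractf)
  also have "(\<Sum>b\<in>?B. \<Sum>l\<in>I. cn ((-1) ^ q) * (cn (X ?a l) * (rho (Eb b l) * ss b))) =
      (\<Sum>l\<in>I. cn ((-1) ^ q) * (cn (X ?a l) * (\<Sum>b\<in>?B. rho (Eb b l) * ss b)))"
    by (subst sum.swap) (simp add: sum_distrib_left)
  \<comment> \<open>Strict upper triangularity leaves only \<open>l\<close> above
    \<open>Suc a\<close>, and for those row \<open>l\<close> of the system is available.\<close>
  also have "\<dots> = (\<Sum>l\<in>I. cn ((-1) ^ q) * (cn (X ?a l) * - DD (ss l)))"
  proof (rule sum.cong[OF refl])
    fix l assume l: "l \<in> I"
    show "cn ((-1) ^ q) * (cn (X ?a l) * (\<Sum>b\<in>?B. rho (Eb b l) * ss b)) =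
        cn ((-1) ^ q) * (cn (X ?a l) * - DD (ss l))"
    proof (cases "X ?a l = 0")
      case False
      then have "?a < l" by (rule up)
      then show ?thesis using l by (subst rho_Eb_sum) (auto simp: I_eq)
    qed simp
  qed
  also have "(\<Sum>b\<in>?B. \<Sum>k\<in>I. ?v b * (cn (X k b) * rho (Eb k ?a)) * ss b) =
    (\<Sum>b\<in>?B. (\<Sum>k\<in>I. if k = a then - cn (gg ?a) * (cn (X a b) * ss b) else 0)) +
    (\<Sum>b\<in>?B. (\<Sum>k\<in>I. if k \<in> ?B then cn ((-1) ^ (q * (pp k + pp ?a + 1))) * Eb k ?a * (cn (X k b) * ss b) else 0))"
    unfolding sum.distrib[symmetric]
  proof (intro sum.cong refl)
    fix b k assume b: "b \<in> ?B" and k: "k \<in> I"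
    show "?v b * (cn (X k b) * rho (Eb k ?a)) * ss b =
      (if k = a then - cn (gg ?a) * (cn (X a b) * ss b) else 0) +
      (if k \<in> ?B then cn ((-1) ^ (q * (pp k + pp ?a + 1))) * Eb k ?a * (cn (X k b) * ss b) else 0)"
    proof (cases "X k b = 0")
      case True
      then have "k = a \<Longrightarrow> X a b = 0" by simp
      then show ?thesis using True by auto
    next
      case False
      have e: "even (pp k + pp b) = even q" by (rule elt_par[OF X False])
      \<comment> \<open>Against column \<open>Suc a\<close>, \<open>rho\<close> keeps the entries
        with \<open>k\<close> at least \<open>Suc a\<close>, makes \<open>k = a\<close> the constant
        \<open>- gg\<close>, and kills smaller \<open>k\<close>.\<close>
      have "k \<in> ?B \<or> k = a \<or> k < a" using k by (auto simp: I_eq)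
      then consider "k \<in> ?B" | "k = a" | "k < a" by blast
      then show ?thesis
      proof cases
        case 1
        have "(-1 :: complex) ^ (q * (pp b + pp ?a)) = (-1) ^ (q * (pp k + pp ?a + 1))"
          using e by (intro neg_one_power_cong) auto
        then show ?thesis using 1 rho_Eb[OF k aI]
          by (simp add: mult.assoc cn_left_commute[of "Eb k (Suc a)"])
      next
        case 2
        have "(-1 :: complex) ^ (q * (pp b + pp ?a)) = (-1) ^ 0"
          using e 2 by (intro neg_one_power_cong) (auto simp: even_pp)
        then show ?thesis using 2 rho_Eb[OF k aI]
          by (simp add: mult.assoc cn_left_commute[of "cn (X a b)"])
      next
        case 3
        then show ?thesis using rho_Eb[OF k aI] by simp
      qed
    qed
  qed
  also have "(\<Sum>b\<in>?B. (\<Sum>k\<in>I. if k = a then - cn (gg ?a) * (cn (X a b) * ss b) else 0)) =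
      - cn (gg ?a) * (\<Sum>c\<in>I. cn (X a c) * ss c)"
  proof (cases "a \<in> I")
    case True
    then show ?thesis
      by (subst sum_X[of "Suc a"]) (simp_all add: sum.delta sum_distrib_left)
  next
    case False
    then have "X a c = 0" for c using elt_I[OF X, of a c] by auto
    then show ?thesis using False by simp
  qed
  also have "(\<Sum>b\<in>?B. (\<Sum>k\<in>I. if k \<in> ?B then cn ((-1) ^ (q * (pp k + pp ?a + 1))) * Eb k ?a * (cn (X k b) * ss b) else 0)) =
      (\<Sum>k\<in>?B. tw q (Eb k ?a) * (\<Sum>c\<in>I. cn (X k c) * ss c))"
  proof -
    have "(\<Sum>k\<in>I. if k \<in> ?B then cn ((-1) ^ (q * (pp k + pp ?a + 1))) * Eb k ?a * (cn (X k b) * ss b) else 0) =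
        (\<Sum>k\<in>?B. tw q (Eb k ?a) * (cn (X k b) * ss b))" for b
      using I aI by (intro sum.mono_neutral_cong_right) (auto simp: tw_Eb)
    moreover have "(\<Sum>c\<in>I. cn (X k c) * ss c) = (\<Sum>c\<in>?B. cn (X k c) * ss c)" if "k \<in> ?B" for k
      using that by (intro sum_X) auto
    ultimately show ?thesis by (simp only:) (subst sum.swap, simp add: sum_distrib_left)
  qed
  finally show ?thesis by (simp add: sum_negf sum_distrib_left)
qed

text \<open>Each power of \<chi> cancels for its own reason. At \<chi>^0 the derivative of
  \<open>X s\<close> is absorbed by \<open>gauge_id\<close>. At \<chi>^1 the term that
  sesquilinearity carries over from \<chi>^0 is \<open>- X s\<close> up to sign, and the invariant
  form in the bracket with \<open>Eb\<close> contributes its negative. Higher powers have no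
  source.\<close>

lemma rho_xi_ss:
  assumes "a \<le> N"
  shows "rho (xi X 0 (ss a)) = - (\<Sum>c\<in>I. cn (X a c) * ss c) \<and> (\<forall>t\<ge>1. rho (xi X t (ss a)) = 0)"
  using assms
proof (induction "N - a" arbitrary: a rule: less_induct)
  case less
  show ?case
  proof (cases "a = N")
    case True
    have "X N c = 0" if "c \<in> I" for c using up[of N c] that by (auto simp: I_eq)
    then show ?thesis unfolding True ss_N
      by (simp add: yy_def xi_outside[OF X out_I out_I] is_homD[OF rho_hom])
  next
    case False
    then have a: "a < N" using less.prems by simp
    have IH: "rho (xi X 0 (ss b)) = - (\<Sum>c\<in>I. cn (X b c) * ss c)" "\<And>t. t \<ge> 1 \<Longrightarrow> rho (xi X t (ss b)) = 0"
      if "b \<in> {Suc a..N}" for b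
      using less.hyps[of b] a that by auto
    have a': "Suc a \<in> {Suc a..N}" "Suc a \<in> I" using a by (auto simp: I_eq)
    have BI: "b \<in> I" if "b \<in> {Suc a..N}" for b using that by (auto simp: I_eq)
    have "rho (xi X 0 (ss a)) = cn (gg (Suc a)) * (- (cn (gg (Suc a)) * (\<Sum>c\<in>I. cn (X a c) * ss c)))"
    proof -
      have "(\<Sum>b\<in>{Suc a..N}. rho (xi X 0 (Eb b (Suc a))) * ss b + tw (q + 0) (Eb b (Suc a)) * rho (xi X 0 (ss b))) =
        cn ((-1) ^ q) * (\<Sum>c\<in>I. cn (X (Suc a) c) * DD (ss c)) - cn (gg (Suc a)) * (\<Sum>c\<in>I. cn (X a c) * ss c)"
        unfolding sum.distrib gauge_id[OF a] using IH(1) by (simp add: sum_negf)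
      then show ?thesis unfolding rho_xi_ss_step[OF a, of 0] IH(1)[OF a'(1)] by (simp add: DD_sum)
    qed
    then have 0: "rho (xi X 0 (ss a)) = - (\<Sum>c\<in>I. cn (X a c) * ss c)"
      by (simp add: mult.assoc[symmetric] cn_mult[symmetric])
    have 1: "rho (xi X 1 (ss a)) = 0"
    proof -
      have "(\<Sum>b\<in>{Suc a..N}. rho (xi X 1 (Eb b (Suc a))) * ss b + tw (q + 1) (Eb b (Suc a)) * rho (xi X 1 (ss b))) =
        (\<Sum>b\<in>{Suc a..N}. cn ((-1) ^ q) * (cn (X (Suc a) b) * ss b))"
        using IH(2)[of _ 1] BI a'(2)
        by (intro sum.cong refl) (simp add: xi_1_Eb[OF X] is_homD(2,3)[OF rho_hom] cn_mult mult.assoc del: One_nat_def)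
      also have "\<dots> = cn ((-1) ^ q) * (\<Sum>c\<in>I. cn (X (Suc a) c) * ss c)"
        by (subst sum_X[of "Suc a"]) (simp_all add: sum_distrib_left)
      finally show ?thesis
        unfolding rho_xi_ss_step[OF a, of 1] using IH[OF a'(1)] by simp
    qed
    have "rho (xi X t (ss a)) = 0" if t: "t \<ge> 2" for t
      unfolding rho_xi_ss_step[OF a, of t] using t IH(2) a'(1)
      by (simp add: xi_ge2_Eb[OF X t] is_homD[OF rho_hom])
    then have "rho (xi X t (ss a)) = 0" if "t \<ge> 1" for t
      using 1 that by (cases "t = 1") auto
    then show ?thesis using 0 by blast
  qed
qed

end

text \<open>The superderivative with respect to the \<open>j\<close>-th derivative of the auxiliary
  generator annihilates all coefficients and returns \<open>c j\<close> up to the parity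
  automorphism.\<close>

lemma yy_indep:
  assumes "\<And>k. k \<le> M \<Longrightarrow> c k \<in> alg FS" "(\<Sum>k\<le>M. c k * yy k) = 0" "j \<le> M"
  shows "c j = 0"
proof -
  let ?g = "(Suc N, Suc N, j)" and ?e = "genpar (Suc N, Suc N, j)"
  have "hpar (genpar g + ?e) (if g = ?g then 1 else 0)" for g
    by (auto simp: hpar_def)
  from ex_der[OF this] obtain d where d: "is_der ?e d" "\<And>g. d (gn g) = (if g = ?g then 1 else 0)"
    by blast
  note D = is_derD[OF d(1)]
  have "d s = 0" if s: "s \<in> FS" for s
  proof -
    obtain i k m where e: "s = (DD ^^ m) (Fb i k)" "i \<in> I" "k \<in> I"
      using s unfolding FS_def by blast
    then have "i \<noteq> Suc N" "pr k \<noteq> Suc N" using pr_I[of k] by (auto simp: I_eq)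
    then show ?thesis unfolding e Fb_eq by (simp add: D(1,6) d(2))
  qed
  note FS0 = this
  have z: "d a = 0" if "a \<in> alg FS" for a
    using that by (induction rule: alg.induct) (auto simp: D FS0)
  have "d (\<Sum>k\<le>M. c k * yy k) = (\<Sum>k\<le>M. if k = j then tw ?e (c j) else 0)"
    unfolding is_der_sum[OF d(1)] using assms(1) by (intro sum.cong refl) (auto simp: D(2) z yy_def d(2))
  then have "tw ?e (c j) = 0" using assms(2,3) by (simp add: D sum.delta)
  then have "tw ?e (tw ?e (c j)) = 0" by simp
  then show ?thesis by (simp add: tw_tw) (simp add: tw_def)
qed

lemma alg_PS_FS: "a \<in> alg PS \<Longrightarrow> a \<in> alg FS"
  using alg_mono[OF PS_FS] by blast

lemma SS_0_WS: "k \<le> N \<Longrightarrow> SS 0 k \<in> WS"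
proof -
  assume k: "k \<le> N"
  have "rho (xi (Fm n i j) t (SS 0 k)) = 0" if ij: "i \<in> I" "j \<in> I" "i < j" for i j t
  proof -
    let ?X = "Fm n i j"
    note X = elt_Fm[OF ij(1,2)]
    have up: "?X a b \<noteq> 0 \<Longrightarrow> a < b" for a b
      using ij by (auto simp: Fm_eq primeI_def Iset_def split: if_splits)
    \<comment> \<open>Index 0 lies outside the matrix, so the sum in \<open>rho_xi_ss\<close> for
      the component \<open>ss 0\<close> is empty.\<close>
    have "?X 0 c = 0" for c using elt_I[OF X, of 0 c] by (auto simp: I_eq)
    then have z: "rho (xi ?X t (ss 0)) = 0"
      using rho_xi_ss[OF X up, of 0] by (cases "t = 0") simp_all
    have y: "xi ?X t (yy m) = 0" for m t
      unfolding yy_def by (rule xi_outside[OF X out_I out_I])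
    have "rho (xi ?X t (ss 0)) = (\<Sum>m\<le>N. rho (xi ?X t (SS 0 m)) * yy m)"
      unfolding ss_def ev_def
      by (simp add: is_der_sum[OF xi_der[OF X]] is_derD(2)[OF xi_der[OF X]] y is_hom_sum[OF rho_hom]
          is_homD(2)[OF rho_hom] rho_yy)
    then show ?thesis
      using z k xi_FS[OF X alg_PS_FS[OF SS_PS]] rho_FS
      by (intro yy_indep[of N "\<lambda>m. rho (xi ?X t (SS 0 m))"]) auto
  qed
  then show ?thesis unfolding WS_def using SS_PS[of 0 k] by auto
qed

definition wS :: "nat \<Rightarrow> sv" where "wS t = cn (hh 1) * SS 0 (N - t)"

lemma wco_cf: "wco n t = cf (wS t)"
  by (simp add: wco_def rdet_cf rdetS_SS wS_def N_def)

lemma WS_add: "a \<in> WS \<Longrightarrow> b \<in> WS \<Longrightarrow> a + b \<in> WS"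
  and WS_scale: "a \<in> WS \<Longrightarrow> cn c * a \<in> WS"
  by (auto simp: WS_def is_derD(1,6)[OF xi_der[OF elt_Fm]] is_homD(1,2,3)[OF rho_hom]
      intro: alg.alg_add alg.alg_mult alg.alg_cn)

lemma wS_WS: "wS t \<in> WS"
  unfolding wS_def by (intro WS_scale SS_0_WS) simp

end

section \<open>Leading terms of the coefficients\<close>

context osp
begin

lemma hpar_SS: "a \<le> N \<Longrightarrow> hpar (N + a + t) (SS a t)"
proof (induction "N - a" arbitrary: a t rule: less_induct)
  case less
  show ?case
  proof (cases "a = N")
    case True
    then show ?thesis unfolding True SS_N by (simp add: oneq_def hpar_def)
  next
    case False
    then have a: "a < N" using less.prems by simp
    have "hpar (N + a + t) (act (Suc a) b (SS b) t)" if b: "b \<in> {Suc a..N}" for b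
    proof -
      have S: "hpar (N + b + t) (SS b t)" for t using less.hyps[of b t] a b by auto
      have bI: "b \<in> I" "Suc a \<in> I" using b by (auto simp: I_eq)
      have "even (pp b + pp (Suc a) + 1 + (N + b + t)) = even (N + a + t)" by (auto simp: even_pp)
      then have 1: "hpar (N + a + t) (Eb b (Suc a) * SS b t)"
        using hpar_mult[OF hpar_Eb[OF bI] S[of t]] hpar_cong by blast
      have 2: "hpar (N + a + t) (DDop (SS b) t)" if "b = Suc a"
      proof -
        have "hpar (N + a + t) (DD (SS b t))" using hpar_DD[OF S[of t]] that by (simp add: hpar_def)
        moreover have "hpar (N + a + t) (sg (SS b (t - 1)))" if "t \<noteq> 0"
          using S[of "t - 1"] \<open>b = Suc a\<close> that by (auto simp: hpar_def)
        ultimately show ?thesis by (auto simp: DDop_def intro: hpar_add)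
      qed
      show ?thesis using 1 2 b by (auto simp: act_def coef_def intro!: hpar_add)
    qed
    then show ?thesis unfolding SS_rec[OF a] by (intro hpar_cn_mult hpar_sum)
  qed
qed

lemma hpar_wS: "t \<le> N \<Longrightarrow> hpar t (wS t)"
  using hpar_cn_mult[OF hpar_SS[of 0 "N - t"], of "hh 1"] unfolding wS_def by (auto simp: hpar_def split: if_splits)

text \<open>\<open>LS s\<close> collects the generators on the subdiagonals of level \<open>i - j\<close> below \<open>s\<close>.\<close>

definition LS :: "nat \<Rightarrow> sv set" where
  "LS s = {(DD ^^ m) (Fb i j) | i j m. i \<in> I \<and> j \<in> I \<and> j \<le> i \<and> i < j + s}"

lemma LS_mono: "s \<le> t \<Longrightarrow> alg (LS s) \<subseteq> alg (LS t)"
  by (rule alg_mono) (fastforce simp: LS_def)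

lemma alg_LS_DD: "a \<in> alg (LS s) \<Longrightarrow> DD a \<in> alg (LS s)" and alg_LS_sg: "a \<in> alg (LS s) \<Longrightarrow> sg a \<in> alg (LS s)"
proof -
  have D: "DD x \<in> LS s" if xs: "x \<in> LS s" for x
  proof -
    obtain i j m where x: "x = (DD ^^ m) (Fb i j)" "i \<in> I" "j \<in> I" "j \<le> i" "i < j + s"
      using xs unfolding LS_def by blast
    then have "DD x = (DD ^^ Suc m) (Fb i j)" by simp
    then show ?thesis using x unfolding LS_def by blast
  qed
  have S: "sg x \<in> alg (LS s)" if x: "x \<in> LS s" for x
    using x hpar_DD_pow[OF hpar_Fb] sg_hpar_alg alg.alg_gen[OF x] unfolding LS_def by blast
  show "a \<in> alg (LS s) \<Longrightarrow> sg a \<in> alg (LS s)" by (rule alg_sg[OF S])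
  show "a \<in> alg (LS s) \<Longrightarrow> DD a \<in> alg (LS s)"
    by (rule alg_der[OF DD_der alg.alg_gen[OF D] S])
qed

lemma Fb_LS:
  assumes "i \<in> I" "j \<in> I" "j \<le> i" "i < j + s"
  shows "Fb i j \<in> alg (LS s)"
proof -
  have "(DD ^^ 0) (Fb i j) \<in> LS s" unfolding LS_def using assms by blast
  then show ?thesis using alg.alg_gen by simp
qed

lemma Eb_LS: "i \<in> I \<Longrightarrow> j \<in> I \<Longrightarrow> j \<le> i \<Longrightarrow> i < j + s \<Longrightarrow> Eb i j \<in> alg (LS s)"
  unfolding Eb_def by (intro alg.alg_mult alg.alg_cn Fb_LS)

text \<open>Coefficients of the part of \<open>SS a\<close> that is linear in the generators of the top level \<open>u - 1\<close>.\<close>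

definition kap :: "nat \<Rightarrow> nat \<Rightarrow> nat \<Rightarrow> complex" where
  "kap a u b = (\<Prod>l\<in>{Suc a..b}. gg l) * (-1) ^ (u * (b - Suc a)) * hh (b + u - 1)"

lemma SS_top: "a \<le> N \<Longrightarrow> SS a (N - a) = cn (hh a)"
proof (induction a rule: inc_induct)
  case base
  then show ?case by (simp add: SS_N oneq_def hh_N)
next
  case (step a)
  have a: "a < N" using step by simp
  have "act (Suc a) b (SS b) (N - a) = (if b = Suc a then cn (hh (Suc a)) else 0)" if b: "b \<in> {Suc a..N}" for b
  proof -
    have "SS b (N - a) = 0" "SS (Suc a) (N - a) = 0" using a b by (auto intro!: SS_supp)
    moreover have "N - a - 1 = N - Suc a" by simp
    ultimately show ?thesis using step.IH a by (simp add: act_def DDop_def)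
  qed
  then have "SS a (N - a) = cn (gg (Suc a)) * (\<Sum>b\<in>{Suc a..N}. if b = Suc a then cn (hh (Suc a)) else 0)"
    unfolding SS_rec[OF a] by simp
  then show ?case using a by (simp add: sum.delta hh_step cn_mult)
qed

lemma kap_step:
  assumes "Suc a < b"
  shows "kap a u b = gg (Suc a) * (-1) ^ u * kap (Suc a) u b"
proof -
  have "(\<Prod>l\<in>{Suc a..b}. gg l) = gg (Suc a) * (\<Prod>l\<in>{Suc (Suc a)..b}. gg l)"
    using assms by (intro prod.atLeast_Suc_atMost) simp
  moreover have "(-1 :: complex) ^ (u * (b - Suc a)) = (-1) ^ u * (-1) ^ (u * (b - Suc (Suc a)))"
  proof -
    have "b - Suc a = Suc (b - Suc (Suc a))" using assms by simp
    then show ?thesis by (simp add: power_add)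
  qed
  ultimately show ?thesis unfolding kap_def by simp
qed

text \<open>Of the three contributions to the recursion, the derivative has lower level; the shift
  passes on the linear part of \<open>SS (Suc a)\<close> with a parity sign; and among the products
  only \<open>b = a + u\<close> reaches level \<open>u - 1\<close>, where \<open>SS b\<close> is the
  constant \<open>hh b\<close>. Smaller \<open>b\<close> give two factors of lower level, larger
  \<open>b\<close> give 0.\<close>

lemma SS_lead_step:
  assumes a: "a + u \<le> N" and u: "1 \<le> u"
    and IH: "\<And>b v. a < b \<Longrightarrow> b + v \<le> N \<Longrightarrow> SS b (N - b - v) \<in> alg (LS v)"
    and IH2: "Suc a + u \<le> N \<Longrightarrow> SS (Suc a) (N - Suc a - u) -
      (\<Sum>b\<in>{Suc (Suc a)..N + 1 - u}. cn (kap (Suc a) u b) * Eb (b + u - 1) b) \<in> alg (LS (u - 1))"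
  shows "SS a (N - a - u) - (\<Sum>b\<in>{Suc a..N + 1 - u}. cn (kap a u b) * Eb (b + u - 1) b) \<in> alg (LS (u - 1))"
proof -
  let ?t = "N - a - u" and ?g = "cn (gg (Suc a))"
  have aN: "a < N" using a u by simp
  define lin where "lin = (\<Sum>b\<in>{Suc (Suc a)..N + 1 - u}. cn (kap (Suc a) u b) * Eb (b + u - 1) b)"
  define shift where "shift = (if ?t = 0 then 0 else sg (SS (Suc a) (?t - 1)))"
  have sum_split: "(\<Sum>b\<in>{Suc a..N}. act (Suc a) b (SS b) ?t) =
    DD (SS (Suc a) ?t) + shift + (\<Sum>b\<in>{Suc a..N}. Eb b (Suc a) * SS b ?t)"
  proof -
    have "(\<Sum>b\<in>{Suc a..N}. act (Suc a) b (SS b) ?t) =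
      (\<Sum>b\<in>{Suc a..N}. (if b = Suc a then DDop (SS (Suc a)) ?t else 0) + Eb b (Suc a) * SS b ?t)"
      by (intro sum.cong refl) (auto simp: act_def coef_def)
    then show ?thesis using aN by (simp add: sum.distrib sum.delta DDop_def shift_def)
  qed
  have D: "DD (SS (Suc a) ?t) \<in> alg (LS (u - 1))"
    using IH[of "Suc a" "u - 1"] a u by (intro alg_LS_DD) simp
  have E: "(\<Sum>b\<in>{Suc a..N}. Eb b (Suc a) * SS b ?t) - cn (hh (a + u)) * Eb (a + u) (Suc a) \<in> alg (LS (u - 1))"
  proof -
    have "(\<Sum>b\<in>{Suc a..N}. Eb b (Suc a) * SS b ?t) = (\<Sum>b\<in>insert (a + u) {Suc a..<a + u}. Eb b (Suc a) * SS b ?t)"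
    proof (intro sum.mono_neutral_right ballI)
      fix b assume b: "b \<in> {Suc a..N} - insert (a + u) {Suc a..<a + u}"
      then have "SS b ?t = 0" using a by (intro SS_supp) auto
      then show "Eb b (Suc a) * SS b ?t = 0" by simp
    qed (use a u in auto)
    also have "\<dots> = Eb (a + u) (Suc a) * SS (a + u) ?t + (\<Sum>b\<in>{Suc a..<a + u}. Eb b (Suc a) * SS b ?t)"
      by simp
    also have "SS (a + u) ?t = cn (hh (a + u))" using SS_top[of "a + u"] a by simp
    finally have "(\<Sum>b\<in>{Suc a..N}. Eb b (Suc a) * SS b ?t) - cn (hh (a + u)) * Eb (a + u) (Suc a) =
       (\<Sum>b\<in>{Suc a..<a + u}. Eb b (Suc a) * SS b ?t)" by (simp add: cn_central)
    moreover have "Eb b (Suc a) * SS b ?t \<in> alg (LS (u - 1))" if b: "b \<in> {Suc a..<a + u}" for b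
    proof (rule alg.alg_mult)
      show "Eb b (Suc a) \<in> alg (LS (u - 1))" using a b by (intro Eb_LS) (auto simp: I_eq)
      have "N - b - (a + u - b) = ?t" using a b by auto
      then have "SS b ?t \<in> alg (LS (a + u - b))" using IH[of b "a + u - b"] a b by auto
      moreover have "a + u - b \<le> u - 1" using b unfolding atLeastLessThan_iff by arith
      ultimately show "SS b ?t \<in> alg (LS (u - 1))" using subsetD[OF LS_mono] by blast
    qed
    ultimately show ?thesis by (simp only: alg_sum)
  qed
  have S: "shift - cn ((-1) ^ u) * lin \<in> alg (LS (u - 1))"
  proof (cases "Suc a + u \<le> N")
    case True
    have "sg (cn (kap (Suc a) u b) * Eb (b + u - 1) b) = cn ((-1) ^ u) * (cn (kap (Suc a) u b) * Eb (b + u - 1) b)"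
      if b: "b \<in> {Suc (Suc a)..N + 1 - u}" for b
    proof -
      have I: "b + u - 1 \<in> I" "b \<in> I" using b u a by (auto simp: I_eq)
      have "even (pp (b + u - 1) + pp b + 1) = even u" using u b by (auto simp: even_pp)
      then have "hpar u (Eb (b + u - 1) b)" using hpar_Eb[OF I] hpar_cong by blast
      then show ?thesis by (auto simp: hpar_def)
    qed
    then have "sg lin = cn ((-1) ^ u) * lin" by (simp add: lin_def sg_sum sum_distrib_left)
    moreover have "shift = sg (SS (Suc a) (N - Suc a - u))" using True by (simp add: shift_def)
    moreover have "sg (SS (Suc a) (N - Suc a - u) - lin) \<in> alg (LS (u - 1))"
      using IH2[OF True] unfolding lin_def by (rule alg_LS_sg)
    ultimately show ?thesis by simp
  next
    case False
    then show ?thesis using a by (simp add: shift_def lin_def)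
  qed
  have "(\<Sum>b\<in>{Suc a..N + 1 - u}. cn (kap a u b) * Eb (b + u - 1) b) =
      cn (kap a u (Suc a)) * Eb (Suc a + u - 1) (Suc a) +
      (\<Sum>b\<in>{Suc (Suc a)..N + 1 - u}. cn (kap a u b) * Eb (b + u - 1) b)"
    using a by (intro sum.atLeast_Suc_atMost) simp
  also have "(\<Sum>b\<in>{Suc (Suc a)..N + 1 - u}. cn (kap a u b) * Eb (b + u - 1) b) = ?g * (cn ((-1) ^ u) * lin)"
    unfolding lin_def sum_distrib_left
    by (intro sum.cong refl) (simp add: kap_step cn_mult mult.assoc)
  also have "cn (kap a u (Suc a)) * Eb (Suc a + u - 1) (Suc a) = ?g * (cn (hh (a + u)) * Eb (a + u) (Suc a))"
    by (simp add: kap_def cn_mult mult.assoc)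
  finally have lin_a: "(\<Sum>b\<in>{Suc a..N + 1 - u}. cn (kap a u b) * Eb (b + u - 1) b) =
      ?g * (cn (hh (a + u)) * Eb (a + u) (Suc a)) + ?g * (cn ((-1) ^ u) * lin)" .
  have "SS a ?t - (\<Sum>b\<in>{Suc a..N + 1 - u}. cn (kap a u b) * Eb (b + u - 1) b) =
    ?g * (DD (SS (Suc a) ?t) + (shift - cn ((-1) ^ u) * lin) +
     ((\<Sum>b\<in>{Suc a..N}. Eb b (Suc a) * SS b ?t) - cn (hh (a + u)) * Eb (a + u) (Suc a)))"
    unfolding SS_rec[OF aN] sum_split lin_a by (simp add: algebra_simps)
  then show ?thesis using D E S by (auto intro!: alg.alg_mult alg.alg_cn alg.alg_add)
qed

lemma SS_lead:
  assumes "a \<le> N"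
  shows "(\<forall>u. a + u \<le> N \<longrightarrow> SS a (N - a - u) \<in> alg (LS u)) \<and>
    (\<forall>u. 1 \<le> u \<longrightarrow> a + u \<le> N \<longrightarrow> SS a (N - a - u) -
      (\<Sum>b\<in>{Suc a..N + 1 - u}. cn (kap a u b) * Eb (b + u - 1) b) \<in> alg (LS (u - 1)))"
  using assms
proof (induction "N - a" arbitrary: a rule: less_induct)
  case less
  have IH: "SS b (N - b - v) \<in> alg (LS v)" if "a < b" "b + v \<le> N" for b v
    using less.hyps[of b] that by auto
  have IH2: "SS (Suc a) (N - Suc a - u) -
      (\<Sum>b\<in>{Suc (Suc a)..N + 1 - u}. cn (kap (Suc a) u b) * Eb (b + u - 1) b) \<in> alg (LS (u - 1))"
    if "1 \<le> u" "Suc a + u \<le> N" for u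
    using less.hyps[of "Suc a"] that by auto
  have 1: "SS a (N - a - u) - (\<Sum>b\<in>{Suc a..N + 1 - u}. cn (kap a u b) * Eb (b + u - 1) b) \<in> alg (LS (u - 1))"
    if "1 \<le> u" "a + u \<le> N" for u
    using SS_lead_step[OF that(2,1) IH IH2[OF that(1)]] .
  have "SS a (N - a - u) \<in> alg (LS u)" if u: "a + u \<le> N" for u
  proof (cases "u = 0")
    case True
    then show ?thesis using SS_top[of a] less.prems by (simp add: alg.alg_cn)
  next
    case False
    let ?lin = "\<Sum>b\<in>{Suc a..N + 1 - u}. cn (kap a u b) * Eb (b + u - 1) b"
    have "?lin \<in> alg (LS u)"
      using False u by (intro alg_sum alg.alg_mult alg.alg_cn Eb_LS) (auto simp: I_eq)
    moreover have "SS a (N - a - u) - ?lin \<in> alg (LS u)"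
      using 1[of u] False u LS_mono[of "u - 1" u] by auto
    ultimately have "(SS a (N - a - u) - ?lin) + ?lin \<in> alg (LS u)" by (intro alg.alg_add)
    then show ?thesis by simp
  qed
  then show ?case using 1 by blast
qed

text \<open>The factors come from passing between \<open>wS\<close> and \<open>SS\<close>, from the
  leading part of \<open>SS\<close>, and from writing \<open>Eb\<close> through
  \<open>Fb\<close>.\<close>

definition KK :: "nat \<Rightarrow> nat \<Rightarrow> complex" where
  "KK s b = hh 1 * kap 0 (Suc s) b * (1/2 * (-1) ^ pp (b + s))"

lemma gg_prod_nz: "(\<Prod>l\<in>A. gg l) \<noteq> 0"
  by (cases "finite A") (auto simp: gg_def)

lemma KK_nz: "KK s b \<noteq> 0"
  using gg_prod_nz by (simp add: KK_def kap_def hh_def)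

lemma wS_lead:
  assumes "s < N"
  shows "wS (Suc s) - (\<Sum>b\<in>{1..N - s}. cn (KK s b) * Fb (b + s) b) \<in> alg (LS s)"
proof -
  have "SS 0 (N - 0 - Suc s) - (\<Sum>b\<in>{Suc 0..N + 1 - Suc s}. cn (kap 0 (Suc s) b) * Eb (b + Suc s - 1) b) \<in> alg (LS (Suc s - 1))"
    by (rule SS_lead[of 0, THEN conjunct2, rule_format]) (use assms in auto)
  then have "cn (hh 1) * (SS 0 (N - Suc s) - (\<Sum>b\<in>{1..N - s}. cn (kap 0 (Suc s) b) * Eb (b + s) b)) \<in> alg (LS s)"
    by (intro alg.alg_mult alg.alg_cn) simp
  moreover have "cn (hh 1) * (SS 0 (N - Suc s) - (\<Sum>b\<in>{1..N - s}. cn (kap 0 (Suc s) b) * Eb (b + s) b)) =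
      wS (Suc s) - (\<Sum>b\<in>{1..N - s}. cn (KK s b) * Fb (b + s) b)"
  proof -
    have "cn (hh 1) * (cn (kap 0 (Suc s) b) * Eb (b + s) b) = cn (KK s b) * Fb (b + s) b" for b
      unfolding KK_def Eb_def by (simp only: cn_mult mult.assoc)
    then show ?thesis unfolding wS_def by (simp only: right_diff_distrib sum_distrib_left)
  qed
  ultimately show ?thesis by simp
qed

text \<open>\<open>dd s\<close> is the number of independent \<open>F\<^sub>i\<^sub>j\<close> on the subdiagonal \<open>i - j = s\<close>: reflection in the
 antidiagonal identifies them in pairs, and the fixed one survives iff \<open>s \<equiv> 2 (mod 4)\<close>.\<close>

definition dd :: "nat \<Rightarrow> nat" where
  "dd s = (N - s + (if s mod 4 = 2 then 1 else 0)) div 2"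

text \<open>A normal form for levels that turns questions about \<open>div\<close> and
  \<open>mod\<close> into linear arithmetic; \<open>m\<close> is \<open>n - k\<close>.\<close>

lemma level_ex:
  assumes "s \<le> N"
  shows "\<exists>k m r. s = 4 * k + r \<and> r < 4 \<and> N = 4 * k + 4 * m + 1 \<and> s mod 4 = r \<and>
    (1 < r \<longrightarrow> 1 \<le> m) \<and> dd s = 2 * m - (if r = 3 then 1 else 0)"
proof -
  define k where "k = s div 4"
  define r where "r = s mod 4"
  have s: "s = 4 * k + r" "r < 4" by (simp_all add: k_def r_def)
  have "k \<le> n" using assms s by (simp add: N_def)
  then obtain m where "n = k + m" using le_Suc_ex by blast
  then have "4 * n + 1 = 4 * k + 4 * m + 1" by simp
  then have N: "N = 4 * k + 4 * m + 1" by (simp only: N_def)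
  have r1: "1 < r \<Longrightarrow> 1 \<le> m" using assms s N by (cases m) auto
  have d: "dd s = (4 * m + 1 - r + (if r = 2 then 1 else 0)) div 2"
    unfolding dd_def r_def[symmetric] using s(1) N by simp
  have "r = 0 \<or> r = 1 \<or> (\<exists>l. m = Suc l) \<and> (r = 2 \<or> r = 3)"
  proof (cases "1 < r")
    case True
    then have "\<exists>l. m = Suc l" using r1 by (cases m) auto
    moreover have "r = 2 \<or> r = 3" using True s(2) by linarith
    ultimately show ?thesis by blast
  next
    case False
    then show ?thesis by linarith
  qed
  then have "dd s = 2 * m - (if r = 3 then 1 else 0)"
    unfolding d by (elim disjE conjE exE) simp_all
  then show ?thesis using s N r_def[symmetric] r1 by blast
qed

text \<open>The count behind the theorem: elements of n of level \<open>Suc s\<close> can eliminate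
  \<open>dd (Suc s)\<close> of the \<open>dd s\<close> generators of level \<open>s\<close>, so one
  is left over exactly at the levels 2 and 3 modulo 4. With \<open>t = Suc s\<close> these are the
  indices 3 and 0.\<close>

lemma dd_step:
  assumes "s < N"
  shows "dd s = dd (Suc s) + (if s mod 4 = 2 \<or> s mod 4 = 3 then 1 else 0)"
proof -
  obtain k m r where s: "s = 4 * k + r" "r < 4" "N = 4 * k + 4 * m + 1" "s mod 4 = r"
    "1 < r \<longrightarrow> 1 \<le> m" "dd s = 2 * m - (if r = 3 then 1 else 0)"
    using level_ex[OF less_imp_le[OF assms]] by blast
  obtain k' m' r' where s': "Suc s = 4 * k' + r'" "r' < 4" "N = 4 * k' + 4 * m' + 1" "Suc s mod 4 = r'"
    "1 < r' \<longrightarrow> 1 \<le> m'" "dd (Suc s) = 2 * m' - (if r' = 3 then 1 else 0)"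
    using level_ex[OF Suc_leI[OF assms]] by blast
  show ?thesis
  proof (cases "r = 3")
    case True
    have "k' = k + 1" "r' = 0" using s(1) s'(1,2) True by presburger+
    moreover have "m = Suc m'" using calculation s(3) s'(3) by simp
    ultimately show ?thesis unfolding s(4,6) s'(6) using True by simp
  next
    case False
    have kr: "k' = k" "r' = r + 1" using s(1,2) s'(1,2) False by presburger+
    then have m: "m' = m" using s(3) s'(3) by simp
    have "r = 2 \<Longrightarrow> 1 \<le> m" using s(5) by simp
    then show ?thesis unfolding s(4,6) s'(6) using False kr m by auto
  qed
qed

lemma dd_bound: "s \<le> N \<Longrightarrow> 2 * dd s \<le> N + 1 - s"
  unfolding dd_def by auto

text \<open>Equality means that the generator fixed by the reflection is itself counted, which
  requires it to be nonzero.\<close>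

lemma dd_even:
  assumes "s \<le> N" "2 * dd s = N + 1 - s"
  shows "s mod 4 = 2 \<and> s < N"
proof -
  obtain k m r where s: "s = 4 * k + r" "r < 4" "N = 4 * k + 4 * m + 1" "s mod 4 = r"
    "1 < r \<longrightarrow> 1 \<le> m" "dd s = 2 * m - (if r = 3 then 1 else 0)"
    using level_ex[OF assms(1)] by blast
  have e: "N + 1 - s = 4 * m + 2 - r" using s(1,3) by simp
  have "r = 2"
  proof (rule ccontr)
    assume "r \<noteq> 2"
    then consider "r = 0" | "r = 1" | "r = 3" using s(2) by linarith
    then show False using assms(2) s(5) unfolding e s(6) by cases auto
  qed
  then show ?thesis using s(1,3,4,5) by simp
qed

text \<open>Representatives of level \<open>i - j\<close>: those of type V, one for each level \<open>\<equiv> 2, 3 (mod 4)\<close>, are traded for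
 the determinant coefficients; those of type U are kept.\<close>

definition isU :: "nat \<Rightarrow> nat \<Rightarrow> bool" where
  "isU i j \<longleftrightarrow> j \<le> i \<and> i \<le> N \<and> 1 \<le> j \<and> j \<le> dd (Suc (i - j))"

definition isV :: "nat \<Rightarrow> nat \<Rightarrow> bool" where
  "isV i j \<longleftrightarrow> j \<le> i \<and> i \<le> N \<and> 1 \<le> j \<and> j = dd (i - j) \<and> ((i - j) mod 4 = 2 \<or> (i - j) mod 4 = 3)"

lemma isUV_dd:
  assumes "isU i j \<or> isV i j"
  shows "1 \<le> j" "j \<le> i" "i \<le> N" "i - j < N" "j \<le> dd (i - j)" "i \<in> I" "j \<in> I"
proof -
  show 1: "1 \<le> j" "j \<le> i" "i \<le> N" using assms by (auto simp: isU_def isV_def)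
  show "i - j < N" using 1 by auto
  then show "j \<le> dd (i - j)" using assms dd_step[of "i - j"] by (auto simp: isU_def isV_def)
  show "i \<in> I" "j \<in> I" using 1 by (auto simp: I_eq)
qed

lemma not_isU_isV: "isU i j \<Longrightarrow> \<not> isV i j"
  using isUV_dd(4)[of i j] dd_step[of "i - j"] by (auto simp: isU_def isV_def)

lemma rep_cases:
  assumes "1 \<le> b" "b \<le> dd s" "s < N"
  shows "isU (b + s) b \<or> isV (b + s) b"
  using assms dd_step[of s] dd_bound[of s] by (auto simp: isU_def isV_def split: if_splits)

lemma pr_eq: "pr i = N + 1 - i"
  by (simp add: primeI_def N_def)

text \<open>Representatives occupy the first \<open>dd\<close> columns of their level, at most half
  of them, and the reflection reverses the columns. So two representatives are reflections of each
  other only on the antidiagonal.\<close>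

lemma rep_swap:
  assumes "isU i j \<or> isV i j" "isU (pr j) (pr i) \<or> isV (pr j) (pr i)"
  shows "i + j = N + 1"
proof -
  have "pr j - pr i = i - j" using isUV_dd(1-3)[OF assms(1)] by (simp add: pr_eq)
  then have "pr i \<le> dd (i - j)" using isUV_dd(5)[OF assms(2)] by simp
  moreover have "j \<le> dd (i - j)" using isUV_dd(5)[OF assms(1)] by simp
  moreover have "2 * dd (i - j) \<le> N + 1 - (i - j)" using isUV_dd(4)[OF assms(1)] by (intro dd_bound) simp
  ultimately show ?thesis using isUV_dd(1-3)[OF assms(1)] dd_even[of "i - j"] by (auto simp: pr_eq)
qed

lemma th_mid:
  assumes "i \<in> I" "i + j = N + 1"
  shows "th i j = (-1) ^ (1 + pp i)"
proof -
  have p: "pr i = j" using assms by (auto simp: pr_eq)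
  show ?thesis
    unfolding thsign_def p[symmetric] using assms(1) even_dl_pr[of i]
    by (intro neg_one_power_cong) (auto simp: even_pp)
qed

lemma Fb_mid:
  assumes "i \<in> I" "j \<in> I" "i + j = N + 1"
  shows "Fb i j = (if even i then cn 2 * gn (i, j, 0) else 0)"
proof -
  have p: "pr j = i" "pr i = j" using assms by (auto simp: pr_eq)
  moreover have "cn 2 = 1 + 1" using cn_simps(3)[of 1 1] by simp
  ultimately show ?thesis
    unfolding Fb_eq p th_mid[OF assms(1,3)] by (simp add: pp_def distrib_right mult_2)
qed

lemma rep_mid_even:
  assumes "isU i j \<or> isV i j" "i + j = N + 1"
  shows "even i"
proof -
  have "2 * dd (i - j) = N + 1 - (i - j)"
    using isUV_dd[OF assms(1)] assms(2) dd_bound[of "i - j"] by auto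
  then have "(i - j) mod 4 = 2" using dd_even[of "i - j"] isUV_dd(4)[OF assms(1)] by simp
  then obtain k where "i - j = 4 * k + 2" by (metis mult_div_mod_eq)
  then have "j + 2 * k = 2 * n" "i = j + 4 * k + 2" using assms(2) isUV_dd(2)[OF assms(1)] by (auto simp: N_def)
  then show ?thesis by presburger
qed

text \<open>The reflection exchanges the columns \<open>b\<close> and \<open>N + 1 - s - b\<close>.
  The only column missed by both halves is the middle one at a level divisible by 4, and there
  \<open>Fb\<close> is zero.\<close>

lemma Fb_cases:
  assumes "1 \<le> b" "b \<le> N - s" "s < N"
  shows "Fb (b + s) b = 0 \<or> b \<le> dd s \<or> (N + 1 - s - b \<le> dd s \<and> 1 \<le> N + 1 - s - b)"
proof (cases "b + s + b = N + 1 \<and> odd (b + s)")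
  case True
  then have "Fb (b + s) b = 0" using assms by (subst Fb_mid) (auto simp: I_eq)
  then show ?thesis by simp
next
  case False
  obtain k m r where s: "s = 4 * k + r" "r < 4" "N = 4 * k + 4 * m + 1" "s mod 4 = r"
    "1 < r \<longrightarrow> 1 \<le> m" "dd s = 2 * m - (if r = 3 then 1 else 0)"
    using level_ex[OF less_imp_le[OF assms(3)]] by blast
  have "b \<le> dd s \<or> N + 1 - s - b \<le> dd s"
  proof (rule ccontr)
    assume "\<not> ?thesis"
    then have c: "dd s < b" "dd s < N + 1 - s - b" by auto
    consider "r = 0" | "r = 1" | "r = 2" | "r = 3" using s(2) by linarith
    then show False
    proof cases
      case 1
      then have "b = 2 * m + 1" using c s by auto
      then show False using False 1 s by auto
    qed (use c s in auto)
  qed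
  then show ?thesis using assms by auto
qed

definition US :: "nat \<Rightarrow> sv set" where
  "US s = {(DD ^^ m) (Fb i j) | i j m. i \<in> I \<and> j \<in> I \<and> j \<le> i \<and> (i < j + s \<or> (i = j + s \<and> isU i j))}"

lemma LS_US: "alg (LS s) \<subseteq> alg (US s)"
  by (rule alg_mono) (auto simp: LS_def US_def)

lemma Fb_US:
  assumes "isU i j" "i = j + s"
  shows "Fb i j \<in> alg (US s)"
proof -
  have "i \<in> I" "j \<in> I" "j \<le> i" using isUV_dd[of i j] assms by auto
  then have "(DD ^^ 0) (Fb i j) \<in> US s" unfolding US_def using assms by blast
  then show ?thesis using alg.alg_gen by simp
qed

text \<open>The coefficient of the type V generator must not cancel. At levels 2 mod 4 this
  generator is its own reflection and occurs once. At levels 3 mod 4 it is the reflection of its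
  neighbour in column \<open>Suc ?v\<close>; the signs make the two coefficients equal, so they add
  up to \<open>2 * KK\<close>.\<close>

lemma wS_decomp:
  assumes s: "s mod 4 = 2 \<or> s mod 4 = 3" "s < N"
  shows "\<exists>C. C \<noteq> 0 \<and> wS (Suc s) - cn C * Fb (dd s + s) (dd s) \<in> alg (US s)"
proof -
  let ?v = "dd s" and ?st = "\<lambda>b. N + 1 - s - b"
  obtain k m r where lv: "s = 4 * k + r" "r < 4" "N = 4 * k + 4 * m + 1" "s mod 4 = r"
    "1 < r \<longrightarrow> 1 \<le> m" "dd s = 2 * m - (if r = 3 then 1 else 0)"
    using level_ex[OF less_imp_le[OF s(2)]] by blast
  have v: "1 \<le> ?v" "?v + s \<le> N" "?v \<le> N - s" using lv s by auto
  have other: "Fb (b + s) b \<in> alg (US s)" if b: "b \<in> {1..N - s}" "b \<noteq> ?v" "b \<noteq> ?st ?v" for b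
  proof -
    have U: "Fb (c + s) c \<in> alg (US s)" if "1 \<le> c" "c \<le> dd s" "c \<noteq> ?v" for c
      using rep_cases[OF that(1,2) s(2)] that by (intro Fb_US) (auto simp: isV_def)
    have "Fb (b + s) b \<in> alg (US s)" if st: "?st b \<le> dd s" "1 \<le> ?st b"
    proof -
      have I: "b + s \<in> I" "b \<in> I" using b by (auto simp: I_eq)
      have "pr b = ?st b + s" "pr (b + s) = ?st b" using b by (auto simp: pr_eq)
      moreover have "?st b \<noteq> ?v" using b v by auto
      ultimately show ?thesis unfolding Fb_swap[OF I] using U[OF st(2,1)] by (auto intro: alg.alg_mult alg.alg_cn)
    qed
    then show ?thesis using Fb_cases[of b s] b s(2) U[of b] by auto
  qed
  let ?L = "\<Sum>b\<in>{1..N - s}. cn (KK s b) * Fb (b + s) b"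
  have "\<exists>C. C \<noteq> 0 \<and> ?L - cn C * Fb (?v + s) ?v \<in> alg (US s)"
  proof (cases "s mod 4 = 2")
    case True
    then have st: "?st ?v = ?v" using lv by auto
    have "?L = cn (KK s ?v) * Fb (?v + s) ?v + (\<Sum>b\<in>{1..N - s} - {?v}. cn (KK s b) * Fb (b + s) b)"
      using v by (intro sum.remove) auto
    moreover have "(\<Sum>b\<in>{1..N - s} - {?v}. cn (KK s b) * Fb (b + s) b) \<in> alg (US s)"
      using other st by (intro alg_sum alg.alg_mult alg.alg_cn) auto
    ultimately show ?thesis using KK_nz by (intro exI[of _ "KK s ?v"]) simp
  next
    case False
    then have s3: "s mod 4 = 3" using s(1) by blast
    have st: "?st ?v = Suc ?v" "Suc ?v + s \<le> N" "odd ?v" using lv s3 by auto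
    have I: "Suc ?v + s \<in> I" "Suc ?v \<in> I" using st v by (auto simp: I_eq)
    have pr: "pr (Suc ?v) = ?v + s" "pr (Suc ?v + s) = ?v" using st(1,2) v by (auto simp: pr_eq)
    have os: "odd s" using s3 by presburger
    let ?A = "{1..N - s} - {?v} - {Suc ?v}"
    have "?L = cn (KK s ?v) * Fb (?v + s) ?v + (\<Sum>b\<in>{1..N - s} - {?v}. cn (KK s b) * Fb (b + s) b)"
      using v by (intro sum.remove) auto
    also have "(\<Sum>b\<in>{1..N - s} - {?v}. cn (KK s b) * Fb (b + s) b) =
        cn (KK s (Suc ?v)) * Fb (Suc ?v + s) (Suc ?v) + (\<Sum>b\<in>?A. cn (KK s b) * Fb (b + s) b)"
      using st by (intro sum.remove) auto
    also have "Fb (Suc ?v + s) (Suc ?v) = cn (th (Suc ?v + s) (Suc ?v)) * Fb (?v + s) ?v"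
      using Fb_swap[OF I] pr by simp
    \<comment> \<open>The signs \<open>gg\<close>, the change of \<open>(-1) ^ pp\<close> and the
      sign of \<theta> multiply to 1; the Koszul sign in \<open>kap\<close> does not change since
      \<open>Suc s\<close> is even.\<close>
    also have "cn (KK s (Suc ?v)) * (cn (th (Suc ?v + s) (Suc ?v)) * Fb (?v + s) ?v) = cn (KK s ?v) * Fb (?v + s) ?v"
    proof -
      have k: "kap 0 (Suc s) (Suc ?v) = gg (Suc ?v) * gg (Suc (?v + s)) * kap 0 (Suc s) ?v"
      proof -
        have "hh (?v + s) = gg (Suc (?v + s)) * hh (Suc (?v + s))" using st(2) by (intro hh_step) simp
        then have "hh (Suc (?v + s)) = gg (Suc (?v + s)) * hh (?v + s)" by simp
        moreover have "(\<Prod>l\<in>{Suc 0..Suc ?v}. gg l) = (\<Prod>l\<in>{Suc 0..?v}. gg l) * gg (Suc ?v)"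
          by (subst prod.nat_ivl_Suc') (auto simp: mult.commute)
        moreover have "(-1 :: complex) ^ (Suc s * (Suc ?v - Suc 0)) = (-1) ^ (Suc s * (?v - Suc 0))"
          using os by (intro neg_one_power_cong) auto
        ultimately show ?thesis unfolding kap_def by simp
      qed
      have "gg (Suc ?v) * gg (Suc (?v + s)) * (-1) ^ pp (Suc ?v + s) * th (Suc ?v + s) (Suc ?v) = (-1) ^ pp (?v + s)"
      proof -
        have "even (\<delta> (pr (Suc ?v))) \<longleftrightarrow> (even (\<delta> (Suc ?v)) \<longleftrightarrow> odd (Suc ?v))" by (rule even_dl_pr[OF I(2)])
        moreover have "\<delta> ?v = 0" "\<delta> (Suc ?v + s) = 0" using st(3) os by (auto simp: dl_def)
        ultimately show ?thesis
          unfolding gg_def thsign_def power_add[symmetric] pr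
          using st(3) os by (intro neg_one_power_cong) (auto simp: even_pp)
      qed
      then have "KK s (Suc ?v) * th (Suc ?v + s) (Suc ?v) = KK s ?v"
        unfolding KK_def k by (simp add: mult_ac)
      then show ?thesis by (simp only: mult.assoc[symmetric] cn_mult[symmetric])
    qed
    finally have "?L - cn (2 * KK s ?v) * Fb (?v + s) ?v = (\<Sum>b\<in>?A. cn (KK s b) * Fb (b + s) b)"
      by (simp only: mult_2 cn_simps distrib_right) simp
    moreover have "(\<Sum>b\<in>?A. cn (KK s b) * Fb (b + s) b) \<in> alg (US s)"
      using other st by (intro alg_sum alg.alg_mult alg.alg_cn) auto
    ultimately show ?thesis using KK_nz by (intro exI[of _ "2 * KK s ?v"]) simp
  qed
  then obtain C where C: "C \<noteq> 0" "?L - cn C * Fb (?v + s) ?v \<in> alg (US s)" by blast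
  have "(wS (Suc s) - ?L) + (?L - cn C * Fb (?v + s) ?v) \<in> alg (US s)"
    using wS_lead[OF s(2)] LS_US C(2) by (intro alg.alg_add) auto
  then show ?thesis using C(1) by (intro exI[of _ C]) simp
qed

end

section \<open>Change of generators\<close>

context osp
begin

definition CC :: "nat \<Rightarrow> complex" where
  "CC s = (SOME C. C \<noteq> 0 \<and> wS (Suc s) - cn C * Fb (dd s + s) (dd s) \<in> alg (US s))"

lemma CC_spec:
  assumes "s mod 4 = 2 \<or> s mod 4 = 3" "s < N"
  shows "CC s \<noteq> 0" "wS (Suc s) - cn (CC s) * Fb (dd s + s) (dd s) \<in> alg (US s)"
  using someI_ex[OF wS_decomp[OF assms]] unfolding CC_def by blast+

lemma isV_level:
  assumes "isV i j"
  shows "i = dd (i - j) + (i - j)" "j = dd (i - j)" "(i - j) mod 4 = 2 \<or> (i - j) mod 4 = 3" "i - j < N"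
  using assms isUV_dd(4)[of i j] by (auto simp: isV_def)

lemma V_decomp:
  assumes "isV i j"
  shows "CC (i - j) \<noteq> 0" "wS (Suc (i - j)) - cn (CC (i - j)) * Fb i j \<in> alg (US (i - j))"
proof -
  show "CC (i - j) \<noteq> 0" by (rule CC_spec[OF isV_level(3,4)[OF assms]])
  have "wS (Suc (i - j)) - cn (CC (i - j)) * Fb (dd (i - j) + (i - j)) (dd (i - j)) \<in> alg (US (i - j))"
    by (rule CC_spec[OF isV_level(3,4)[OF assms]])
  then show "wS (Suc (i - j)) - cn (CC (i - j)) * Fb i j \<in> alg (US (i - j))"
    using isV_level(1,2)[OF assms] by metis
qed

lemma isV_dd:
  assumes "s mod 4 = 2 \<or> s mod 4 = 3" "s < N"
  shows "isV (dd s + s) (dd s)"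
proof -
  obtain k m r where "s = 4 * k + r" "r < 4" "N = 4 * k + 4 * m + 1" "s mod 4 = r"
    "1 < r \<longrightarrow> 1 \<le> m" "dd s = 2 * m - (if r = 3 then 1 else 0)"
    using level_ex[OF less_imp_le[OF assms(2)]] by blast
  then show ?thesis using assms unfolding isV_def by auto
qed

lemma US_LS:
  assumes "t < s"
  shows "US t \<subseteq> LS s"
proof
  fix x assume "x \<in> US t"
  then obtain i j m where x: "x = (DD ^^ m) (Fb i j)" "i \<in> I" "j \<in> I" "j \<le> i" "i < j + t \<or> (i = j + t \<and> isU i j)"
    unfolding US_def by blast
  then have "i < j + s" using assms by auto
  then show "x \<in> LS s" unfolding LS_def using x by blast
qed

definition dhom :: "(sv \<Rightarrow> sv) \<Rightarrow> bool" where
  "dhom T \<longleftrightarrow> is_hom T \<and> (\<forall>a. T (DD a) = DD (T a))"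

lemma dhom_hom: "dhom T \<Longrightarrow> is_hom T" and dhom_DD: "dhom T \<Longrightarrow> T (DD a) = DD (T a)"
  by (auto simp: dhom_def)

lemma dhom_DD_pow: "dhom T \<Longrightarrow> T ((DD ^^ m) a) = (DD ^^ m) (T a)"
  by (induction m) (auto simp: dhom_DD)

lemma dhom_Fb: "dhom T \<Longrightarrow> T (Fb i j) = T (gn (i, j, 0)) + cn (th i j) * T (gn (pr j, pr i, 0))"
  by (simp only: Fb_eq is_homD[OF dhom_hom])

text \<open>The reflection of a representative is no representative, so its half is sent to 0; on
  the antidiagonal both halves coincide, whence the 2.\<close>

lemma dhom_Fb_rep:
  assumes T: "dhom T" and z: "\<And>i j. \<not> isU i j \<Longrightarrow> \<not> isV i j \<Longrightarrow> T (gn (i, j, 0)) = 0"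
    and ij: "isU i j \<or> isV i j"
  shows "T (Fb i j) = cn (if i + j = N + 1 then 2 else 1) * T (gn (i, j, 0))"
proof (cases "i + j = N + 1")
  case True
  have "Fb i j = cn 2 * gn (i, j, 0)"
    using Fb_mid[OF isUV_dd(6,7)[OF ij] True] rep_mid_even[OF ij True] by simp
  then show ?thesis using True by (simp add: is_homD(2,3)[OF dhom_hom[OF T]])
next
  case False
  then have "T (gn (pr j, pr i, 0)) = 0" using z rep_swap[OF ij] by blast
  then show ?thesis using False by (simp add: dhom_Fb[OF T])
qed

text \<open>The images of the type V generators are found level by level. The invariant of the
  current level is a nonzero multiple of one V generator plus \<open>q\<close>, and
  \<open>T q\<close> is already final; so the required value is a linear equation for one free
  image. Changing that image leaves the generators in \<open>US s\<close> alone.\<close>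

lemma ex_Theta:
  assumes "s \<le> N"
  shows "\<exists>T. dhom T \<and> (\<forall>i j. \<not> isU i j \<longrightarrow> \<not> isV i j \<longrightarrow> T (gn (i, j, 0)) = 0) \<and>
    (\<forall>i j. isU i j \<longrightarrow> T (Fb i j) = gn (i, j, 0)) \<and>
    (\<forall>i j. isV i j \<longrightarrow> i - j < s \<longrightarrow> T (wS (Suc (i - j))) = gn (i, j, 0))"
  using assms
proof (induction s)
  case 0
  \<comment> \<open>On the antidiagonal \<open>Fb i j\<close> is twice the generator; the 1/2
    compensates for this. All type V labels start at 0.\<close>
  let ?f = "\<lambda>i j. if isU i j then cn (if i + j = N + 1 then 1/2 else 1) * gn (i, j, 0) else 0"
  have "hpar (genpar (i, j, 0)) (?f i j)" for i j
    by (auto intro: hpar_cn_mult hpar_gn)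
  from ex_dhom[OF this] obtain T where T: "dhom T" "\<And>i j. T (gn (i, j, 0)) = ?f i j"
    unfolding dhom_def by blast
  have "T (Fb i j) = gn (i, j, 0)" if "isU i j" for i j
  proof -
    have "T (Fb i j) = cn (if i + j = N + 1 then 2 else 1) * T (gn (i, j, 0))"
      using T that by (intro dhom_Fb_rep) auto
    then show ?thesis using that T(2)[of i j] by (simp add: mult.assoc[symmetric] cn_mult[symmetric])
  qed
  then show ?case using T by (intro exI[of _ T]) auto
next
  case (Suc s)
  then obtain T where T: "dhom T" "\<And>i j. \<not> isU i j \<Longrightarrow> \<not> isV i j \<Longrightarrow> T (gn (i, j, 0)) = 0"
    "\<And>i j. isU i j \<Longrightarrow> T (Fb i j) = gn (i, j, 0)"
    "\<And>i j. isV i j \<Longrightarrow> i - j < s \<Longrightarrow> T (wS (Suc (i - j))) = gn (i, j, 0)"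
    by auto
  note H = is_homD[OF dhom_hom[OF T(1)]]
  show ?case
  proof (cases "s mod 4 = 2 \<or> s mod 4 = 3")
    case False
    then have "i - j < s" if "isV i j" "i - j < Suc s" for i j
      using isV_level(3)[OF that(1)] that(2) by (cases "i - j = s") auto
    then show ?thesis using T by (intro exI[of _ T]) blast
  next
    case True
    have sN: "s < N" using Suc.prems by simp
    let ?v = "dd s"
    define i0 where "i0 = ?v + s"
    have V: "isV i0 ?v" unfolding i0_def by (rule isV_dd[OF True sN])
    have lev: "i0 - ?v = s" by (simp add: i0_def)
    define q where "q = wS (Suc s) - cn (CC s) * Fb i0 ?v"
    have C: "CC s \<noteq> 0" and q: "q \<in> alg (US s)"
      unfolding q_def i0_def by (rule CC_spec[OF True sN])+
    let ?mid = "if i0 + ?v = N + 1 then 2 else 1 :: complex"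
    \<comment> \<open>The value at \<open>(i0, ?v)\<close> solves
      \<open>CC s * ?mid * x + T q = gn (i0, ?v, 0)\<close> for \<open>x\<close>.\<close>
    let ?f = "\<lambda>i j. if i = i0 \<and> j = ?v then cn (1 / (CC s * ?mid)) * (gn (i, j, 0) - T q) else T (gn (i, j, 0))"
    have "hpar (genpar (i, j, 0)) (?f i j)" for i j
    proof -
      have "hpar (genpar (i0, ?v, 0)) q"
      proof -
        have "even (pp i0 + pp ?v + 1) = even (Suc s)" by (auto simp: even_pp i0_def)
        then have "hpar (genpar (i0, ?v, 0)) (wS (Suc s))"
          using hpar_wS[of "Suc s"] sN by (simp add: hpar_def genpar_simp mod_2_eq_odd)
        then show ?thesis unfolding q_def using isUV_dd(6,7)[of i0 ?v] V
          by (intro hpar_diff hpar_cn_mult hpar_Fb) auto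
      qed
      then have "hpar (genpar (i0, ?v, 0)) (T q)" by (rule is_hom_hpar[OF dhom_hom[OF T(1)]])
      then show ?thesis using is_hom_hpar[OF dhom_hom[OF T(1)] hpar_gn]
        by (auto intro!: hpar_cn_mult hpar_diff hpar_gn)
    qed
    from ex_dhom[OF this] obtain T' where T': "dhom T'" "\<And>i j. T' (gn (i, j, 0)) = ?f i j"
      unfolding dhom_def by blast
    have zero: "T' (gn (i, j, 0)) = 0" if "\<not> isU i j" "\<not> isV i j" for i j
      using that T(2) T'(2) V by auto
    have eqF: "T' (Fb i j) = T (Fb i j)" if "\<not> (i = i0 \<and> j = ?v)" "\<not> (pr j = i0 \<and> pr i = ?v)" for i j
    proof -
      have "T' (gn (i, j, 0)) = T (gn (i, j, 0))" "T' (gn (pr j, pr i, 0)) = T (gn (pr j, pr i, 0))"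
        by (rule trans[OF T'(2) if_not_P[OF that(1)]], rule trans[OF T'(2) if_not_P[OF that(2)]])
      then show ?thesis by (simp only: dhom_Fb[OF T(1)] dhom_Fb[OF T'(1)])
    qed
    have U: "T' (Fb i j) = T (Fb i j)" if ij: "isU i j" for i j
    proof (rule eqF)
      show 1: "\<not> (i = i0 \<and> j = ?v)" using V not_isU_isV[OF ij] by auto
      show "\<not> (pr j = i0 \<and> pr i = ?v)"
      proof
        assume *: "pr j = i0 \<and> pr i = ?v"
        then have "isV (pr j) (pr i)" using V by simp
        then have "i + j = N + 1" using rep_swap[of i j] ij by blast
        then have "pr j = i" "pr i = j" by (auto simp: pr_eq)
        then show False using 1 * by simp
      qed
    qed
    have low: "T' (Fb i j) = T (Fb i j)" if "i \<in> I" "j \<in> I" "j \<le> i" "i < j + s" for i j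
      using that lev by (intro eqF) (auto simp: pr_eq I_eq)
    have US: "T' a = T a" if a: "a \<in> alg (US s)" for a
    proof (rule alg_hom_eq[OF dhom_hom[OF T'(1)] dhom_hom[OF T(1)] _ a])
      fix x assume "x \<in> US s"
      then obtain i j m where x: "x = (DD ^^ m) (Fb i j)" "i \<in> I" "j \<in> I" "j \<le> i"
        "i < j + s \<or> (i = j + s \<and> isU i j)" unfolding US_def by blast
      then have "T' (Fb i j) = T (Fb i j)" using U low by blast
      then show "T' x = T x" unfolding x(1) by (simp add: dhom_DD_pow T(1) T'(1))
    qed
    have Vlow: "T' (wS (Suc (i - j))) = gn (i, j, 0)" if ij: "isV i j" "i - j < s" for i j
    proof -
      have "alg (US (i - j)) \<subseteq> alg (US s)"
        using alg_mono[OF US_LS[OF ij(2)]] LS_US by blast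
      moreover have "Fb i j \<in> alg (US s)"
        using isUV_dd[of i j] ij Fb_LS[of i j s] LS_US[of s] by auto
      ultimately have "(wS (Suc (i - j)) - cn (CC (i - j)) * Fb i j) + cn (CC (i - j)) * Fb i j \<in> alg (US s)"
        using V_decomp(2)[OF ij(1)] by (intro alg.alg_add alg.alg_mult alg.alg_cn) auto
      then have "wS (Suc (i - j)) \<in> alg (US s)" by simp
      then show ?thesis using US T(4)[OF ij] by simp
    qed
    have Vs: "T' (wS (Suc s)) = gn (i0, ?v, 0)"
    proof -
      note H' = is_homD[OF dhom_hom[OF T'(1)]]
      have "T' (Fb i0 ?v) = cn ?mid * T' (gn (i0, ?v, 0))"
        by (rule dhom_Fb_rep[OF T'(1) zero]) (use V in auto)
      then have "cn (CC s) * T' (Fb i0 ?v) = gn (i0, ?v, 0) - T q"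
        unfolding T'(2) using C by (simp add: mult.assoc[symmetric] cn_mult[symmetric])
      moreover have "wS (Suc s) = cn (CC s) * Fb i0 ?v + q" by (simp add: q_def)
      ultimately show ?thesis using US[OF q] by (simp add: H'(1,2,3))
    qed
    have "T' (wS (Suc (i - j))) = gn (i, j, 0)" if ij: "isV i j" "i - j < Suc s" for i j
    proof (cases "i - j = s")
      case True
      then have "j = ?v" "i = i0" using isV_level(1,2)[OF ij(1)] by (auto simp: i0_def)
      then show ?thesis using Vs True by simp
    next
      case False
      then show ?thesis using Vlow ij by simp
    qed
    then show ?thesis using T'(1) zero U T(3) by (intro exI[of _ T']) auto
  qed
qed

definition Theta :: "sv \<Rightarrow> sv" where
  "Theta = (SOME T. dhom T \<and> (\<forall>i j. \<not> isU i j \<longrightarrow> \<not> isV i j \<longrightarrow> T (gn (i, j, 0)) = 0) \<and>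
    (\<forall>i j. isU i j \<longrightarrow> T (Fb i j) = gn (i, j, 0)) \<and>
    (\<forall>i j. isV i j \<longrightarrow> i - j < N \<longrightarrow> T (wS (Suc (i - j))) = gn (i, j, 0)))"

lemma Theta: "dhom Theta" "isU i j \<Longrightarrow> Theta (Fb i j) = gn (i, j, 0)"
  "isV i j \<Longrightarrow> Theta (wS (Suc (i - j))) = gn (i, j, 0)"
  using someI_ex[OF ex_Theta[OF order_refl]] isV_level(4)[of i j] unfolding Theta_def by blast+

text \<open>\<open>Psi\<close> substitutes the new generators for the labels, and \<open>Theta\<close> is its inverse on the differential algebra of the parabolic subalgebra.\<close>

definition Psi :: "sv \<Rightarrow> sv" where
  "Psi = (SOME T. is_hom T \<and> (\<forall>a. T (DD a) = DD (T a)) \<and> (\<forall>i j. T (gn (i, j, 0)) =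
    (if isV i j then wS (Suc (i - j)) else if i \<in> I \<and> j \<in> I then Fb i j else gn (i, j, 0))))"

lemma Psi_spec: "is_hom Psi \<and> (\<forall>a. Psi (DD a) = DD (Psi a)) \<and> (\<forall>i j. Psi (gn (i, j, 0)) =
    (if isV i j then wS (Suc (i - j)) else if i \<in> I \<and> j \<in> I then Fb i j else gn (i, j, 0)))"
proof -
  have "hpar (genpar (i, j, 0)) (if isV i j then wS (Suc (i - j)) else if i \<in> I \<and> j \<in> I then Fb i j
      else gn (i, j, 0))" for i j
  proof -
    have "hpar (genpar (i, j, 0)) (wS (Suc (i - j)))" if "isV i j"
    proof -
      have "even (pp i + pp j + 1) = even (Suc (i - j))" using isUV_dd(2)[of i j] that by (auto simp: even_pp)
      then show ?thesis
        using hpar_wS[of "Suc (i - j)"] isV_level(4)[OF that] by (simp add: hpar_def genpar_simp mod_2_eq_odd)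
    qed
    then show ?thesis using hpar_Fb hpar_gn[of "(i, j, 0)"] by auto
  qed
  from ex_dhom[OF this] show ?thesis unfolding Psi_def by (rule someI_ex)
qed

lemma Psi_dhom: "dhom Psi" using Psi_spec by (simp add: dhom_def)

lemma Psi_gn: "isV i j \<Longrightarrow> Psi (gn (i, j, m)) = (DD ^^ m) (wS (Suc (i - j)))"
  "isU i j \<Longrightarrow> Psi (gn (i, j, m)) = (DD ^^ m) (Fb i j)"
proof -
  have e: "gn (i, j, m) = (DD ^^ m) (gn (i, j, 0))" by simp
  show "isV i j \<Longrightarrow> Psi (gn (i, j, m)) = (DD ^^ m) (wS (Suc (i - j)))"
    unfolding e dhom_DD_pow[OF Psi_dhom] using Psi_spec by simp
  show "isU i j \<Longrightarrow> Psi (gn (i, j, m)) = (DD ^^ m) (Fb i j)"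
    unfolding e dhom_DD_pow[OF Psi_dhom] using Psi_spec not_isU_isV[of i j] isUV_dd(6,7)[of i j] by simp
qed

definition RG :: "gen set" where "RG = {(i, j, m). isU i j \<or> isV i j}"

lemma Theta_Psi: "P \<in> alg (gn ` RG) \<Longrightarrow> Theta (Psi P) = P"
proof (rule alg_hom_eq[OF is_hom_comp[OF dhom_hom[OF Theta(1)] dhom_hom[OF Psi_dhom]] is_hom_id])
  fix s assume "s \<in> gn ` RG"
  then obtain i j m where s: "s = gn (i, j, m)" "isU i j \<or> isV i j" unfolding RG_def by auto
  then show "Theta (Psi s) = s" by (auto simp: Psi_gn dhom_DD_pow[OF Theta(1)] Theta(2,3))
qed

text \<open>Packaged as a predicate because it passes to generated subalgebras and to derivatives;
  on generators it amounts to surjectivity of \<open>Psi\<close>.\<close>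

definition Ok :: "sv \<Rightarrow> bool" where "Ok a \<longleftrightarrow> Theta a \<in> alg (gn ` RG) \<and> Psi (Theta a) = a"

lemma Ok_alg: "(\<And>s. s \<in> S \<Longrightarrow> Ok s) \<Longrightarrow> a \<in> alg S \<Longrightarrow> Ok a"
proof -
  assume S: "\<And>s. s \<in> S \<Longrightarrow> Ok s" and a: "a \<in> alg S"
  have "Theta a \<in> alg (gn ` RG)" by (rule alg_hom[OF dhom_hom[OF Theta(1)] _ a]) (use S Ok_def in auto)
  moreover have "Psi (Theta a) = a"
    by (rule alg_hom_eq[OF is_hom_comp[OF dhom_hom[OF Psi_dhom] dhom_hom[OF Theta(1)]] is_hom_id _ a])
      (use S Ok_def in auto)
  ultimately show "Ok a" by (simp add: Ok_def)
qed

lemma RG_DD: "a \<in> alg (gn ` RG) \<Longrightarrow> DD a \<in> alg (gn ` RG)"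
proof (rule alg_der[OF DD_der])
  show "DD s \<in> alg (gn ` RG)" if "s \<in> gn ` RG" for s
    using that by (auto simp: RG_def intro!: alg.alg_gen)
  show "sg s \<in> alg (gn ` RG)" if "s \<in> gn ` RG" for s
    using that sg_hpar_alg[OF hpar_gn alg.alg_gen] by blast
qed

lemma Ok_DD_pow: "Ok a \<Longrightarrow> Ok ((DD ^^ m) a)"
proof (induction m)
  case (Suc m)
  then show ?case using RG_DD by (simp add: Ok_def dhom_DD[OF Theta(1)] dhom_DD[OF Psi_dhom])
qed simp

lemma Ok_U: "isU i j \<Longrightarrow> Ok (Fb i j)"
  using Psi_gn(2)[of i j 0] by (auto simp: Ok_def Theta(2) RG_def intro!: alg.alg_gen)

text \<open>Induction on the level. Type U holds by construction; a type V generator is recovered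
  from its invariant and from \<open>US s\<close>; every other generator is zero or a multiple of
  its reflection.\<close>

lemma Ok_Fb: "i \<in> I \<Longrightarrow> j \<in> I \<Longrightarrow> j \<le> i \<Longrightarrow> Ok (Fb i j)"
proof (induction "i - j" arbitrary: i j rule: less_induct)
  case less
  define s where "s = i - j"
  have US: "Ok x" if "x \<in> US s" for x
  proof -
    obtain k l m where x: "x = (DD ^^ m) (Fb k l)" "k \<in> I" "l \<in> I" "l \<le> k" "k < l + s \<or> isU k l"
      using \<open>x \<in> US s\<close> unfolding US_def by blast
    have "Ok (Fb k l)"
    proof (cases "isU k l")
      case False
      then have "k - l < i - j" using x(4,5) by (auto simp: s_def)
      then show ?thesis using less.hyps x by blast
    qed (rule Ok_U)
    then show ?thesis unfolding x(1) by (rule Ok_DD_pow)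
  qed
  have rep: "Ok (Fb k l)" if kl: "isU k l \<or> isV k l" "k - l = s" for k l
  proof (cases "isU k l")
    case False
    then have V: "isV k l" using kl by blast
    let ?q = "wS (Suc s) - cn (CC s) * Fb k l"
    have C: "CC s \<noteq> 0" and q: "?q \<in> alg (US s)" using V_decomp[OF V] kl(2) by simp_all
    have w: "Ok (wS (Suc s))"
      using Theta(3)[OF V] Psi_gn(1)[OF V, of 0] V kl(2) by (auto simp: Ok_def RG_def intro!: alg.alg_gen)
    have "cn (1 / CC s) * (wS (Suc s) - ?q) \<in> alg {wS (Suc s), ?q}"
      by (intro alg.alg_mult alg.alg_cn alg_diff alg.alg_gen) auto
    moreover have "cn (1 / CC s) * (wS (Suc s) - ?q) = Fb k l"
      using C by (simp add: mult.assoc[symmetric] cn_mult[symmetric])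
    ultimately have "Fb k l \<in> alg {wS (Suc s), ?q}" by simp
    moreover have "Ok x" if "x \<in> {wS (Suc s), ?q}" for x using that w Ok_alg[OF US q] by blast
    ultimately show ?thesis by (rule Ok_alg[rotated])
  qed (rule Ok_U)
  have ij: "i = j + s" "1 \<le> j" "j \<le> N - s" "s < N" using less.prems by (auto simp: s_def I_eq)
  have e: "Ok x" if "x \<in> alg {}" for x using Ok_alg[of "{}" x] that by auto
  from Fb_cases[OF ij(2-4)] show ?case
  proof (elim disjE)
    assume "Fb (j + s) j = 0"
    then show ?thesis using e[OF alg_zero] ij(1) by simp
  next
    assume "j \<le> dd s"
    then show ?thesis using rep_cases[OF ij(2) _ ij(4)] rep ij(1) by auto
  next
    assume *: "N + 1 - s - j \<le> dd s \<and> 1 \<le> N + 1 - s - j"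
    have "pr i = N + 1 - s - j" "pr j = N + 1 - s - j + s" using ij by (auto simp: pr_eq)
    then have "Ok (Fb (pr j) (pr i))" using rep rep_cases[of "N + 1 - s - j" s] * ij(4) by auto
    moreover have "Fb i j \<in> alg {Fb (pr j) (pr i)}"
      unfolding Fb_swap[OF less.prems(1,2)] by (intro alg.alg_mult alg.alg_cn alg.alg_gen) simp
    ultimately show ?thesis using Ok_alg[of "{Fb (pr j) (pr i)}"] by simp
  qed
qed

lemma Ok_PS: "a \<in> alg PS \<Longrightarrow> Ok a"
  by (rule Ok_alg) (auto simp: PS_def intro!: Ok_DD_pow Ok_Fb)

lemma WS_DD: "a \<in> WS \<Longrightarrow> DD a \<in> WS"
  unfolding WS_def by (auto simp: xi_DD[OF elt_Fm] is_homD[OF rho_hom] rho_DD alg_DD_PS)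

lemma WS_DD_pow: "a \<in> WS \<Longrightarrow> (DD ^^ m) a \<in> WS"
  by (induction m) (auto intro: WS_DD)

lemma WS_PS: "a \<in> WS \<Longrightarrow> a \<in> alg PS"
  by (simp add: WS_def)

lemma WS_mult: "a \<in> WS \<Longrightarrow> b \<in> WS \<Longrightarrow> a * b \<in> WS"
  unfolding WS_def
  by (auto simp: is_derD(2)[OF xi_der[OF elt_Fm]] is_homD(1,2)[OF rho_hom] intro: alg.alg_mult)

lemma WS_cn: "cn c \<in> WS"
  unfolding WS_def by (auto simp: is_derD(3)[OF xi_der[OF elt_Fm]] is_homD(5)[OF rho_hom] intro: alg.alg_cn)

lemma WS_alg: "S \<subseteq> WS \<Longrightarrow> a \<in> alg S \<Longrightarrow> a \<in> WS"
proof -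
  assume "S \<subseteq> WS" "a \<in> alg S"
  then show "a \<in> WS" by (induction rule: alg.induct[consumes 1, OF \<open>a \<in> alg S\<close>]) (auto intro: WS_cn WS_add WS_mult)
qed

lemma Psi_PS: "P \<in> alg (gn ` RG) \<Longrightarrow> Psi P \<in> alg PS"
proof (rule alg_hom[OF dhom_hom[OF Psi_dhom]])
  fix s assume "s \<in> gn ` RG"
  then obtain i j m where s: "s = gn (i, j, m)" "isU i j \<or> isV i j" unfolding RG_def by auto
  show "Psi s \<in> alg PS"
  proof (cases "isV i j")
    case True
    then show ?thesis using s by (simp add: Psi_gn WS_PS[OF WS_DD_pow[OF wS_WS]])
  next
    case False
    then have "isU i j" using s by blast
    then show ?thesis using s isUV_dd[of i j] by (auto simp: Psi_gn intro!: alg.alg_gen PS_I)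
  qed
qed

end

section \<open>Monomials and partial superderivatives\<close>

lemma alg_gn_supp: "a \<in> alg (gn ` G) \<Longrightarrow> cf a m \<noteq> 0 \<Longrightarrow> supp m \<subseteq> G"
proof (induction arbitrary: m rule: alg.induct)
  case (alg_cn c)
  then show ?case by (auto simp: cf_cn sconst_def supp_def split: if_splits)
next
  case (alg_gen s)
  then obtain g where "g \<in> G" "s = mon (mgen g)" by (auto simp: mon_mgen)
  then show ?case using alg_gen by (auto simp: cf_mon split: if_splits)
next
  case (alg_add a b)
  then have "cf a m \<noteq> 0 \<or> cf b m \<noteq> 0" by (auto simp: cf_simps)
  then show ?case using alg_add by blast
next
  case (alg_mult a b)
  then have "(\<Sum>x\<in>divs m. cf a x * cf b (\<lambda>g. m g - x g) * msign genpar x (\<lambda>g. m g - x g)) \<noteq> 0"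
    by (auto simp: cf_mult smul_def split: if_splits)
  then obtain x where x: "x \<in> divs m" "cf a x \<noteq> 0" "cf b (\<lambda>g. m g - x g) \<noteq> 0"
    by (rule sum.not_neutral_contains_not_neutral) auto
  have "supp m \<subseteq> supp x \<union> supp (\<lambda>g. m g - x g)" by (auto simp: supp_def)
  then show ?case using alg_mult.IH x by blast
qed

lemma mon_alg: "finite (supp m) \<Longrightarrow> supp m \<subseteq> G \<Longrightarrow> mon m \<in> alg (gn ` G)"
proof (induction m rule: mono_induct)
  case zero
  then show ?case by (simp add: mon_zero)
next
  case (gen g m)
  then have "supp m \<subseteq> G" "g \<in> G" by (auto simp: supp_def mgen_def)
  then show ?case using gen by (auto simp flip: gn_mult_mon_min intro!: alg.alg_mult intro: alg.alg_gen)
qed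

lemma alg_gn_iff: "a \<in> alg (gn ` G) \<longleftrightarrow> (\<forall>m. cf a m \<noteq> 0 \<longrightarrow> supp m \<subseteq> G)"
proof
  assume a: "\<forall>m. cf a m \<noteq> 0 \<longrightarrow> supp m \<subseteq> G"
  have "(\<Sum>m | cf a m \<noteq> 0. cn (cf a m) * mon m) \<in> alg (gn ` G)"
    using a cf_valid[of a] by (intro alg_sum alg.alg_mult alg.alg_cn mon_alg) (auto simp: valid_mono_def)
  then show "a \<in> alg (gn ` G)" by (simp flip: sv_expand)
qed (use alg_gn_supp in blast)

text \<open>The scalar \<open>c\<close> is the sign from passing smaller odd generators. For even
  \<open>e\<close> it has to be pinned to 1, because repeated factors of \<open>g\<close> then add
  up; an odd \<open>g\<close> occurs at most once.\<close>

lemma der_mon: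
  assumes d: "is_der e d" "\<And>h. d (gn h) = (if h = g then 1 else 0)" and e: "even e = even (genpar g)"
    and "finite (supp m)" "valid_mono genpar m"
  shows "\<exists>c. c \<noteq> 0 \<and> (even e \<longrightarrow> c = 1) \<and> d (mon m) = cn (c * of_nat (m g)) * mon (m(g := m g - 1))"
  using assms(4,5)
proof (induction m rule: mono_induct)
  case zero
  show ?case by (rule exI[of _ 1]) (simp add: mon_zero is_derD[OF d(1)])
next
  case (gen h m)
  let ?M = "madd (mgen h) m"
  have vm: "valid_mono genpar m" by (rule valid_mono_le[OF gen.prems]) simp
  obtain c where c: "c \<noteq> 0" "even e \<longrightarrow> c = 1" "d (mon m) = cn (c * of_nat (m g)) * mon (m(g := m g - 1))"
    using gen.IH vm by blast
  have min: "k \<in> supp (m(g := m g - 1)) \<Longrightarrow> h \<le> k" for k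
    using gen.hyps(2) by (auto simp: supp_def split: if_splits)
  have dM: "d (mon ?M) = d (gn h) * mon m + tw e (gn h) * (cn (c * of_nat (m g)) * mon (m(g := m g - 1)))"
    using gn_mult_mon_min[OF gen.hyps(2)] is_derD(2)[OF d(1), of "gn h" "mon m"] c(3) by simp
  show ?case
  proof (cases "h = g")
    case False
    let ?s = "if odd e \<and> odd (genpar h) then -1 else 1 :: complex"
    define M' where "M' = ?M(g := ?M g - 1)"
    have Mg: "?M g = m g" using False by (simp add: mgen_other)
    have "madd (mgen h) (m(g := m g - 1)) = M'" using False by (auto simp: M'_def mgen_other)
    then have "gn h * mon (m(g := m g - 1)) = mon M'" using gn_mult_mon_min[OF min] by simp
    moreover have "tw e (gn h) = cn ?s * gn h" by (simp add: tw_hpar[OF hpar_gn])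
    ultimately have "d (mon ?M) = cn (?s * c * of_nat (m g)) * mon M'"
      unfolding dM using False d(2)[of h]
      by (simp add: cn_left_commute[of "gn h"] mult.assoc cn_mult)
    then have "d (mon ?M) = cn (?s * c * of_nat (?M g)) * mon (?M(g := ?M g - 1))"
      by (simp only: M'_def Mg)
    moreover have "?s * c \<noteq> 0" "even e \<longrightarrow> ?s * c = 1" using c(1,2) by auto
    ultimately show ?thesis by blast
  next
    case True
    have M: "?M(g := ?M g - 1) = m" by (rule ext) (simp add: True mgen_def)
    show ?thesis
    proof (cases "odd e")
      case True
      then have "?M g \<le> 1" using gen.prems e unfolding valid_mono_def by blast
      then have "m g = 0" using \<open>h = g\<close> by simp
      then show ?thesis using dM d(2)[of h] \<open>h = g\<close> M by (intro exI[of _ 1]) simp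
    next
      case False
      have "cn (of_nat (m g)) * (gn g * mon (m(g := m g - 1))) = cn (of_nat (m g)) * mon m"
      proof (cases "m g = 0")
        case False
        then have "madd (mgen g) (m(g := m g - 1)) = m" by (auto simp: mgen_def)
        then show ?thesis using gn_mult_mon_min[OF min] True by simp
      qed simp
      then have "d (mon ?M) = cn (1 + of_nat (m g)) * mon m"
        unfolding dM using False c(2) True d(2)[of h]
        by (simp add: tw_def cn_left_commute[of "gn g"] distrib_right)
      then show ?thesis using M True by (intro exI[of _ 1]) simp
    qed
  qed
qed

text \<open>Distinct monomials containing \<open>g\<close> have distinct derivatives, and in
  characteristic 0 no exponent vanishes, so nothing can cancel.\<close>

lemma der_indep:
  assumes d: "is_der e d" "\<And>h. d (gn h) = (if h = g then 1 else 0)" and e: "even e = even (genpar g)"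
    and z: "d P = 0" and m: "cf P m \<noteq> 0"
  shows "m g = 0"
proof (rule ccontr)
  assume mg: "m g \<noteq> 0"
  let ?m = "m(g := m g - 1)"
  have "\<exists>c. c \<noteq> 0 \<and> d (mon x) = cn (c * of_nat (x g)) * mon (x(g := x g - 1))" if "cf P x \<noteq> 0" for x
    using der_mon[OF d e] cf_valid[OF that] by (auto simp: valid_mono_def)
  then obtain c where c: "\<And>x. cf P x \<noteq> 0 \<Longrightarrow> c x \<noteq> 0 \<and> d (mon x) = cn (c x * of_nat (x g)) * mon (x(g := x g - 1))"
    by metis
  have "d P = (\<Sum>x | cf P x \<noteq> 0. cn (cf P x) * (cn (c x * of_nat (x g)) * mon (x(g := x g - 1))))"
    by (subst sv_expand[of P], unfold is_der_sum[OF d(1)]) (intro sum.cong refl, simp add: is_derD(6)[OF d(1)] c)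
  then have "cf (d P) ?m = (\<Sum>x | cf P x \<noteq> 0. cf P x * (c x * of_nat (x g) * cf (mon (x(g := x g - 1))) ?m))"
    by (simp add: cf_sum cf_cn_mult)
  also have "\<dots> = (\<Sum>x | cf P x \<noteq> 0. if x = m then cf P m * (c m * of_nat (m g)) else 0)"
  proof (intro sum.cong refl)
    fix x assume "x \<in> {x. cf P x \<noteq> 0}"
    have v: "valid_mono genpar ?m" by (rule valid_mono_le[OF cf_valid[OF m]]) simp
    show "cf P x * (c x * of_nat (x g) * cf (mon (x(g := x g - 1))) ?m) =
        (if x = m then cf P m * (c m * of_nat (m g)) else 0)"
    proof (cases "x g = 0")
      case True
      then show ?thesis using mg by auto
    next
      case False
      have "?m = x(g := x g - 1) \<longleftrightarrow> x = m"
      proof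
        assume eq: "?m = x(g := x g - 1)"
        have "m h = x h" for h using fun_cong[OF eq, of h] mg False by (cases "h = g") auto
        then show "x = m" by auto
      qed auto
      then show ?thesis using v by (auto simp: cf_mon)
    qed
  qed
  also have "\<dots> = cf P m * (c m * of_nat (m g))" using m finite_cf[of P] by (simp add: sum.delta)
  finally show False using z m mg c[OF m] by (simp add: cf_simps)
qed

section \<open>Free generation\<close>

context osp
begin

definition LBL :: "nat \<Rightarrow> gen set" where
  "LBL s = {(i, j, m). isV i j \<or> (isU i j \<and> i - j < s)}"

lemma LBL_N: "LBL N = RG"
  using isUV_dd(4) by (auto simp: LBL_def RG_def)

lemma LBL_RG: "LBL s \<subseteq> RG"
  by (auto simp: LBL_def RG_def)

primrec esg :: "nat \<Rightarrow> nat \<Rightarrow> complex" where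
  "esg q 0 = 1"
| "esg q (Suc m) = - ((-1) ^ (q + Suc m)) * esg q m"

lemma esg_nz: "esg q m \<noteq> 0"
  by (induction m) auto

text \<open>By sesquilinearity each \<open>DD\<close> differentiates the old coefficient, which
  kills a constant, and also moves it up one power of \<chi>. Hence the power of \<chi> records the
  number of derivatives.\<close>

lemma xi_pow:
  assumes X: "elt X q" and x: "\<And>t. rho (xi X t x) = (if t = 0 then cn c else 0)"
  shows "rho (xi X t ((DD ^^ m) x)) = (if t = m then cn (esg q m * c) else 0)"
proof (induction m arbitrary: t)
  case 0
  then show ?case by (simp add: x)
next
  case (Suc m)
  have "(DD ^^ Suc m) x = DD ((DD ^^ m) x)" by simp
  then have "rho (xi X t ((DD ^^ Suc m) x)) = cn ((-1) ^ (q + t)) * (DD (rho (xi X t ((DD ^^ m) x))) -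
      (if t = 0 then 0 else rho (xi X (t - 1) ((DD ^^ m) x))))"
    by (simp only: xi_DD[OF X] is_homD[OF rho_hom] rho_DD if_distrib[of rho])
  also have "\<dots> = cn ((-1) ^ (q + t)) * (0 - (if t = Suc m then cn (esg q m * c) else 0))"
    unfolding Suc.IH by auto
  also have "\<dots> = (if t = Suc m then cn (esg q (Suc m) * c) else 0)"
    by (simp add: cn_mult mult.assoc)
  finally show ?case .
qed

text \<open>The constant to which the bracket of \<open>X\<close> with \<open>F\<^sub>d\<^sub>a\<close> reduces when \<open>d - a\<close> is one less than the level of \<open>X\<close>.\<close>

definition cst :: "mat \<Rightarrow> nat \<Rightarrow> nat \<Rightarrow> nat \<Rightarrow> complex" where
  "cst X q d a = (-1) ^ (q * (pp d + pp a + 1)) * ((\<Sum>k\<in>I. X k d * sf (Fm n k a)) -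
    (-1) ^ (q * (pp d + pp a)) * (\<Sum>l\<in>I. X a l * sf (Fm n d l)))"

text \<open>The bracket lies strictly above the diagonal, where \<open>rho\<close> takes scalar
  values. The form term would need an entry of \<open>X\<close> at distance \<open>d - a\<close>,
  which is below \<open>s + 1\<close>.\<close>

lemma rho_xi_const:
  assumes X: "elt X q" and lev: "\<And>x y. X x y \<noteq> 0 \<Longrightarrow> y = x + s + 1"
    and da: "d \<in> I" "a \<in> I" "a \<le> d" "d \<le> a + s"
  shows "rho (xi X t (Fb d a)) = (if t = 0 then cn (cst X q d a) else 0)"
proof -
  consider "t = 0" | "t = 1" | "t \<ge> 2" by linarith
  then show ?thesis
  proof cases
    case 1
    have a: "cn (X k d) * rho (Fb k a) = cn (X k d * sf (Fm n k a))" if "k \<in> I" for k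
    proof (cases "X k d = 0")
      case False
      then have "k < a" using lev[of k d] da by auto
      then show ?thesis using rho_Fb[OF that da(2)] by (simp add: cn_mult)
    qed simp
    have b: "cn (X a l) * rho (Fb d l) = cn (X a l * sf (Fm n d l))" if "l \<in> I" for l
    proof (cases "X a l = 0")
      case False
      then have "d < l" using lev[of a l] da by auto
      then show ?thesis using rho_Fb[OF da(1) that] by (simp add: cn_mult)
    qed simp
    have "rho (xi X 0 (Fb d a)) = cn (cst X q d a)"
      unfolding xi_0_Fb[OF X da(1,2)] cst_def
      by (simp add: is_homD(2,3,8)[OF rho_hom] is_hom_sum[OF rho_hom] a b cn_mult cn_sum)
    then show ?thesis using 1 by simp
  next
    case 2
    have "X a d = 0" using lev[of a d] da by auto
    then show ?thesis unfolding 2 xi_1_Fb[OF X da(1,2)] by (simp add: is_homD[OF rho_hom])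
  next
    case 3
    then show ?thesis by (simp add: xi_ge2_Fb[OF X] is_homD[OF rho_hom])
  qed
qed

context
  fixes b s X q
  assumes b: "1 \<le> b" "b \<le> dd (Suc s)" and s: "s < N"
  defines "X \<equiv> Fm n b (b + s + 1)" and "q \<equiv> pp b + pp (b + s + 1)"
begin

lemma b_bounds: "2 * b \<le> N - s" "b + s + 1 \<le> N" "b \<in> I" "b + s + 1 \<in> I" "pr (b + s + 1) = N - s - b" "pr b = N + 1 - b"
proof -
  have "2 * b \<le> N + 1 - Suc s" using b dd_bound[of "Suc s"] s by linarith
  then show 1: "2 * b \<le> N - s" "b + s + 1 \<le> N" using b by auto
  then show "b \<in> I" "b + s + 1 \<in> I" using b by (auto simp: I_eq)
  show "pr (b + s + 1) = N - s - b" "pr b = N + 1 - b" by (auto simp: pr_eq)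
qed

lemma X_elt: "elt X q"
  unfolding X_def q_def by (rule elt_Fm[OF b_bounds(3,4)])

lemma even_q: "even q = odd s"
  unfolding q_def by (auto simp: even_pp)

text \<open>The reflected entry sits in row \<open>N - s - b\<close>, which is at least
  \<open>b\<close> because of the bound by \<open>dd (Suc s)\<close>. This is the source of
  triangularity.\<close>

lemma X_level: "X x y \<noteq> 0 \<Longrightarrow> y = x + s + 1 \<and> b \<le> x"
proof -
  assume "X x y \<noteq> 0"
  then have "(x = b \<and> y = b + s + 1) \<or> (x = pr (b + s + 1) \<and> y = pr b)"
    unfolding X_def Fm_eq by (auto split: if_splits)
  then show ?thesis using b_bounds by auto
qed

text \<open>The danger is the antidiagonal, where \<open>F\<close> may vanish. There the bound on
  \<open>b\<close> forces level 2 mod 4, hence even \<open>b\<close>, and the two halves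
  add.\<close>

lemma X_diag: "X b (b + s + 1) \<noteq> 0"
proof (cases "b = pr (b + s + 1)")
  case True
  then have 2: "b + (b + s + 1) = N + 1" using b_bounds by auto
  then have "2 * dd (Suc s) = N + 1 - Suc s" using b(2) dd_bound[of "Suc s"] s by auto
  then have "Suc s mod 4 = 2" using dd_even[of "Suc s"] s by auto
  then obtain k where "Suc s = 4 * k + 2" by (metis mult_div_mod_eq)
  then have "b + 2 * k = 2 * n" using 2 by (simp add: N_def)
  then have "even b" by presburger
  then have "th b (b + s + 1) = 1" unfolding th_mid[OF b_bounds(3) 2] by (simp add: pp_def)
  then show ?thesis unfolding X_def Fm_eq by auto
next
  case False
  then show ?thesis unfolding X_def Fm_eq by simp
qed

text \<open>For level below \<open>s\<close> the bracket lands at least two steps above the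
  diagonal, out of reach of the form with \<open>f\<close>.\<close>

lemma cst_low:
  assumes "a \<le> d" "d < a + s" "d \<in> I" "a \<in> I"
  shows "cst X q d a = 0"
proof -
  have "X k d * sf (Fm n k a) = 0" if "k \<in> I" for k
    using X_level[of k d] sf_Fm[OF that assms(4)] assms by (cases "X k d = 0") auto
  then have "(\<Sum>k\<in>I. X k d * sf (Fm n k a)) = 0" by (intro sum.neutral) auto
  moreover have "X a l * sf (Fm n d l) = 0" if "l \<in> I" for l
    using X_level[of a l] sf_Fm[OF assms(3) that] assms by (cases "X a l = 0") auto
  then have "(\<Sum>l\<in>I. X a l * sf (Fm n d l)) = 0" by (intro sum.neutral) auto
  ultimately show ?thesis by (simp add: cst_def)
qed

lemma cst_upper:
  assumes "a < b" "a + s \<in> I" "a \<in> I"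
  shows "cst X q (a + s) a = 0"
proof -
  have "X k (a + s) * sf (Fm n k a) = 0" if "k \<in> I" for k
    using X_level[of k "a + s"] assms by (cases "X k (a + s) = 0") auto
  then have "(\<Sum>k\<in>I. X k (a + s) * sf (Fm n k a)) = 0" by (intro sum.neutral) auto
  moreover have "X a l * sf (Fm n (a + s) l) = 0" if "l \<in> I" for l
    using X_level[of a l] assms by (cases "X a l = 0") auto
  then have "(\<Sum>l\<in>I. X a l * sf (Fm n (a + s) l)) = 0" by (intro sum.neutral) auto
  ultimately show ?thesis by (simp add: cst_def)
qed

lemma cst_diag: "cst X q (b + s) b \<noteq> 0"
proof -
  have bs: "b + s \<in> I" using b_bounds by (auto simp: I_eq)
  \<comment> \<open>A nonzero entry in column \<open>b + s\<close> would lie in row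
    \<open>b - 1\<close>, above all rows of \<open>X\<close>. So only the second sum
    survives.\<close>
  have "X k (b + s) = 0" for k using X_level[of k "b + s"] by (cases "X k (b + s) = 0") auto
  moreover have "(\<Sum>l\<in>I. X b l * sf (Fm n (b + s) l)) =
      (\<Sum>l\<in>I. if l = b + s + 1 then X b (b + s + 1) * (2 * (-1) ^ pp (b + s + 1) * gg (b + s + 1)) else 0)"
    by (intro sum.cong refl) (auto simp: sf_Fm[OF bs])
  moreover have "\<dots> = X b (b + s + 1) * (2 * (-1) ^ pp (b + s + 1) * gg (b + s + 1))"
    using b_bounds(4) by (simp add: sum.delta)
  ultimately show ?thesis using X_diag by (simp add: cst_def)
qed

text \<open>Both sides are derivations along \<open>Psi\<close> with the same twist, since
  \<open>rho\<close> fixes the image of \<open>Psi\<close> and \<open>q\<close> has the parity of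
  \<open>Suc s\<close>. It remains to compare labels: type V gives invariants, type U below level
  \<open>s\<close> gives 0, and type U of level \<open>s\<close> gives a constant only for exactly
  \<open>k\<close> derivatives.\<close>

lemma E_formula:
  assumes D: "\<And>a. a \<in> {1..dd (Suc s)} \<Longrightarrow> is_der (Suc s + k) (D a)"
    "\<And>a h. a \<in> {1..dd (Suc s)} \<Longrightarrow> D a (gn h) = (if h = (a + s, a, k) then 1 else 0)"
    and P: "P \<in> alg (gn ` LBL (Suc s))"
  shows "rho (xi X k (Psi P)) = Psi (\<Sum>a\<in>{1..dd (Suc s)}. cn (esg q k * cst X q (a + s) a) * D a P)"
proof -
  let ?B = "{1..dd (Suc s)}"
  define Dk where "Dk = (\<lambda>P. \<Sum>a\<in>?B. cn (esg q k * cst X q (a + s) a) * D a P)"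
  have Dk: "is_der (Suc s + k) Dk" unfolding Dk_def by (rule is_der_lincomb[OF D(1)])
  note DD' = is_derD[OF Dk] and DX = is_derD[OF xi_der[OF X_elt, of k]]
    and HP = is_homD[OF dhom_hom[OF Psi_dhom]] and HR = is_homD[OF rho_hom]
  have twq: "tw (q + k) = tw (Suc s + k)" using even_q by (intro tw_cong) auto
  have rP: "rho (Psi a) = Psi a" if "a \<in> alg (gn ` LBL (Suc s))" for a
    using that alg_mono[OF image_mono[OF LBL_RG]] by (intro rho_PS Psi_PS) blast
  have "rho (xi X k (Psi P)) = Psi (Dk P)" using P
  proof induction
    case (alg_cn c)
    then show ?case by (simp add: HP HR DX DD')
  next
    case (alg_add a b)
    then show ?case by (simp add: HP HR DX DD')
  next
    case (alg_mult a b)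
    have "rho (xi X k (Psi (a * b))) = rho (xi X k (Psi a)) * Psi b + tw (q + k) (Psi a) * rho (xi X k (Psi b))"
      using alg_mult.hyps by (simp add: HP(2) DX(2) HR(1,2) is_hom_tw[OF rho_hom] rP)
    then show ?case unfolding alg_mult.IH DD'(2) HP(1,2) is_hom_tw[OF dhom_hom[OF Psi_dhom]] twq .
  next
    case (alg_gen x)
    then obtain i j m where x: "x = gn (i, j, m)" "isV i j \<or> (isU i j \<and> i - j < Suc s)"
      unfolding LBL_def by auto
    have Dx: "Dk x = (\<Sum>a\<in>?B. if (i, j, m) = (a + s, a, k) then cn (esg q k * cst X q (a + s) a) else 0)"
      unfolding Dk_def x(1) by (intro sum.cong refl) (auto simp: D(2))
    show ?case
    proof (cases "isU i j")
      case False
      then have V: "isV i j" using x by blast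
      have "(i, j, m) \<noteq> (a + s, a, k)" if "a \<in> ?B" for a
      proof
        assume "(i, j, m) = (a + s, a, k)"
        then have "isU i j" using isUV_dd(1-3)[of i j] V that by (auto simp: isU_def)
        then show False using False by blast
      qed
      then have "Dk x = 0" unfolding Dx by (intro sum.neutral ballI) auto
      moreover have "(DD ^^ m) (wS (Suc (i - j))) \<in> WS" by (rule WS_DD_pow[OF wS_WS])
      then have "rho (xi X k (Psi x)) = 0"
        unfolding x(1) Psi_gn(1)[OF V] X_def using b_bounds(3,4) unfolding WS_def by simp
      ultimately show ?thesis by (simp add: HP)
    next
      case True
      note ij = isUV_dd[of i j, OF disjI1[OF True]]
      have lev: "i - j < Suc s" using x(2) not_isU_isV[OF True] by blast
      have "rho (xi X t (Fb i j)) = (if t = 0 then cn (cst X q i j) else 0)" for t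
        using X_level ij lev by (intro rho_xi_const[OF X_elt, of s]) auto
      then have E: "rho (xi X k (Psi x)) = (if k = m then cn (esg q m * cst X q i j) else 0)"
        unfolding x(1) Psi_gn(2)[OF True] by (rule xi_pow[OF X_elt])
      show ?thesis
      proof (cases "i - j = s")
        case True
        then have "i = j + s" "j \<in> ?B" using ij \<open>isU i j\<close> by (auto simp: isU_def)
        then have "Dk x = (\<Sum>a\<in>?B. if a = j then if m = k then cn (esg q k * cst X q (j + s) j) else 0 else 0)"
          unfolding Dx by (intro sum.cong) auto
        also have "\<dots> = (if m = k then cn (esg q k * cst X q (j + s) j) else 0)"
          using \<open>j \<in> ?B\<close> by (simp add: sum.delta)
        finally show ?thesis using E \<open>i = j + s\<close> by (auto simp: HP)
      next
        case False
        then have "i < j + s" using lev by auto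
        then have "cst X q i j = 0" using ij by (intro cst_low) auto
        moreover have "Dk x = 0" unfolding Dx using \<open>i < j + s\<close> by (intro sum.neutral ballI) auto
        ultimately show ?thesis using E by (simp add: HP)
      qed
    qed
  qed
  then show ?thesis by (simp only: Dk_def)
qed

end

text \<open>The coefficients in the formula for the brackets are triangular in \<open>(b, a)\<close> with nonzero diagonal, so
 invariance kills all partial derivatives with respect to the generators of type U on level \<open>s\<close>.\<close>

lemma descend:
  assumes s: "s < N" and P: "P \<in> alg (gn ` LBL (Suc s))" and W: "Psi P \<in> WS"
  shows "P \<in> alg (gn ` LBL s)"
proof -
  let ?B = "{1..dd (Suc s)}"
  have PRG: "P \<in> alg (gn ` RG)" using P alg_mono[OF image_mono[OF LBL_RG]] by blast
  have ex: "\<exists>d. is_der (Suc s + k) d \<and> (\<forall>h. d (gn h) = (if h = (a + s, a, k) then 1 else 0))" for a k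
  proof (rule ex_der)
    have "even (genpar (a + s, a, k) + (Suc s + k))" by (auto simp: genpar_simp mod_2_eq_odd even_pp)
    then show "hpar (genpar g + (Suc s + k)) (if g = (a + s, a, k) then 1 else 0)" for g
      by (auto simp: hpar_def)
  qed
  define D where "D = (\<lambda>a k. SOME d. is_der (Suc s + k) d \<and>
    (\<forall>h. d (gn h) = (if h = (a + s, a, k) then 1 else 0)))"
  have D: "is_der (Suc s + k) (D a k)" "D a k (gn h) = (if h = (a + s, a, k) then 1 else 0)" for a k h
    using someI_ex[OF ex[of k a]] unfolding D_def by blast+
  have eq0: "(\<Sum>a\<in>?B. cn (esg (pp b + pp (b + s + 1)) k * cst (Fm n b (b + s + 1)) (pp b + pp (b + s + 1)) (a + s) a) * D a k P) = 0"
    if b: "b \<in> ?B" for b k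
  proof -
    let ?X = "Fm n b (b + s + 1)" and ?q = "pp b + pp (b + s + 1)"
    let ?R = "\<Sum>a\<in>?B. cn (esg ?q k * cst ?X ?q (a + s) a) * D a k P"
    have b': "1 \<le> b" "b \<le> dd (Suc s)" using b by auto
    have "rho (xi ?X k (Psi P)) = Psi ?R"
      by (rule E_formula[OF b' s]) (use D P in auto)
    moreover have "rho (xi ?X k (Psi P)) = 0"
      using W b_bounds(3,4)[OF b' s] unfolding WS_def by simp
    ultimately have z: "Psi ?R = 0" by simp
    have "?R \<in> alg (gn ` RG)"
    proof (intro alg_sum alg.alg_mult alg.alg_cn)
      fix a
      show "D a k P \<in> alg (gn ` RG)"
      proof (rule alg_der[OF D(1) _ _ PRG])
        show "D a k x \<in> alg (gn ` RG)" if "x \<in> gn ` RG" for x using that D(2) by auto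
        show "sg x \<in> alg (gn ` RG)" if "x \<in> gn ` RG" for x
          using that sg_hpar_alg[OF hpar_gn alg.alg_gen] by blast
      qed
    qed
    \<comment> \<open>\<open>Psi\<close> is injective on labels, so a vanishing bracket becomes a
      linear relation among partial derivatives of \<open>P\<close>.\<close>
    then have "Theta (Psi ?R) = ?R" by (rule Theta_Psi)
    then show ?thesis unfolding z is_homD(5)[OF dhom_hom[OF Theta(1)]] by simp
  qed
  have "D b k P = 0" if "b \<in> ?B" for b k
    using that
  proof (induction "dd (Suc s) - b" arbitrary: b rule: less_induct)
    case less
    let ?X = "Fm n b (b + s + 1)" and ?q = "pp b + pp (b + s + 1)"
    have b': "1 \<le> b" "b \<le> dd (Suc s)" using less.prems by auto
    have "cn (esg ?q k * cst ?X ?q (a + s) a) * D a k P = 0" if a: "a \<in> ?B" "a \<noteq> b" for a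
    proof (cases "a < b")
      case True
      then have "cst ?X ?q (a + s) a = 0"
        using a b_bounds(2)[OF b' s] by (intro cst_upper[OF b' s]) (auto simp: I_eq)
      then show ?thesis by simp
    next
      case False
      then have "D a k P = 0" using a less.prems by (intro less.hyps) auto
      then show ?thesis by simp
    qed
    then have "(\<Sum>a\<in>?B. cn (esg ?q k * cst ?X ?q (a + s) a) * D a k P) =
        cn (esg ?q k * cst ?X ?q (b + s) b) * D b k P"
      using less.prems by (subst sum.remove[of _ b]) auto
    then have z: "cn (esg ?q k * cst ?X ?q (b + s) b) * D b k P = 0" using eq0[OF less.prems] by simp
    have nz: "esg ?q k * cst ?X ?q (b + s) b \<noteq> 0" using cst_diag[OF b' s] esg_nz by simp
    have "D b k P = cn (1 / (esg ?q k * cst ?X ?q (b + s) b)) * (cn (esg ?q k * cst ?X ?q (b + s) b) * D b k P)"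
      unfolding mult.assoc[symmetric] cn_mult[symmetric] using nz by simp
    then show ?case unfolding z by simp
  qed
  then have z: "m (a + s, a, k) = 0" if "a \<in> ?B" "cf P m \<noteq> 0" for a k m
    using that by (intro der_indep[OF D(1,2)]) (auto simp: genpar_simp mod_2_eq_odd even_pp)
  show ?thesis unfolding alg_gn_iff
  proof (intro allI impI subsetI)
    fix m g assume m: "cf P m \<noteq> 0" and g: "g \<in> supp m"
    obtain i j k where ijk: "g = (i, j, k)" by (cases g) auto
    have "g \<in> LBL (Suc s)" using P m g unfolding alg_gn_iff by blast
    then have ij: "isV i j \<or> (isU i j \<and> i - j < Suc s)" by (simp add: LBL_def ijk)
    have "\<not> (isU i j \<and> i - j = s)"
    proof
      assume "isU i j \<and> i - j = s"
      then have "i = j + s" "j \<in> ?B" by (auto simp: isU_def)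
      then have "m g = 0" using z[of j m k] m ijk by simp
      then show False using g by (simp add: supp_def)
    qed
    then show "g \<in> LBL s" using ij by (auto simp: LBL_def ijk)
  qed
qed

lemma WS_Psi:
  assumes "w \<in> WS"
  shows "Theta w \<in> alg (gn ` LBL 0)" "Psi (Theta w) = w"
proof -
  have ok: "Theta w \<in> alg (gn ` RG)" "Psi (Theta w) = w"
    using Ok_PS[OF WS_PS[OF assms]] by (auto simp: Ok_def)
  have "Theta w \<in> alg (gn ` LBL s)" if "s \<le> N" for s
    using that
  proof (induction s rule: inc_induct)
    case base
    then show ?case using ok by (simp add: LBL_N)
  next
    case (step s)
    then show ?case using descend[of s "Theta w"] ok(2) assms by simp
  qed
  then show "Theta w \<in> alg (gn ` LBL 0)" "Psi (Theta w) = w" using ok by auto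
qed

section \<open>Polynomials in the invariants and their derivatives\<close>

definition GG :: "(nat \<times> nat) set" where
  "GG = {(t, m). 1 \<le> t \<and> t \<le> N \<and> (t mod 4 = 0 \<or> t mod 4 = 3)}"

text \<open>The type V label of level \<open>t - 1\<close>, whose place the coefficient with index
  \<open>t\<close> takes.\<close>

definition lab :: "nat \<times> nat \<Rightarrow> gen" where
  "lab g = (case g of (t, m) \<Rightarrow> (dd (t - 1) + (t - 1), dd (t - 1), m))"

definition xs :: "nat \<times> nat \<Rightarrow> sv" where
  "xs g = (case g of (t, m) \<Rightarrow> (DD ^^ m) (wS t))"

lemma lab_V:
  assumes "(t, m) \<in> GG"
  shows "isV (dd (t - 1) + (t - 1)) (dd (t - 1))"
proof -
  obtain t' where t: "t = Suc t'" using assms by (cases t) (auto simp: GG_def)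
  have "t' mod 4 = 2 \<or> t' mod 4 = 3" "t' < N" using assms unfolding t GG_def by (auto; presburger)+
  then show ?thesis unfolding t by (simp add: isV_dd)
qed

lemma lab_image: "lab ` GG = LBL 0"
proof (intro equalityI subsetI)
  fix g assume "g \<in> lab ` GG"
  then show "g \<in> LBL 0" using lab_V by (auto simp: lab_def LBL_def)
next
  fix g assume "g \<in> LBL 0"
  then obtain i j m where g: "g = (i, j, m)" "isV i j" by (auto simp: LBL_def)
  note V = isV_level[OF g(2)]
  have "(Suc (i - j), m) \<in> GG" using V(3,4) unfolding GG_def by (auto simp: mod_Suc)
  moreover have "lab (Suc (i - j), m) = g" using V(1,2) by (simp add: lab_def g(1))
  ultimately show "g \<in> lab ` GG" by (metis imageI)
qed

lemma inj_lab: "inj_on lab GG"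
proof (rule inj_onI)
  fix x y assume xy: "x \<in> GG" "y \<in> GG" "lab x = lab y"
  obtain t m t' m' where e: "x = (t, m)" "y = (t', m')" by (cases x, cases y) auto
  then have "m = m'" "t - 1 = t' - 1" using xy(3) by (auto simp: lab_def)
  then show "x = y" using xy(1,2) e by (auto simp: GG_def)
qed

lemma Psi_lab: "g \<in> GG \<Longrightarrow> Psi (gn (lab g)) = xs g"
proof -
  assume g: "g \<in> GG"
  obtain t m where e: "g = (t, m)" by (cases g) auto
  have "1 \<le> t" using g e by (auto simp: GG_def)
  then show ?thesis using Psi_gn(1)[OF lab_V[of t m], of m] g e by (simp add: lab_def xs_def)
qed

lemma lab_RG: "g \<in> GG \<Longrightarrow> lab g \<in> RG"
  using lab_image LBL_RG by blast

lemma gn_nz: "gn g \<noteq> 0"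
proof
  assume "gn g = 0"
  then have "cf (mon (mgen g)) (mgen g) = cf 0 (mgen g)" by (simp add: mon_mgen)
  then show False by (simp add: cf_mon cf_simps)
qed

lemma xs_nz: "g \<in> GG \<Longrightarrow> xs g \<noteq> 0"
proof
  assume g: "g \<in> GG" and "xs g = 0"
  have "Theta (Psi (gn (lab g))) = gn (lab g)"
    using lab_RG[OF g] by (intro Theta_Psi alg.alg_gen) auto
  then show False using Psi_lab[OF g] \<open>xs g = 0\<close> gn_nz is_homD(5)[OF dhom_hom[OF Theta(1)]] by simp
qed

lemma xs_homog: "g \<in> GG \<Longrightarrow> homog genpar (cf (xs g)) (genpar (lab g))"
proof -
  assume g: "g \<in> GG"
  have "hpar (genpar (lab g)) (xs g)"
    using is_hom_hpar[OF dhom_hom[OF Psi_dhom] hpar_gn[of "lab g"]] Psi_lab[OF g] by simp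
  then show ?thesis by (rule hpar_imp_homog) (simp add: genpar_def split: prod.splits)
qed

text \<open>\<open>gparity\<close> chooses a parity, and the zero polynomial would allow both; so
  \<open>xs_nz\<close> is what makes the choice determined.\<close>

lemma gparity_xs:
  assumes g: "g \<in> GG"
  shows "gparity (\<lambda>g. cf (xs g)) g = genpar (lab g)"
proof -
  obtain m where m: "cf (xs g) m \<noteq> 0"
    using xs_nz[OF g] sv_eqI[of "xs g" 0] by (auto simp: cf_simps)
  show ?thesis unfolding gparity_def
  proof (rule some_equality)
    show "genpar (lab g) < 2 \<and> homog genpar (cf (xs g)) (genpar (lab g))"
      using xs_homog[OF g] by (auto simp: genpar_def split: prod.splits)
    fix e assume "e < 2 \<and> homog genpar (cf (xs g)) e"
    then show "e = genpar (lab g)" using xs_homog[OF g] m unfolding homog_def by metis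
  qed
qed

text \<open>Exponents transported along \<open>lab\<close>; the two linear orders on labels do not match, so ordered products
 correspond only up to a nonzero scalar.\<close>

definition rel :: "(nat \<times> nat) mono \<Rightarrow> gen mono" where
  "rel m = (\<lambda>h. if h \<in> lab ` GG then m (the_inv_into GG lab h) else 0)"

lemma rel_lab: "g \<in> GG \<Longrightarrow> rel m (lab g) = m g"
  by (simp add: rel_def the_inv_into_f_f[OF inj_lab])

lemma rel_inj: "supp m \<subseteq> GG \<Longrightarrow> supp m' \<subseteq> GG \<Longrightarrow> rel m = rel m' \<Longrightarrow> m = m'"
proof
  fix g assume a: "supp m \<subseteq> GG" "supp m' \<subseteq> GG" "rel m = rel m'"
  show "m g = m' g"
  proof (cases "g \<in> GG")
    case True
    then show ?thesis using rel_lab[of g m] rel_lab[of g m'] a(3) by simp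
  next
    case False
    then have "g \<notin> supp m" "g \<notin> supp m'" using a by auto
    then show ?thesis by (simp add: supp_def)
  qed
qed

lemma supp_rel: "supp m \<subseteq> GG \<Longrightarrow> supp (rel m) = lab ` supp m"
proof -
  assume m: "supp m \<subseteq> GG"
  have "h \<in> supp (rel m) \<longleftrightarrow> h \<in> lab ` supp m" for h
  proof (cases "h \<in> lab ` GG")
    case True
    then obtain g where g: "h = lab g" "g \<in> GG" by blast
    then have "h \<in> supp (rel m) \<longleftrightarrow> g \<in> supp m" by (simp add: supp_def rel_lab)
    also have "\<dots> \<longleftrightarrow> h \<in> lab ` supp m" using g m inj_lab by (auto dest: inj_onD)
    finally show ?thesis .
  next
    case False
    then show ?thesis using m by (auto simp: supp_def rel_def)
  qed
  then show ?thesis by blast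
qed

lemma valid_rel:
  assumes "supp m \<subseteq> GG"
  shows "valid_mono (gparity (\<lambda>g. cf (xs g))) m \<longleftrightarrow> valid_mono genpar (rel m)"
proof -
  have fin: "finite (supp (rel m)) \<longleftrightarrow> finite (supp m)"
    unfolding supp_rel[OF assms] using inj_on_subset[OF inj_lab assms] by (rule finite_image_iff)
  have "(\<forall>g. odd (gparity (\<lambda>g. cf (xs g)) g) \<longrightarrow> m g \<le> 1) \<longleftrightarrow> (\<forall>h. odd (genpar h) \<longrightarrow> rel m h \<le> 1)"
  proof
    assume L: "\<forall>g. odd (gparity (\<lambda>g. cf (xs g)) g) \<longrightarrow> m g \<le> 1"
    show "\<forall>h. odd (genpar h) \<longrightarrow> rel m h \<le> 1"
    proof (intro allI impI)
      fix h assume h: "odd (genpar h)"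
      show "rel m h \<le> 1"
      proof (cases "h \<in> lab ` GG")
        case True
        then obtain g where "h = lab g" "g \<in> GG" by blast
        then show ?thesis using L h gparity_xs rel_lab by metis
      qed (simp add: rel_def)
    qed
  next
    assume R: "\<forall>h. odd (genpar h) \<longrightarrow> rel m h \<le> 1"
    show "\<forall>g. odd (gparity (\<lambda>g. cf (xs g)) g) \<longrightarrow> m g \<le> 1"
    proof (intro allI impI)
      fix g assume g: "odd (gparity (\<lambda>g. cf (xs g)) g)"
      show "m g \<le> 1"
      proof (cases "g \<in> GG")
        case True
        then show ?thesis using R g gparity_xs rel_lab by metis
      next
        case False
        then have "m g = 0" using assms by (auto simp: supp_def)
        then show ?thesis by simp
      qed
    qed
  qed
  then show ?thesis using fin by (simp add: valid_mono_def)
qed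

lemma gn_pow_mon: "\<exists>c. c \<noteq> 0 \<and> gn g ^ k * mon m = cn c * mon (\<lambda>h. m h + (if h = g then k else 0))"
proof (induction k)
  case 0
  show ?case by (rule exI[of _ 1]) simp
next
  case (Suc k)
  then obtain c where c: "c \<noteq> 0" "gn g ^ k * mon m = cn c * mon (\<lambda>h. m h + (if h = g then k else 0))"
    by blast
  let ?m = "\<lambda>h. m h + (if h = g then k else 0)"
  have "gn g ^ Suc k * mon m = cn c * (gn g * mon ?m)"
    using c(2) by (simp add: mult.assoc cn_left_commute[of "gn g"])
  also have "\<dots> = cn (c * msign genpar (mgen g) ?m) * mon (madd (mgen g) ?m)"
    by (simp add: gn_mult_mon cn_mult mult.assoc)
  also have "madd (mgen g) ?m = (\<lambda>h. m h + (if h = g then Suc k else 0))" by (auto simp: mgen_def)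
  finally show ?case using c(1) by (intro exI[of _ "c * msign genpar (mgen g) ?m"]) (simp add: msign_def)
qed

lemma prod_lab:
  assumes "distinct gs" "set gs \<subseteq> GG"
  shows "\<exists>c. c \<noteq> 0 \<and> prod_list (map (\<lambda>g. gn (lab g) ^ m g) gs) = cn c * mon (rel (\<lambda>g. if g \<in> set gs then m g else 0))"
  using assms
proof (induction gs)
  case Nil
  have "rel (\<lambda>g. 0) = (\<lambda>_. 0)" by (auto simp: rel_def)
  then show ?case by (intro exI[of _ 1]) (simp add: mon_zero)
next
  case (Cons g gs)
  then obtain c where c: "c \<noteq> 0"
    "prod_list (map (\<lambda>g. gn (lab g) ^ m g) gs) = cn c * mon (rel (\<lambda>g. if g \<in> set gs then m g else 0))" by auto
  let ?m = "rel (\<lambda>g. if g \<in> set gs then m g else 0)"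
  obtain c' where c': "c' \<noteq> 0" "gn (lab g) ^ m g * mon ?m = cn c' * mon (\<lambda>h. ?m h + (if h = lab g then m g else 0))"
    using gn_pow_mon by blast
  have e: "(\<lambda>h. ?m h + (if h = lab g then m g else 0)) = rel (\<lambda>k. if k \<in> set (g # gs) then m k else 0)"
  proof
    fix h
    show "?m h + (if h = lab g then m g else 0) = rel (\<lambda>k. if k \<in> set (g # gs) then m k else 0) h"
    proof (cases "h \<in> lab ` GG")
      case True
      then obtain k where k: "h = lab k" "k \<in> GG" by blast
      have "lab k = lab g \<longleftrightarrow> k = g" using k Cons.prems(2) inj_lab by (auto dest: inj_onD)
      then show ?thesis using k Cons.prems by (auto simp: rel_lab)
    next
      case False
      then have "h \<noteq> lab g" using Cons.prems(2) by auto
      then show ?thesis using False by (simp add: rel_def)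
    qed
  qed
  have "prod_list (map (\<lambda>g. gn (lab g) ^ m g) (g # gs)) = cn (c * c') * mon (rel (\<lambda>k. if k \<in> set (g # gs) then m k else 0))"
    using c(2) c'(2) by (simp add: e cn_left_commute[of "gn (lab g) ^ m g"] cn_mult mult.assoc)
  then show ?case using c(1) c'(1) by (intro exI[of _ "c * c'"]) simp
qed

lemma foldr_Vmul: "foldr Vmul (map (\<lambda>g. cf (f g)) gs) sone = cf (prod_list (map f gs))"
  by (induction gs) (auto simp: cf_transfer)

lemma Vmul_funpow: "(Vmul (cf a) ^^ k) sone = cf (a ^ k)"
  by (induction k) (auto simp: cf_transfer)

lemma is_hom_prod_list: "is_hom h \<Longrightarrow> h (prod_list l) = prod_list (map h l)"
  by (induction l) (auto simp: is_homD)

lemma is_hom_power: "is_hom h \<Longrightarrow> h (a ^ k) = h a ^ k"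
  by (induction k) (auto simp: is_homD)

lemma mprodV_xs:
  assumes "finite (supp m)" "supp m \<subseteq> GG"
  shows "\<exists>c. c \<noteq> 0 \<and> mprodV (\<lambda>g. cf (xs g)) m = cf (Psi (cn c * mon (rel m)))"
proof -
  let ?gs = "sorted_list_of_set (supp m)"
  have gs: "distinct ?gs" "set ?gs = supp m" using assms(1) by auto
  obtain c where c: "c \<noteq> 0"
    "prod_list (map (\<lambda>g. gn (lab g) ^ m g) ?gs) = cn c * mon (rel (\<lambda>g. if g \<in> set ?gs then m g else 0))"
    using prod_lab[OF gs(1), of m] gs(2) assms(2) by blast
  have "(\<lambda>g. if g \<in> set ?gs then m g else 0) = m" using gs(2) by (auto simp: supp_def)
  then have e: "prod_list (map (\<lambda>g. gn (lab g) ^ m g) ?gs) = cn c * mon (rel m)" using c(2) by simp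
  have "mprodV (\<lambda>g. cf (xs g)) m = cf (prod_list (map (\<lambda>g. xs g ^ m g) ?gs))"
    unfolding mprodV_def Vmul_funpow by (rule foldr_Vmul)
  also have "map (\<lambda>g. xs g ^ m g) ?gs = map Psi (map (\<lambda>g. gn (lab g) ^ m g) ?gs)"
    using gs(2) assms(2) Psi_lab by (auto simp: is_hom_power[OF dhom_hom[OF Psi_dhom]])
  also have "prod_list (map Psi (map (\<lambda>g. gn (lab g) ^ m g) ?gs)) = Psi (cn c * mon (rel m))"
    by (simp only: is_hom_prod_list[OF dhom_hom[OF Psi_dhom], symmetric] e)
  finally show ?thesis using c(1) by blast
qed

text \<open>Evaluation factors as \<open>lift\<close> followed by \<open>Psi\<close>, where
  \<open>lift\<close> renames the labels and corrects by the reordering scalars \<open>c\<close>.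
  Injectivity comes from the left inverse \<open>Theta\<close>; surjectivity from
  \<open>WS_Psi\<close>, by which an invariant involves only type V labels.\<close>

lemma free: "freely_generates GG (\<lambda>g. cf (xs g)) (Wset n)"
proof -
  let ?x = "\<lambda>g. cf (xs g)"
  let ?PP = "polys_on (gparity ?x) GG"
  note HP = is_homD[OF dhom_hom[OF Psi_dhom]]
  have "\<exists>c. finite (supp m) \<and> supp m \<subseteq> GG \<longrightarrow> c \<noteq> 0 \<and> mprodV ?x m = cf (Psi (cn c * mon (rel m)))" for m
    using mprodV_xs by blast
  then obtain c where c: "\<And>m. finite (supp m) \<Longrightarrow> supp m \<subseteq> GG \<Longrightarrow> c m \<noteq> 0 \<and> mprodV ?x m = cf (Psi (cn (c m) * mon (rel m)))"
    by metis
  define lift where "lift = (\<lambda>P. \<Sum>m | P m \<noteq> 0. cn (P m * c m) * mon (rel m))"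
  have PP: "finite {m. P m \<noteq> 0}" "\<And>m. P m \<noteq> 0 \<Longrightarrow> finite (supp m)" "\<And>m. P m \<noteq> 0 \<Longrightarrow> supp m \<subseteq> GG"
    "\<And>m. P m \<noteq> 0 \<Longrightarrow> valid_mono genpar (rel m)" if "P \<in> ?PP" for P
    using that valid_rel unfolding polys_on_def is_poly_def by (auto simp: valid_mono_def)
  have ev: "evalV ?x P = cf (Psi (lift P))" if P: "P \<in> ?PP" for P
  proof
    fix M
    have "evalV ?x P M = (\<Sum>m | P m \<noteq> 0. cf (cn (P m) * Psi (cn (c m) * mon (rel m))) M)"
      unfolding evalV_def using PP(2,3)[OF P] c by (intro sum.cong refl) (simp add: cf_cn_mult)
    also have "\<dots> = cf (Psi (lift P)) M"
      unfolding lift_def is_hom_sum[OF dhom_hom[OF Psi_dhom]] cf_sum[symmetric]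
      by (simp add: HP(2,3) cn_mult mult.assoc)
    finally show "evalV ?x P M = cf (Psi (lift P)) M" .
  qed
  have lift_alg: "lift P \<in> alg (gn ` LBL 0)" if P: "P \<in> ?PP" for P
    unfolding lift_def
  proof (intro alg_sum alg.alg_mult alg.alg_cn mon_alg)
    fix m assume "m \<in> {m. P m \<noteq> 0}"
    then have m: "finite (supp m)" "supp m \<subseteq> GG" using PP[OF P] by auto
    show "finite (supp (rel m))" "supp (rel m) \<subseteq> LBL 0"
      unfolding supp_rel[OF m(2)] using m lab_image by auto
  qed
  have lift_RG: "lift P \<in> alg (gn ` RG)" if P: "P \<in> ?PP" for P
    using lift_alg[OF P] alg_mono[OF image_mono[OF LBL_RG]] by blast
  have lift_cf: "cf (lift P) (rel m) = P m * c m" if P: "P \<in> ?PP" and m: "supp m \<subseteq> GG" for P m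
  proof -
    have "cf (lift P) (rel m) = (\<Sum>x | P x \<noteq> 0. if x = m then P m * c m else 0)"
      unfolding lift_def cf_sum
    proof (intro sum.cong refl)
      fix x assume x: "x \<in> {x. P x \<noteq> 0}"
      then have "rel m = rel x \<longleftrightarrow> x = m" using rel_inj[OF m] PP(3)[OF P] by blast
      then show "cf (cn (P x * c x) * mon (rel x)) (rel m) = (if x = m then P m * c m else 0)"
        using PP(4)[OF P] x by (auto simp: cf_cn_mult cf_mon)
    qed
    also have "\<dots> = P m * c m" using PP(1)[OF P] by (auto simp: sum.delta)
    finally show ?thesis .
  qed
  have hom: "\<forall>g\<in>GG. \<exists>e<2. homog genpar (?x g) e"
    using xs_homog by (auto simp: genpar_def split: prod.splits intro!: exI) 
  have inj: "inj_on (evalV ?x) ?PP"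
  proof (rule inj_onI)
    fix P Q assume P: "P \<in> ?PP" and Q: "Q \<in> ?PP" and eq: "evalV ?x P = evalV ?x Q"
    have "Psi (lift P) = Psi (lift Q)" using eq ev[OF P] ev[OF Q] by (simp add: cf_inject)
    then have l: "lift P = lift Q" using Theta_Psi[OF lift_RG[OF P]] Theta_Psi[OF lift_RG[OF Q]] by metis
    show "P = Q"
    proof
      fix m
      show "P m = Q m"
      proof (cases "supp m \<subseteq> GG \<and> finite (supp m)")
        case True
        then show ?thesis using lift_cf[OF P, of m] lift_cf[OF Q, of m] l c[of m] by simp
      next
        case False
        then have "P m = 0" "Q m = 0" using PP(2,3)[OF P, of m] PP(2,3)[OF Q, of m] by blast+
        then show ?thesis by simp
      qed
    qed
  qed
  have im: "Wset n = evalV ?x ` ?PP"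
  proof (intro equalityI subsetI)
    fix p assume "p \<in> evalV ?x ` ?PP"
    then obtain P where P: "P \<in> ?PP" "p = cf (Psi (lift P))" using ev by auto
    have "Psi (lift P) \<in> alg (range xs)"
    proof (rule alg_hom[OF dhom_hom[OF Psi_dhom] _ lift_alg[OF P(1)]])
      fix s assume "s \<in> gn ` LBL 0"
      then obtain g where "s = gn (lab g)" "g \<in> GG" unfolding lab_image[symmetric] by blast
      then show "Psi s \<in> alg (range xs)" using Psi_lab by (auto intro: alg.alg_gen)
    qed
    moreover have "range xs \<subseteq> WS" using WS_DD_pow[OF wS_WS] by (auto simp: xs_def)
    ultimately have "Psi (lift P) \<in> WS" using WS_alg by blast
    then show "p \<in> Wset n" using P(2) by (auto simp: Wset_cf)
  next
    fix p assume "p \<in> Wset n"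
    then obtain w where w: "p = cf w" "w \<in> WS" by (auto simp: Wset_cf)
    define P0 where "P0 = Theta w"
    have P0: "P0 \<in> alg (gn ` LBL 0)" "Psi P0 = w" using WS_Psi[OF w(2)] by (auto simp: P0_def)
    \<comment> \<open>The inverse of \<open>lift\<close>: rename back and divide by the reordering
      scalar.\<close>
    define P where "P = (\<lambda>m. if supp m \<subseteq> GG then cf P0 (rel m) / c m else 0)"
    have fin: "finite {m. P m \<noteq> 0}"
    proof (rule inj_on_finite[of rel _ "{M. cf P0 M \<noteq> 0}"])
      show "inj_on rel {m. P m \<noteq> 0}" using rel_inj by (auto simp: inj_on_def P_def split: if_splits)
    qed (auto simp: P_def finite_cf)
    have P: "P \<in> ?PP"
      unfolding polys_on_def is_poly_def using fin valid_rel cf_valid[of P0]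
      by (auto simp: P_def split: if_splits)
    have "lift P = P0"
    proof (rule sv_eqI)
      fix M
      show "cf (lift P) M = cf P0 M"
      proof (cases "supp M \<subseteq> LBL 0")
        case True
        define m where "m = (\<lambda>g. if g \<in> GG then M (lab g) else 0)"
        have m: "supp m \<subseteq> GG" by (auto simp: m_def supp_def)
        have "rel m = M"
        proof
          fix h
          show "rel m h = M h"
          proof (cases "h \<in> lab ` GG")
            case True
            then obtain g where "h = lab g" "g \<in> GG" by blast
            then show ?thesis by (simp add: rel_lab m_def)
          next
            case False
            then have "h \<notin> supp M" using \<open>supp M \<subseteq> LBL 0\<close> lab_image by auto
            then show ?thesis using False by (simp add: rel_def supp_def)
          qed
        qed
        moreover have "c m \<noteq> 0 \<or> cf P0 (rel m) = 0"
        proof (cases "cf P0 (rel m) = 0")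
          case False
          then have "finite (supp m)" using valid_rel[OF m] cf_valid by (auto simp: valid_mono_def)
          then show ?thesis using c m by blast
        qed simp
        ultimately show ?thesis using lift_cf[OF P m] m by (auto simp: P_def)
      next
        case False
        then show ?thesis using alg_gn_supp[OF lift_alg[OF P], of M] alg_gn_supp[OF P0(1), of M] by metis
      qed
    qed
    then show "p \<in> evalV ?x ` ?PP" using ev[OF P] P P0(2) w(1) by (intro image_eqI[of _ _ P]) auto
  qed
  show ?thesis unfolding freely_generates_def using hom im inj by blast
qed

end

theorem mainTheorem9:
  fixes n :: nat
  assumes "n \<ge> 1"
  shows "(\<forall>t\<in>{1..4*n+1}. wco n t \<in> Wset n)
    \<and> freely_generates {(t, m). 1 \<le> t \<and> t \<le> 4*n+1 \<and> (t mod 4 = 0 \<or> t mod 4 = 3)}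
        (\<lambda>(t, m). Dpow m (wco n t)) (Wset n)"
proof -
  interpret osp n by (rule osp.intro[OF assms])
  have "wco n t \<in> Wset n" for t
    unfolding wco_cf Wset_cf using wS_WS by blast
  moreover have "(\<lambda>(t, m). Dpow m (wco n t)) = (\<lambda>g. cf (xs g))"
    by (auto simp: wco_cf Dpow_cf xs_def)
  ultimately show ?thesis using free unfolding GG_def N_def by simp
qed

end
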